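(* Let $V$ be a complex vector space of dimension $r$, let $G\subset\mathrm{GL}(V)$ be a complex reflection group, let $N\triangleleft G$ be a normal reflection subgroup, and let $E=V/N$. With the fake degrees $e_i^N(V)$ and $e_i^G(E)$ compatibly indexed (as specified in the context), \[\sum_{g \in G} q^{\mathrm{fix}_V g}\, t^{\mathrm{fix}_{E} g} = \prod_{i=1}^r \left(qt+e_i^N(V)\, t + e_i^G(E)\right)\] as polynomials in $q$ and $t$.
   Context: A reflection is an element of $\mathrm{GL}(V)$ that fixes some hyperplane pointwise. A complex reflection group is a finite subgroup of $\mathrm{GL}(V)$ generated by reflections. A normal reflection subgroup $N$ of $G$ is a normal subgroup of $G$ that is generated by reflections. $S(V^* )$ is the symmetric algebra of $V^*$; degree in its usual grading is called $\mathbf{x}$-degree. The invariant rings $S(V^* )^N$ and $S(V^* )^G$ are polynomial rings on $r$ homogeneous generators (fundamental invariants). The space $E=V/N$. Choose homogeneous algebraically independent generators $N_1,\dots,N_r$ of $S(V^* )^N$ such that $E^*:=\mathrm{span}_{\mathbb{C}}\{N_1,\dots,N_r\}$ is $G$-stable (such a choice exists). The quotient $H=G/N$ acts on $E^*$ and on its dual $E$, and acts on $E$ as a complex reflection group; $G$ acts on $E$ through $H$. The vector space $E$ is identified with $V/N$ since $S(E^* )=S(V^* )^N$. For $g\in G$ and $X\in\{V,E\}$, $\mathrm{fix}_X g=\dim\ker(1-g|_X)$ is the dimension of the fixed space of $g$ acting on $X$. Fake degrees. For a complex reflection group $K\subset\mathrm{GL}(V)$ (here $K=G$ or $N$), let $\mathbb{C}[V]_K=S(V^*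 )/I_+$ be the coinvariant ring, where $I_+$ is the ideal generated by homogeneous $K$-invariants of positive degree, and let $\mathbb{C}[V]_K^j$ be its degree $j$ component. For an $m$-dimensional $K$-module $M$, the fake degrees $e_1^K(M),\dots,e_m^K(M)$ are the nonnegative integers (with multiplicity) defined by $\sum_j \dim\mathrm{Hom}_K(M,\mathbb{C}[V]_K^j)\,q^j=\sum_{i=1}^m q^{e_i^K(M)}$; equivalently, they are the $\mathbf{x}$-degrees of homogeneous generators of $(S(V^* )\otimes M^* )^K$ as a free $S(V^* )^K$-module. Indexing convention. There are fundamental $H$-invariants $H_1,\dots,H_r$, generating $S(E^* )^H=S(V^* )^G$, such that each $H_i$ is homogeneous both as a polynomial in $N_1,\dots,N_r$ (of degree $d_i^H$) and in $\mathbf{x}$-degree (of degree $d_i^G$), and such that the $N_j$ occurring nontrivially in $H_i$ all have the same $\mathbf{x}$-degree, denoted $d_i^N$; the $d_i^N$, $i=1,\dots,r$, are then the degrees of $N_1,\dots,N_r$ in some order. The fake degrees are indexed accordingly: $e_i^N(V)=d_i^N-1$, and $e_i^G(E)$ is the $\mathbf{x}$-degree of the coefficients $\partial H_i/\partial N_k$ of the generator $dH_i=\sum_{k=1}^r\frac{\partial H_i}{\partial N_k}\otimes N_k$ of $(S(V^* )\otimes E^* )^G$, i.e. $e_i^G(E)=d_i^N(d_i^H-1)$. *)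

theory Defs
  imports
    "HOL-Library.Function_Algebras"
    "HOL-Library.Poly_Mapping"
    "HOL-Computational_Algebra.Polynomial"
    "HOL-Computational_Algebra.Formal_Power_Series"
    "HOL-Algebra.Generated_Groups"
    "HOL-Algebra.QuotRing"
    "Jordan_Normal_Form.Missing_VectorSpace"
begin

text \<open>
  Throughout, \<open>scale\<close> is the scalar multiplication of a complex vector space \<open>V\<close> whose vectors are
  all elements of the type \<open>'v\<close>. Function spaces carry the pointwise operations of
  \<^theory>\<open>HOL-Library.Function_Algebras\<close>. The qualified names \<open>Modules.module.span\<close> and
  \<open>Vector_Spaces.vector_space.dim\<close> refer to the type-class based linear algebra of HOL;
  \<open>vectorspace.dim\<close> is the dimension of a vector space given by a module record.
\<close>

subsection \<open>Reflection groups\<close>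

definition GL :: "(complex \<Rightarrow> 'v::ab_group_add \<Rightarrow> 'v) \<Rightarrow> ('v \<Rightarrow> 'v) monoid" where
  "GL scale = \<lparr>carrier = {g. Vector_Spaces.linear scale scale g \<and> bij g}, monoid.mult = (\<circ>), one = id\<rparr>"

definition hyperplane :: "(complex \<Rightarrow> 'v::ab_group_add \<Rightarrow> 'v) \<Rightarrow> 'v set \<Rightarrow> bool" where
  "hyperplane scale U \<longleftrightarrow> Modules.module.subspace scale U \<and>
     Vector_Spaces.vector_space.dim scale U + 1 = Vector_Spaces.vector_space.dim scale UNIV"

text \<open>With this convention the identity is a reflection as soon as \<open>dim V \<ge> 1\<close>.\<close>

definition reflection :: "(complex \<Rightarrow> 'v::ab_group_add \<Rightarrow> 'v) \<Rightarrow> ('v \<Rightarrow> 'v) \<Rightarrow> bool" where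
  "reflection scale s \<longleftrightarrow> s \<in> carrier (GL scale) \<and> (\<exists>U. hyperplane scale U \<and> (\<forall>v\<in>U. s v = v))"

definition generated_by_reflections ::
  "(complex \<Rightarrow> 'v::ab_group_add \<Rightarrow> 'v) \<Rightarrow> ('v \<Rightarrow> 'v) set \<Rightarrow> bool" where
  "generated_by_reflections scale G \<longleftrightarrow>
     (\<exists>R. (\<forall>s\<in>R. reflection scale s) \<and> G = generate (GL scale) R)"

definition complex_reflection_group ::
  "(complex \<Rightarrow> 'v::ab_group_add \<Rightarrow> 'v) \<Rightarrow> ('v \<Rightarrow> 'v) set \<Rightarrow> bool" where
  "complex_reflection_group scale G \<longleftrightarrow>
     finite G \<and> subgroup G (GL scale) \<and> generated_by_reflections scale G"

definition normal_reflection_subgroup ::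
  "(complex \<Rightarrow> 'v::ab_group_add \<Rightarrow> 'v) \<Rightarrow> ('v \<Rightarrow> 'v) set \<Rightarrow> ('v \<Rightarrow> 'v) set \<Rightarrow> bool" where
  "normal_reflection_subgroup scale N G \<longleftrightarrow>
     N \<lhd> (GL scale)\<lparr>carrier := G\<rparr> \<and> generated_by_reflections scale N"

subsection \<open>The symmetric algebra of the dual space\<close>

text \<open>
  As \<open>\<complex>\<close> is infinite, \<open>S(V\<^sup>*)\<close> is the algebra of polynomial functions on \<open>V\<close>; its component of
  degree \<open>j\<close> is spanned by the products of \<open>j\<close> linear functionals.
\<close>

definition fscale :: "complex \<Rightarrow> ('x \<Rightarrow> complex) \<Rightarrow> 'x \<Rightarrow> complex" where
  "fscale c f = (\<lambda>x. c * f x)"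

definition sym_comp :: "(complex \<Rightarrow> 'v::ab_group_add \<Rightarrow> 'v) \<Rightarrow> nat \<Rightarrow> ('v \<Rightarrow> complex) set" where
  "sym_comp scale j = Modules.module.span fscale
     {(\<lambda>v. \<Prod>i<j. l i v) | l. \<forall>i<j. Vector_Spaces.linear scale (*) (l i)}"

definition sym_alg :: "(complex \<Rightarrow> 'v::ab_group_add \<Rightarrow> 'v) \<Rightarrow> ('v \<Rightarrow> complex) set" where
  "sym_alg scale = Modules.module.span fscale (\<Union>j. sym_comp scale j)"

definition sym_ring :: "(complex \<Rightarrow> 'v::ab_group_add \<Rightarrow> 'v) \<Rightarrow> ('v \<Rightarrow> complex) ring" where
  "sym_ring scale = \<lparr>carrier = sym_alg scale, monoid.mult = (*), one = 1, zero = 0, add = (+)\<rparr>"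

text \<open>The left action \<open>(g \<cdot> f)(x) = f(g\<^sup>-\<^sup>1 x)\<close> of an invertible map on functions.\<close>

definition fun_act :: "('x \<Rightarrow> 'x) \<Rightarrow> ('x \<Rightarrow> complex) \<Rightarrow> 'x \<Rightarrow> complex" where
  "fun_act g f = (\<lambda>x. f (inv_into UNIV g x))"

definition invariants :: "('v \<Rightarrow> 'v) set \<Rightarrow> ('v \<Rightarrow> complex) set \<Rightarrow> ('v \<Rightarrow> complex) set" where
  "invariants K A = {f \<in> A. \<forall>g\<in>K. fun_act g f = f}"

subsection \<open>Fundamental invariants\<close>

text \<open>
  A polynomial in the variables \<open>x\<^sub>0, \<dots>, x\<^bsub>r-1\<^esub>\<close> is a finitely supported map sending exponent vectors
  to coefficients.
\<close>

type_synonym mpoly = "(nat \<Rightarrow>\<^sub>0 nat) \<Rightarrow>\<^sub>0 complex"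

definition mpolys :: "nat \<Rightarrow> mpoly set" where
  "mpolys r = {p. \<forall>\<alpha>\<in>Poly_Mapping.keys p. Poly_Mapping.keys \<alpha> \<subseteq> {..<r}}"

definition mpoly_homogeneous :: "nat \<Rightarrow> mpoly \<Rightarrow> nat \<Rightarrow> bool" where
  "mpoly_homogeneous r p d \<longleftrightarrow>
     (\<forall>\<alpha>\<in>Poly_Mapping.keys p. (\<Sum>i<r. Poly_Mapping.lookup \<alpha> i) = d)"

definition occurs_in :: "nat \<Rightarrow> mpoly \<Rightarrow> bool" where
  "occurs_in j p \<longleftrightarrow> (\<exists>\<alpha>\<in>Poly_Mapping.keys p. j \<in> Poly_Mapping.keys \<alpha>)"

definition mpoly_subst :: "nat \<Rightarrow> mpoly \<Rightarrow> (nat \<Rightarrow> 'v \<Rightarrow> complex) \<Rightarrow> 'v \<Rightarrow> complex" where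
  "mpoly_subst r p F = (\<lambda>v. \<Sum>\<alpha>\<in>Poly_Mapping.keys p.
     Poly_Mapping.lookup p \<alpha> * (\<Prod>i<r. F i v ^ Poly_Mapping.lookup \<alpha> i))"

definition alg_independent :: "nat \<Rightarrow> (nat \<Rightarrow> 'v \<Rightarrow> complex) \<Rightarrow> bool" where
  "alg_independent r F \<longleftrightarrow> (\<forall>p\<in>mpolys r. mpoly_subst r p F = 0 \<longrightarrow> p = 0)"

definition fundamental_invariants ::
  "(complex \<Rightarrow> 'v::ab_group_add \<Rightarrow> 'v) \<Rightarrow> ('v \<Rightarrow> 'v) set \<Rightarrow> nat \<Rightarrow> (nat \<Rightarrow> 'v \<Rightarrow> complex) \<Rightarrow>
    (nat \<Rightarrow> nat) \<Rightarrow> bool" where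
  "fundamental_invariants scale K r F d \<longleftrightarrow>
     (\<forall>i<r. F i \<in> invariants K (sym_comp scale (d i))) \<and>
     alg_independent r F \<and>
     invariants K (sym_alg scale) = (\<lambda>p. mpoly_subst r p F) ` mpolys r"

subsection \<open>Fake degrees\<close>

definition coinv_ideal ::
  "(complex \<Rightarrow> 'v::ab_group_add \<Rightarrow> 'v) \<Rightarrow> ('v \<Rightarrow> 'v) set \<Rightarrow> ('v \<Rightarrow> complex) set" where
  "coinv_ideal scale K = Idl\<^bsub>sym_ring scale\<^esub> (\<Union>d\<in>{1..}. invariants K (sym_comp scale d))"

definition coinv_ring ::
  "(complex \<Rightarrow> 'v::ab_group_add \<Rightarrow> 'v) \<Rightarrow> ('v \<Rightarrow> 'v) set \<Rightarrow> ('v \<Rightarrow> complex) set ring" where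
  "coinv_ring scale K = sym_ring scale Quot coinv_ideal scale K"

definition coinv_class ::
  "(complex \<Rightarrow> 'v::ab_group_add \<Rightarrow> 'v) \<Rightarrow> ('v \<Rightarrow> 'v) set \<Rightarrow> ('v \<Rightarrow> complex) \<Rightarrow> ('v \<Rightarrow> complex) set" where
  "coinv_class scale K f = coinv_ideal scale K +>\<^bsub>sym_ring scale\<^esub> f"

definition coinv_comp ::
  "(complex \<Rightarrow> 'v::ab_group_add \<Rightarrow> 'v) \<Rightarrow> ('v \<Rightarrow> 'v) set \<Rightarrow> nat \<Rightarrow> ('v \<Rightarrow> complex) set set" where
  "coinv_comp scale K j = coinv_class scale K ` sym_comp scale j"

text \<open>Scalars act on the coinvariant ring through multiplication by the class of a constant.\<close>

definition coinv_scale ::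
  "(complex \<Rightarrow> 'v::ab_group_add \<Rightarrow> 'v) \<Rightarrow> ('v \<Rightarrow> 'v) set \<Rightarrow> complex \<Rightarrow>
    ('v \<Rightarrow> complex) set \<Rightarrow> ('v \<Rightarrow> complex) set" where
  "coinv_scale scale K c X = coinv_class scale K (\<lambda>_. c) \<otimes>\<^bsub>coinv_ring scale K\<^esub> X"

text \<open>
  \<open>coinv_hom scale K sc M \<rho> j\<close> is the space of \<open>K\<close>-equivariant linear maps from the \<open>K\<close>-module
  \<open>M\<close> (a subspace, with scalar multiplication \<open>sc\<close> and action \<open>\<rho>\<close>) to the component of degree
  \<open>j\<close> of the coinvariant ring. The fields \<open>mult\<close> and \<open>one\<close>, which every module record
  inherits from ring records, play no role in a module.
\<close>

definition coinv_hom ::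
  "(complex \<Rightarrow> 'v::ab_group_add \<Rightarrow> 'v) \<Rightarrow> ('v \<Rightarrow> 'v) set \<Rightarrow>
    (complex \<Rightarrow> 'm::ab_group_add \<Rightarrow> 'm) \<Rightarrow> 'm set \<Rightarrow> (('v \<Rightarrow> 'v) \<Rightarrow> 'm \<Rightarrow> 'm) \<Rightarrow> nat \<Rightarrow>
    (complex, 'm \<Rightarrow> ('v \<Rightarrow> complex) set) module" where
  "coinv_hom scale K sc M \<rho> j =
     \<lparr>carrier = {\<phi> \<in> M \<rightarrow>\<^sub>E coinv_comp scale K j.
        (\<forall>x\<in>M. \<forall>y\<in>M. \<phi> (x + y) = \<phi> x \<oplus>\<^bsub>coinv_ring scale K\<^esub> \<phi> y) \<and>
        (\<forall>c. \<forall>x\<in>M. \<phi> (sc c x) = coinv_scale scale K c (\<phi> x)) \<and>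
        (\<forall>g\<in>K. \<forall>x\<in>M. \<phi> (\<rho> g x) = fun_act g ` \<phi> x)},
      monoid.mult = undefined,
      one = undefined,
      zero = (\<lambda>x\<in>M. \<zero>\<^bsub>coinv_ring scale K\<^esub>),
      add = (\<lambda>\<phi> \<psi>. \<lambda>x\<in>M. \<phi> x \<oplus>\<^bsub>coinv_ring scale K\<^esub> \<psi> x),
      smult = (\<lambda>c \<phi>. \<lambda>x\<in>M. coinv_scale scale K c (\<phi> x))\<rparr>"

definition complex_field :: "complex ring" where
  "complex_field = \<lparr>carrier = UNIV, monoid.mult = (*), one = 1, zero = 0, add = (+)\<rparr>"

text \<open>\<open>e 0, \<dots>, e (dim M - 1)\<close> are the fake degrees of \<open>M\<close>, listed with multiplicity.\<close>

definition fake_degrees ::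
  "(complex \<Rightarrow> 'v::ab_group_add \<Rightarrow> 'v) \<Rightarrow> ('v \<Rightarrow> 'v) set \<Rightarrow>
    (complex \<Rightarrow> 'm::ab_group_add \<Rightarrow> 'm) \<Rightarrow> 'm set \<Rightarrow> (('v \<Rightarrow> 'v) \<Rightarrow> 'm \<Rightarrow> 'm) \<Rightarrow>
    (nat \<Rightarrow> nat) \<Rightarrow> bool" where
  "fake_degrees scale K sc M \<rho> e \<longleftrightarrow>
     Abs_fps (\<lambda>j. int (vectorspace.dim complex_field (coinv_hom scale K sc M \<rho> j))) =
     (\<Sum>i<Vector_Spaces.vector_space.dim sc M. fps_X ^ e i)"

subsection \<open>The space \<open>E = V/N\<close>\<close>

text \<open>
  For a space \<open>U\<close> of functions on \<open>V\<close>, its dual consists of the linear functionals on \<open>U\<close>,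
  extended by \<open>0\<close> outside \<open>U\<close> so that each is represented exactly once.
\<close>

definition fun_dual :: "('v \<Rightarrow> complex) set \<Rightarrow> (('v \<Rightarrow> complex) \<Rightarrow> complex) set" where
  "fun_dual U = {\<phi>. (\<forall>f\<in>U. \<forall>h\<in>U. \<phi> (f + h) = \<phi> f + \<phi> h) \<and>
     (\<forall>c. \<forall>f\<in>U. \<phi> (fscale c f) = c * \<phi> f) \<and> (\<forall>f. f \<notin> U \<longrightarrow> \<phi> f = 0)}"

definition dual_act ::
  "('v \<Rightarrow> 'v) \<Rightarrow> (('v \<Rightarrow> complex) \<Rightarrow> complex) \<Rightarrow> ('v \<Rightarrow> complex) \<Rightarrow> complex" where
  "dual_act g \<phi> = (\<lambda>f. \<phi> (fun_act (inv_into UNIV g) f))"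

text \<open>
  \<open>E_dual r F\<close> is \<open>E\<^sup>*\<close> and \<open>E_space r F\<close> is \<open>E\<close>, for fundamental \<open>N\<close>-invariants \<open>F\<close>. The group \<open>G\<close>
  acts on both through \<open>G/N\<close>, as \<open>N\<close> fixes every \<open>F i\<close>.
\<close>

definition E_dual :: "nat \<Rightarrow> (nat \<Rightarrow> 'v \<Rightarrow> complex) \<Rightarrow> ('v \<Rightarrow> complex) set" where
  "E_dual r F = Modules.module.span fscale (F ` {..<r})"

definition E_space :: "nat \<Rightarrow> (nat \<Rightarrow> 'v \<Rightarrow> complex) \<Rightarrow> (('v \<Rightarrow> complex) \<Rightarrow> complex) set" where
  "E_space r F = fun_dual (E_dual r F)"

definition fix_dim :: "(complex \<Rightarrow> 'm::ab_group_add \<Rightarrow> 'm) \<Rightarrow> 'm set \<Rightarrow> ('m \<Rightarrow> 'm) \<Rightarrow> nat" where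
  "fix_dim sc M a = Vector_Spaces.vector_space.dim sc {x \<in> M. x - a x = 0}"

end

theory Submission
  imports
    Defs
    "HOL-Combinatorics.Permutations"
    "HOL-Computational_Algebra.Polynomial_FPS"
    "HOL-Algebra.Multiplicative_Group"
begin

text \<open>
  Solomon's theorem is proved in a form with a twist: let \<open>K\<close> be a finite group acting linearly
  whose invariant ring is generated by algebraically independent homogeneous \<open>F\<^sub>i\<close> of degrees
  \<open>d\<^sub>i\<close>. Then the invariant polynomial differential forms are free over the invariants on the products
  of the \<open>dF\<^sub>i\<close>. For forms of top degree this follows from Molien's formula under \<open>z \<mapsto> 1/z\<close>, which
  shows that the invariant top forms and the multiples of \<open>dF\<^sub>1 \<dots> dF\<^sub>r\<close> have the same Hilbert series;
  the general case follows by wedging with complementary differentials. Reflections never enter.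
  Comparing the trace of a pair \<open>(g, T)\<close> acting on coefficients and covectors, computed on all forms
  and on invariant forms, gives an identity of rational functions in \<open>z\<close>.

  Applied to \<open>N\<close> acting on \<open>V\<close>, twisted by \<open>g \<in> G\<close>, the limit \<open>z \<rightarrow> 1\<close> yields
  \<open>\<Sum>\<^bsub>x\<in>gN\<^esub> q\<^bsup>fix\<^esup> = \<bar>N\<bar> \<Prod> (q + d\<^sub>i - 1) / d\<^sub>i\<close>, the product running over the eigenvalues \<open>1\<close> of \<open>g\<close>
  on \<open>E\<close>. Applied to \<open>G\<close> acting on \<open>E\<close>, with \<open>T\<close> a scalar on every homogeneous component of \<open>E\<close>, it
  evaluates \<open>\<Sum>\<^bsub>g\<in>G\<^esub> \<Prod> y\<^bsub>d\<^sub>i\<^esub>\<close> over the same eigenvalues for arbitrary weights \<open>y\<^sub>d\<close>, and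
  \<open>y\<^sub>d = t (q + d - 1) / d\<close> gives the theorem up to a constant, which is \<open>1\<close> because only the
  identity fixes all of \<open>V\<close>.
\<close>

text \<open>Counting top forms, instead of factoring the Jacobian into root functionals, also lets
  the group act unfaithfully: \<open>G\<close> acts on \<open>E\<close> with \<open>N\<close> acting
  trivially, and no quotient group has to be formed. The twist decouples covectors from
  coefficients. Letting covectors be moved by \<open>u = y * (1 - z) - 1\<close> times the map on
  coefficients makes an eigenvalue 1 contribute \<open>y * (1 - z) / (1 - z)\<close>, which is
  \<open>y\<close>, while an eigenvalue \<lambda> \<noteq> 1 contributes
  \<open>(1 - \<lambda>) / (1 - \<lambda>)\<close> in the limit. So the limit weighs every fixed
  dimension by \<open>y\<close>. The sum over a coset of \<open>N\<close> involves the degrees of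
  the eigenvectors of \<open>g\<close> in \<open>E\<close>, not merely their number. Hence the
  second application needs one weight per degree; this is possible because all \<open>N_j\<close> in
  one \<open>H_i\<close> share their degree, so that \<open>dH_i\<close> is an eigenvector of the
  degree-dependent scalar. \<open>E\<close> consists of functionals on functions, while the general
  theory wants linear coordinates. As the \<open>N_i\<close> are algebraically independent,
  polynomials in them are formal, and \<open>V\<close> itself can model \<open>E\<close>, the
  coordinate \<open>X i\<close> standing for \<open>N_i\<close>.\<close>

interpretation fs: Vector_Spaces.vector_space "fscale :: complex \<Rightarrow> ('a \<Rightarrow> complex) \<Rightarrow> _"
  by unfold_locales (auto simp: fscale_def fun_eq_iff algebra_simps)

lemma sum_fun_apply: "(\<Sum>i\<in>I. f i) x = (\<Sum>i\<in>I. f i x)"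
  by (induction I rule: infinite_finite_induct) auto

subsection \<open>Indexed bases and traces\<close>

definition lincomb :: "'i set \<Rightarrow> ('i \<Rightarrow> 'a \<Rightarrow> complex) \<Rightarrow> ('i \<Rightarrow> complex) \<Rightarrow> 'a \<Rightarrow> complex" where
  "lincomb J b c = (\<lambda>x. \<Sum>j\<in>J. c j * b j x)"

definition indep_family :: "'i set \<Rightarrow> ('i \<Rightarrow> 'a \<Rightarrow> complex) \<Rightarrow> bool" where
  "indep_family J b \<longleftrightarrow> (\<forall>c. lincomb J b c = 0 \<longrightarrow> (\<forall>j\<in>J. c j = 0))"

text \<open>A basis kept as an indexed family, so that matrices are functions of two indices and
  degrees and eigenvalues can be attached to the index.\<close>

definition frame :: "'i set \<Rightarrow> ('i \<Rightarrow> 'a \<Rightarrow> complex) \<Rightarrow> ('a \<Rightarrow> complex) set \<Rightarrow> bool" where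
  "frame J b W \<longleftrightarrow> finite J \<and> W = range (lincomb J b) \<and> indep_family J b"

lemma lincomb_eq_sum: "lincomb J b c = (\<Sum>j\<in>J. fscale (c j) (b j))"
  by (auto simp: lincomb_def fscale_def fun_eq_iff sum_fun_apply)

lemma indep_familyD:
  assumes "indep_family J b" "\<And>x. (\<Sum>j\<in>J. c j * b j x) = 0" "j \<in> J"
  shows "c j = 0"
  using assms unfolding indep_family_def lincomb_def by (auto simp: fun_eq_iff)

lemma indep_family_coeff_eq:
  assumes "indep_family J b" "lincomb J b c = lincomb J b c'" "j \<in> J"
  shows "c j = c' j"
proof -
  have "c j - c' j = 0"
    by (rule indep_familyD[OF assms(1) _ assms(3), where c = "\<lambda>j. c j - c' j"])
      (use fun_cong[OF assms(2)] in \<open>simp add: lincomb_def algebra_simps sum_subtractf\<close>)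
  then show ?thesis by simp
qed

lemma frame_elem: "frame J b W \<Longrightarrow> j \<in> J \<Longrightarrow> b j \<in> W"
proof -
  assume f: "frame J b W" and j: "j \<in> J"
  then have "b j = lincomb J b (\<lambda>i. if i = j then 1 else 0)"
    by (auto simp: lincomb_def frame_def fun_eq_iff if_distrib[where f = "\<lambda>x. x * _"] cong: if_cong)
  then show "b j \<in> W" using f by (auto simp: frame_def)
qed

lemma frame_coeffs:
  assumes "frame J b W" "\<forall>i\<in>I. f i \<in> W"
  obtains m where "\<And>i. i \<in> I \<Longrightarrow> f i = lincomb J b (\<lambda>j. m j i)"
proof -
  have "\<forall>i\<in>I. \<exists>c. f i = lincomb J b c" using assms by (auto simp: frame_def)
  then obtain c where "\<forall>i\<in>I. f i = lincomb J b (c i)" by metis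
  then show ?thesis by (intro that[of "\<lambda>j i. c i j"]) auto
qed

lemma lincomb_lincomb:
  "lincomb J (\<lambda>j. lincomb I b (\<lambda>i. m i j)) c = lincomb I b (\<lambda>i. \<Sum>j\<in>J. m i j * c j)"
proof
  fix x
  have "(\<Sum>j\<in>J. c j * (\<Sum>i\<in>I. m i j * b i x)) = (\<Sum>j\<in>J. \<Sum>i\<in>I. m i j * c j * b i x)"
    by (simp add: sum_distrib_left mult_ac)
  also have "\<dots> = (\<Sum>i\<in>I. \<Sum>j\<in>J. m i j * c j * b i x)" by (rule sum.swap)
  finally show "lincomb J (\<lambda>j. lincomb I b (\<lambda>i. m i j)) c x = lincomb I b (\<lambda>i. \<Sum>j\<in>J. m i j * c j) x"
    by (simp add: lincomb_def sum_distrib_right)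
qed

lemma lincomb_cong:
  "J = J' \<Longrightarrow> (\<And>j. j \<in> J' \<Longrightarrow> b j = b' j) \<Longrightarrow> (\<And>j. j \<in> J' \<Longrightarrow> c j = c' j) \<Longrightarrow>
    lincomb J b c = lincomb J' b' c'"
  by (auto simp: lincomb_def)

text \<open>
  With \<open>W0 = W\<close> this says that the trace does not depend on the basis; in general it says
  that the trace of a map into a subspace can be computed on that subspace.
\<close>

lemma trace_eq:
  assumes b: "frame J b W" and b0: "frame J0 b0 W0" and sub: "W0 \<subseteq> W"
    and L: "\<And>c. L (lincomb J b c) = lincomb J (\<lambda>j. L (b j)) c"
    and LW: "\<And>j. j \<in> J \<Longrightarrow> L (b j) \<in> W0"
    and m: "\<And>j. j \<in> J \<Longrightarrow> L (b j) = lincomb J b (\<lambda>i. m i j)"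
    and m0: "\<And>j. j \<in> J0 \<Longrightarrow> L (b0 j) = lincomb J0 b0 (\<lambda>i. m0 i j)"
  shows "(\<Sum>j\<in>J. m j j) = (\<Sum>j\<in>J0. m0 j j)"
proof -
  \<comment> \<open>\<open>n\<close> is the matrix of \<open>L\<close> as a map from
    \<open>W\<close> to \<open>W0\<close>, and \<open>s\<close> that of the inclusion of
    \<open>W0\<close>. Then \<open>m\<close> is \<open>s\<close> times \<open>n\<close> and
    \<open>m0\<close> is \<open>n\<close> times \<open>s\<close>, so the traces agree.\<close>
  obtain n where n: "\<And>j. j \<in> J \<Longrightarrow> L (b j) = lincomb J0 b0 (\<lambda>i. n i j)"
    using frame_coeffs[OF b0, of J "\<lambda>j. L (b j)"] LW by blast
  obtain s where s: "\<And>i. i \<in> J0 \<Longrightarrow> b0 i = lincomb J b (\<lambda>j. s j i)"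
    using frame_coeffs[OF b, of J0 b0] frame_elem[OF b0] sub by blast
  have 1: "m i j = (\<Sum>k\<in>J0. s i k * n k j)" if "i \<in> J" "j \<in> J" for i j
  proof (rule indep_family_coeff_eq[of J b "\<lambda>i. m i j" "\<lambda>i. \<Sum>k\<in>J0. s i k * n k j"])
    have "lincomb J b (\<lambda>i. m i j) = lincomb J0 b0 (\<lambda>i. n i j)" using m n that by metis
    also have "\<dots> = lincomb J0 (\<lambda>i. lincomb J b (\<lambda>j. s j i)) (\<lambda>i. n i j)"
      by (rule lincomb_cong) (use s in auto)
    finally show "lincomb J b (\<lambda>i. m i j) = lincomb J b (\<lambda>i. \<Sum>k\<in>J0. s i k * n k j)"
      by (simp add: lincomb_lincomb)
  qed (use b that in \<open>auto simp: frame_def\<close>)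
  have 2: "m0 i j = (\<Sum>k\<in>J. n i k * s k j)" if "i \<in> J0" "j \<in> J0" for i j
  proof (rule indep_family_coeff_eq[of J0 b0 "\<lambda>i. m0 i j" "\<lambda>i. \<Sum>k\<in>J. n i k * s k j"])
    have "lincomb J0 b0 (\<lambda>i. m0 i j) = lincomb J (\<lambda>j. L (b j)) (\<lambda>k. s k j)"
      using m0 s L that by metis
    also have "\<dots> = lincomb J (\<lambda>j. lincomb J0 b0 (\<lambda>i. n i j)) (\<lambda>k. s k j)"
      by (rule lincomb_cong) (use n in auto)
    finally show "lincomb J0 b0 (\<lambda>i. m0 i j) = lincomb J0 b0 (\<lambda>i. \<Sum>k\<in>J. n i k * s k j)"
      by (simp add: lincomb_lincomb)
  qed (use b0 that in \<open>auto simp: frame_def\<close>)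
  have "(\<Sum>j\<in>J. m j j) = (\<Sum>j\<in>J. \<Sum>k\<in>J0. s j k * n k j)" by (simp add: 1)
  also have "\<dots> = (\<Sum>k\<in>J0. \<Sum>j\<in>J. s j k * n k j)" by (rule sum.swap)
  also have "\<dots> = (\<Sum>k\<in>J0. m0 k k)" by (simp add: 2 mult.commute)
  finally show ?thesis .
qed

lemma indep_family_imp_independent:
  assumes "finite J" "indep_family J b"
  shows "inj_on b J" "fs.independent (b ` J)"
proof -
  show inj: "inj_on b J"
  proof (rule inj_onI, rule ccontr)
    fix i j assume ij: "i \<in> J" "j \<in> J" "b i = b j" "i \<noteq> j"
    have "lincomb J b (\<lambda>k. if k = i then 1 else 0) = lincomb J b (\<lambda>k. if k = j then 1 else 0)"
      using assms(1) ij by (simp add: lincomb_def if_distrib[where f = "\<lambda>x. x * _"] cong: if_cong)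
    from indep_family_coeff_eq[OF assms(2) this ij(1)] ij show False by simp
  qed
  show "fs.independent (b ` J)"
  proof
    assume "fs.dependent (b ` J)"
    then obtain u v where u: "v \<in> b ` J" "u v \<noteq> 0" "(\<Sum>v\<in>b ` J. fscale (u v) v) = 0"
      using assms(1) by (auto simp: fs.dependent_finite)
    have "lincomb J b (\<lambda>j. u (b j)) = 0"
      using u(3) by (simp add: sum.reindex[OF inj] lincomb_eq_sum)
    then show False using assms(2) u(1,2) by (auto simp: indep_family_def)
  qed
qed

lemma lincomb_in_span:
  assumes "b ` J \<subseteq> S"
  shows "lincomb J b c \<in> fs.span S"
  unfolding lincomb_eq_sum
  by (rule fs.span_sum, rule fs.span_scale, rule fs.span_base) (use assms in blast)

lemma range_lincomb_eq_span:
  assumes "finite J"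
  shows "range (lincomb J b) = fs.span (b ` J)"
proof (intro subset_antisym subsetI)
  fix w assume "w \<in> range (lincomb J b)"
  then show "w \<in> fs.span (b ` J)" using lincomb_in_span[of b J "b ` J"] by auto
next
  fix w assume "w \<in> fs.span (b ` J)"
  then show "w \<in> range (lincomb J b)"
  proof (induction rule: fs.span_induct_alt)
    case base
    show ?case by (rule image_eqI[where x = "\<lambda>_. 0"]) (auto simp: lincomb_def fun_eq_iff)
  next
    case (step c x y)
    then obtain j d where "j \<in> J" "x = b j" "y = lincomb J b d" by auto
    with assms have "fscale c x + y = lincomb J b (\<lambda>i. (if i = j then c else 0) + d i)"
      by (auto simp: lincomb_def fun_eq_iff fscale_def distrib_right sum.distrib
          if_distrib[where f = "\<lambda>x. x * _"] cong: if_cong)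
    then show ?case by auto
  qed
qed

lemma independent_imp_frame:
  assumes "finite B" "fs.independent B"
  shows "frame B (\<lambda>f. f) (fs.span B)"
  unfolding frame_def
proof (intro conjI)
  show "fs.span B = range (lincomb B (\<lambda>f. f))" using range_lincomb_eq_span[OF assms(1), of "\<lambda>f. f"] by simp
  show "indep_family B (\<lambda>f. f)"
    using assms unfolding indep_family_def lincomb_eq_sum by (auto simp: fs.dependent_finite)
qed (fact assms(1))

text \<open>Used where the dimension of \<open>U\<close> is still to be found: \<open>W\<close>
  bounds the size of independent sets, so extending the known family yields a finite basis.\<close>

lemma frame_extend:
  assumes W: "frame J b W" and U: "fs.subspace U" "U \<subseteq> W"
    and b0: "finite J0" "indep_family J0 b0" "\<And>i. i \<in> J0 \<Longrightarrow> b0 i \<in> U"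
  obtains B where "frame B (\<lambda>f. f) U" "b0 ` J0 \<subseteq> B"
proof -
  from b0 have "b0 ` J0 \<subseteq> U" by auto
  from fs.maximal_independent_subset_extend[OF this indep_family_imp_independent(2)[OF b0(1,2)]]
  obtain B where B: "b0 ` J0 \<subseteq> B" "B \<subseteq> U" "fs.independent B" "U \<subseteq> fs.span B" by blast
  have "B \<subseteq> fs.span (b ` J)"
    using B U W range_lincomb_eq_span[of J b] by (auto simp: frame_def)
  with fs.independent_span_bound[of "b ` J" B] B W have fin: "finite B" by (auto simp: frame_def)
  have "fs.span B = U" using B U by (metis fs.span_minimal subset_antisym)
  with independent_imp_frame[OF fin B(3)] B(1) that show thesis by simp
qed

subsection \<open>Monomials and polynomial algebras\<close>

text \<open>Entries from \<open>r\<close> on are forced to be 0 because \<open>pmono r F\<close>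
  ignores them; with free tails the monomials would repeat and could not be independent.\<close>

definition expos :: "nat \<Rightarrow> (nat \<Rightarrow> nat) set" where
  "expos r = {\<alpha>. \<forall>i\<ge>r. \<alpha> i = 0}"

definition wdeg :: "nat \<Rightarrow> (nat \<Rightarrow> nat) \<Rightarrow> (nat \<Rightarrow> nat) \<Rightarrow> nat" where
  "wdeg r d \<alpha> = (\<Sum>i<r. \<alpha> i * d i)"

definition expos_deg :: "nat \<Rightarrow> (nat \<Rightarrow> nat) \<Rightarrow> nat \<Rightarrow> (nat \<Rightarrow> nat) set" where
  "expos_deg r d j = {\<alpha> \<in> expos r. wdeg r d \<alpha> = j}"

definition pmono :: "nat \<Rightarrow> (nat \<Rightarrow> 'a \<Rightarrow> complex) \<Rightarrow> (nat \<Rightarrow> nat) \<Rightarrow> 'a \<Rightarrow> complex" where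
  "pmono r F \<alpha> = (\<lambda>v. \<Prod>i<r. F i v ^ \<alpha> i)"

definition polyalg :: "nat \<Rightarrow> (nat \<Rightarrow> 'a \<Rightarrow> complex) \<Rightarrow> ('a \<Rightarrow> complex) set" where
  "polyalg r F = fs.span (pmono r F ` expos r)"

definition algind :: "nat \<Rightarrow> (nat \<Rightarrow> 'a \<Rightarrow> complex) \<Rightarrow> bool" where
  "algind r F \<longleftrightarrow> (\<forall>A. finite A \<longrightarrow> A \<subseteq> expos r \<longrightarrow> indep_family A (pmono r F))"

lemma finite_expos_deg:
  assumes "\<And>i. i < r \<Longrightarrow> d i \<ge> 1"
  shows "finite (expos_deg r d j)"
proof (rule finite_subset)
  show "expos_deg r d j \<subseteq> {\<alpha>. \<forall>i. (i \<in> {..<r} \<longrightarrow> \<alpha> i \<in> {..j}) \<and> (i \<notin> {..<r} \<longrightarrow> \<alpha> i = 0)}"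
  proof
    fix \<alpha> assume a: "\<alpha> \<in> expos_deg r d j"
    have "\<alpha> i \<le> j" if "i < r" for i
    proof -
      have "\<alpha> i \<le> \<alpha> i * d i" using assms[OF that] by simp
      also have "\<dots> \<le> (\<Sum>i<r. \<alpha> i * d i)" using that by (intro member_le_sum) auto
      finally show ?thesis using a by (simp add: expos_deg_def wdeg_def)
    qed
    then show "\<alpha> \<in> {\<alpha>. \<forall>i. (i \<in> {..<r} \<longrightarrow> \<alpha> i \<in> {..j}) \<and> (i \<notin> {..<r} \<longrightarrow> \<alpha> i = 0)}"
      using a by (auto simp: expos_deg_def expos_def)
  qed
  show "finite {\<alpha>. \<forall>i. (i \<in> {..<r} \<longrightarrow> \<alpha> i \<in> {..j}) \<and> (i \<notin> {..<r} \<longrightarrow> \<alpha> i = (0::nat))}"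
    by (rule finite_set_of_finite_funs) auto
qed

lemma pmono_mult: "pmono r F \<alpha> v * pmono r F \<beta> v = pmono r F (\<lambda>i. \<alpha> i + \<beta> i) v"
  by (simp add: pmono_def power_add prod.distrib)

lemma pmono_zero [simp]: "pmono r F (\<lambda>_. 0) = (\<lambda>_. 1)"
  by (simp add: pmono_def)

lemma pmono_unit: "i < r \<Longrightarrow> pmono r F ((\<lambda>_. 0)(i := 1)) = F i"
  by (auto simp: pmono_def fun_upd_def if_distrib[where f = "\<lambda>n. _ ^ n"] cong: if_cong)

lemma polyalg_explicit:
  "f \<in> polyalg r F \<longleftrightarrow> (\<exists>A c. finite A \<and> A \<subseteq> expos r \<and> f = lincomb A (pmono r F) c)"
proof
  assume "f \<in> polyalg r F"
  then obtain t u where t: "finite t" "t \<subseteq> pmono r F ` expos r" "f = (\<Sum>a\<in>t. fscale (u a) a)"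
    unfolding polyalg_def fs.span_explicit by blast
  from t(2) obtain A where A: "A \<subseteq> expos r" "inj_on (pmono r F) A" "t = pmono r F ` A"
    by (auto simp: subset_image_inj)
  have "f = lincomb A (pmono r F) (\<lambda>\<alpha>. u (pmono r F \<alpha>))"
    using t(3) A by (simp add: sum.reindex lincomb_eq_sum)
  then show "\<exists>A c. finite A \<and> A \<subseteq> expos r \<and> f = lincomb A (pmono r F) c"
    using A t(1) finite_image_iff by blast
next
  assume "\<exists>A c. finite A \<and> A \<subseteq> expos r \<and> f = lincomb A (pmono r F) c"
  then show "f \<in> polyalg r F"
    unfolding polyalg_def using lincomb_in_span[of "pmono r F"] by (metis image_mono)
qed

lemma polyalg_add: "f \<in> polyalg r F \<Longrightarrow> g \<in> polyalg r F \<Longrightarrow> (\<lambda>v. f v + g v) \<in> polyalg r F"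
  using fs.span_add[of f "pmono r F ` expos r" g] by (simp add: polyalg_def plus_fun_def)

lemma polyalg_scale: "f \<in> polyalg r F \<Longrightarrow> (\<lambda>v. c * f v) \<in> polyalg r F"
  using fs.span_scale[of f "pmono r F ` expos r" c] by (simp add: polyalg_def fscale_def)

lemma polyalg_const: "(\<lambda>_. c) \<in> polyalg r F"
proof -
  have "pmono r F (\<lambda>_. 0) \<in> polyalg r F"
    unfolding polyalg_def by (intro fs.span_base imageI) (auto simp: expos_def)
  from polyalg_scale[OF this, of c] show ?thesis by simp
qed

lemma polyalg_gen: "i < r \<Longrightarrow> F i \<in> polyalg r F"
proof -
  assume i: "i < r"
  then have "pmono r F ((\<lambda>_. 0)(i := 1)) \<in> polyalg r F"
    unfolding polyalg_def using i by (intro fs.span_base imageI) (auto simp: expos_def)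
  then show ?thesis unfolding pmono_unit[OF i] .
qed

lemma polyalg_mult:
  assumes "f \<in> polyalg r F" "g \<in> polyalg r F"
  shows "(\<lambda>v. f v * g v) \<in> polyalg r F"
proof -
  obtain A c B d where A: "finite A" "A \<subseteq> expos r" "f = lincomb A (pmono r F) c"
    and B: "finite B" "B \<subseteq> expos r" "g = lincomb B (pmono r F) d"
    using assms by (auto simp: polyalg_explicit)
  have "(\<lambda>v. f v * g v) = (\<Sum>\<alpha>\<in>A. \<Sum>\<beta>\<in>B. fscale (c \<alpha> * d \<beta>) (pmono r F (\<lambda>i. \<alpha> i + \<beta> i)))"
    by (auto simp: A B lincomb_def sum_product fun_eq_iff sum_fun_apply fscale_def pmono_mult[symmetric] mult_ac)
  moreover have "\<dots> \<in> polyalg r F" unfolding polyalg_def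
    using A(2) B(2) by (intro fs.span_sum fs.span_scale fs.span_base imageI) (auto simp: expos_def)
  ultimately show ?thesis by simp
qed

lemma polyalg_sum: "(\<And>i. i \<in> I \<Longrightarrow> f i \<in> polyalg r F) \<Longrightarrow> (\<lambda>v. \<Sum>i\<in>I. f i v) \<in> polyalg r F"
  by (induction I rule: infinite_finite_induct) (auto intro: polyalg_const polyalg_add)

lemma polyalg_prod: "(\<And>i. i \<in> I \<Longrightarrow> f i \<in> polyalg r F) \<Longrightarrow> (\<lambda>v. \<Prod>i\<in>I. f i v) \<in> polyalg r F"
  by (induction I rule: infinite_finite_induct) (auto intro: polyalg_const polyalg_mult)

lemma polyalg_power: "f \<in> polyalg r F \<Longrightarrow> (\<lambda>v. f v ^ n) \<in> polyalg r F"
  by (induction n) (auto intro: polyalg_const polyalg_mult)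

lemma polyalg_lincomb: "(\<And>i. i \<in> I \<Longrightarrow> f i \<in> polyalg r F) \<Longrightarrow> lincomb I f c \<in> polyalg r F"
  unfolding lincomb_def by (intro polyalg_sum polyalg_scale)

lemma polyalg_pmono: "(\<And>i. i < r \<Longrightarrow> f i \<in> polyalg s F) \<Longrightarrow> pmono r f \<alpha> \<in> polyalg s F"
  unfolding pmono_def by (intro polyalg_prod polyalg_power) auto

lemma polyalg_subset: "(\<And>i. i < r \<Longrightarrow> f i \<in> polyalg s F) \<Longrightarrow> polyalg r f \<subseteq> polyalg s F"
  by (auto simp: polyalg_explicit[of _ r] intro!: polyalg_lincomb polyalg_pmono)

lemma mpoly_subst_eq_pmono:
  "mpoly_subst r p F v =
    (\<Sum>\<alpha>\<in>Poly_Mapping.keys p. Poly_Mapping.lookup p \<alpha> * pmono r F (Poly_Mapping.lookup \<alpha>) v)"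
  by (simp add: mpoly_subst_def pmono_def)

lemma mpoly_subst_mem_polyalg:
  assumes "\<And>i. i < r \<Longrightarrow> f i \<in> polyalg s F"
  shows "mpoly_subst r p f \<in> polyalg s F"
proof -
  have "mpoly_subst r p f = (\<lambda>v. \<Sum>\<alpha>\<in>Poly_Mapping.keys p.
      Poly_Mapping.lookup p \<alpha> * pmono r f (Poly_Mapping.lookup \<alpha>) v)"
    by (simp add: fun_eq_iff mpoly_subst_eq_pmono)
  then show ?thesis using assms by (auto intro!: polyalg_sum polyalg_scale polyalg_pmono)
qed

text \<open>Converts combinations of monomials to formal polynomials. The witness serves every
  \<open>F\<close>, and its coefficients can be read back, so that \<open>p = 0\<close> forces
  \<open>c\<close> to vanish on \<open>A\<close>.\<close>

lemma obtain_mpoly: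
  assumes "finite A" "A \<subseteq> expos r"
  obtains p where "p \<in> mpolys r" "\<And>F :: nat \<Rightarrow> 'a \<Rightarrow> complex. mpoly_subst r p F = lincomb A (pmono r F) c"
    "\<And>\<alpha>. \<alpha> \<in> A \<Longrightarrow> Poly_Mapping.lookup p (Poly_Mapping.Abs_poly_mapping \<alpha>) = c \<alpha>"
proof -
  define B where "B = {m :: nat \<Rightarrow>\<^sub>0 nat. Poly_Mapping.lookup m \<in> A}"
  have inj: "inj_on Poly_Mapping.lookup B" by (auto simp: inj_on_def)
  have lookup_Abs: "Poly_Mapping.lookup (Poly_Mapping.Abs_poly_mapping \<alpha>) = \<alpha>" if "\<alpha> \<in> expos r" for \<alpha>
  proof (rule lookup_Abs_poly_mapping)
    have "{x. \<alpha> x \<noteq> 0} \<subseteq> {..<r}"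
    proof
      fix x assume "x \<in> {x. \<alpha> x \<noteq> 0}"
      with that show "x \<in> {..<r}" by (cases "x < r") (auto simp: expos_def)
    qed
    then show "finite {x. \<alpha> x \<noteq> 0}" by (rule finite_subset) simp
  qed
  have img: "Poly_Mapping.lookup ` B = A"
  proof
    show "A \<subseteq> Poly_Mapping.lookup ` B"
    proof
      fix \<alpha> assume "\<alpha> \<in> A"
      then have "Poly_Mapping.lookup (Poly_Mapping.Abs_poly_mapping \<alpha>) = \<alpha>" using lookup_Abs assms by auto
      then show "\<alpha> \<in> Poly_Mapping.lookup ` B"
        using \<open>\<alpha> \<in> A\<close> unfolding B_def by (metis (mono_tags, lifting) imageI mem_Collect_eq)
    qed
  qed (auto simp: B_def)
  have finB: "finite B" using assms(1) img inj by (metis finite_image_iff)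
  define p where "p = Poly_Mapping.Abs_poly_mapping (\<lambda>m. if m \<in> B then c (Poly_Mapping.lookup m) else 0)"
  have p: "Poly_Mapping.lookup p = (\<lambda>m. if m \<in> B then c (Poly_Mapping.lookup m) else 0)"
    unfolding p_def by (rule lookup_Abs_poly_mapping) (rule finite_subset[OF _ finB], auto)
  have keys: "Poly_Mapping.keys p \<subseteq> B" by (auto simp: in_keys_iff p split: if_splits)
  show thesis
  proof
    show "p \<in> mpolys r"
      unfolding mpolys_def
    proof safe
      fix m i assume m: "m \<in> Poly_Mapping.keys p" "i \<in> Poly_Mapping.keys m"
      then have "Poly_Mapping.lookup m \<in> expos r" using keys assms by (auto simp: B_def)
      with m(2) show "i < r" by (cases "i < r") (auto simp: expos_def in_keys_iff)
    qed
    show "mpoly_subst r p F = lincomb A (pmono r F) c" for F :: "nat \<Rightarrow> 'a \<Rightarrow> complex"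
    proof
      fix v
      have "mpoly_subst r p F v = (\<Sum>m\<in>B. Poly_Mapping.lookup p m * pmono r F (Poly_Mapping.lookup m) v)"
        unfolding mpoly_subst_eq_pmono by (rule sum.mono_neutral_left[OF finB keys]) (auto simp: in_keys_iff)
      also have "\<dots> = (\<Sum>m\<in>B. c (Poly_Mapping.lookup m) * pmono r F (Poly_Mapping.lookup m) v)"
        by (rule sum.cong) (auto simp: p)
      also have "\<dots> = lincomb A (pmono r F) c v"
        unfolding lincomb_def img[symmetric] by (simp add: sum.reindex[OF inj])
      finally show "mpoly_subst r p F v = lincomb A (pmono r F) c v" .
    qed
    show "Poly_Mapping.lookup p (Poly_Mapping.Abs_poly_mapping \<alpha>) = c \<alpha>" if "\<alpha> \<in> A" for \<alpha>
      using that assms lookup_Abs by (auto simp: p B_def)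
  qed
qed

lemma mpoly_subst_image:
  fixes F :: "nat \<Rightarrow> 'a \<Rightarrow> complex"
  shows "(\<lambda>p. mpoly_subst r p F) ` mpolys r = polyalg r F"
proof (intro subset_antisym subsetI)
  fix f assume "f \<in> polyalg r F"
  then obtain A c where A: "finite A" "A \<subseteq> expos r" "f = lincomb A (pmono r F) c"
    by (auto simp: polyalg_explicit)
  show "f \<in> (\<lambda>p. mpoly_subst r p F) ` mpolys r"
  proof (rule obtain_mpoly[OF A(1,2), where c = c and 'a = 'a])
    fix p assume p: "p \<in> mpolys r" "\<And>F :: nat \<Rightarrow> 'a \<Rightarrow> complex. mpoly_subst r p F = lincomb A (pmono r F) c"
    show ?thesis by (rule image_eqI[OF _ p(1)]) (simp add: p(2) A(3))
  qed
next
  fix f assume "f \<in> (\<lambda>p. mpoly_subst r p F) ` mpolys r"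
  then obtain p where p: "f = mpoly_subst r p F" by blast
  show "f \<in> polyalg r F" unfolding p by (rule mpoly_subst_mem_polyalg) (rule polyalg_gen)
qed

lemma alg_independent_imp_algind:
  fixes F :: "nat \<Rightarrow> 'a \<Rightarrow> complex"
  assumes "alg_independent r F"
  shows "algind r F"
  unfolding algind_def indep_family_def
proof (intro allI impI ballI)
  fix A c \<alpha> assume A: "finite A" "A \<subseteq> expos r" "lincomb A (pmono r F) c = 0" "\<alpha> \<in> A"
  show "c \<alpha> = 0"
  proof (rule obtain_mpoly[OF A(1,2), where c = c and 'a = 'a])
    fix p assume p: "p \<in> mpolys r" "\<And>F :: nat \<Rightarrow> 'a \<Rightarrow> complex. mpoly_subst r p F = lincomb A (pmono r F) c"
      "\<And>\<alpha>. \<alpha> \<in> A \<Longrightarrow> Poly_Mapping.lookup p (Poly_Mapping.Abs_poly_mapping \<alpha>) = c \<alpha>"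
    have "mpoly_subst r p F = 0" using p(2) A(3) by simp
    moreover have "\<forall>p\<in>mpolys r. mpoly_subst r p F = 0 \<longrightarrow> p = 0"
      using assms by (simp only: alg_independent_def)
    ultimately have "p = 0" using p(1) by simp
    with p(3)[OF A(4)] show "c \<alpha> = 0" by simp
  qed
qed

text \<open>Induction on the number of variables: with the others fixed, the sum is a polynomial in
  the last variable that vanishes identically, and its coefficient of degree
  \<open>\<alpha> r\<close> is a sum over the fibre \<open>B\<close>. The second assumption, unlike
  membership in \<open>expos\<close>, passes to fibres.\<close>

lemma monomials_indep:
  fixes c :: "(nat \<Rightarrow> nat) \<Rightarrow> complex"
  assumes "finite A" "\<forall>\<alpha>\<in>A. \<forall>\<beta>\<in>A. (\<forall>i<r. \<alpha> i = \<beta> i) \<longrightarrow> \<alpha> = \<beta>"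
    and "\<forall>y. (\<Sum>\<alpha>\<in>A. c \<alpha> * (\<Prod>i<r. y i ^ \<alpha> i)) = 0" and "\<alpha> \<in> A"
  shows "c \<alpha> = 0"
  using assms
proof (induction r arbitrary: A)
  case 0
  then have "A = {\<alpha>}" by blast
  with 0(3) show ?case by simp
next
  case (Suc r)
  define B where "B = {\<beta> \<in> A. \<beta> r = \<alpha> r}"
  show ?case
  proof (rule Suc.IH[of B])
    show "finite B" "\<alpha> \<in> B" using Suc.prems by (auto simp: B_def)
    show "\<forall>\<beta>\<in>B. \<forall>\<gamma>\<in>B. (\<forall>i<r. \<beta> i = \<gamma> i) \<longrightarrow> \<beta> = \<gamma>"
      using Suc.prems(2) by (auto simp: B_def less_Suc_eq)
    show "\<forall>y. (\<Sum>\<beta>\<in>B. c \<beta> * (\<Prod>i<r. y i ^ \<beta> i)) = 0"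
    proof
      fix y :: "nat \<Rightarrow> complex"
      define p where "p = (\<Sum>\<beta>\<in>A. Polynomial.monom (c \<beta> * (\<Prod>i<r. y i ^ \<beta> i)) (\<beta> r))"
      have "poly p s = 0" for s
      proof -
        have "poly p s = (\<Sum>\<beta>\<in>A. c \<beta> * (\<Prod>i<Suc r. (y(r := s)) i ^ \<beta> i))"
          by (simp add: p_def poly_sum poly_monom mult_ac)
        with Suc.prems(3)[rule_format, of "y(r := s)"] show ?thesis by simp
      qed
      then have "p = 0" by (simp add: poly_eq_poly_eq_iff[symmetric] fun_eq_iff)
      then have "0 = Polynomial.coeff p (\<alpha> r)" by simp
      also have "\<dots> = (\<Sum>\<beta>\<in>A. if \<beta> r = \<alpha> r then c \<beta> * (\<Prod>i<r. y i ^ \<beta> i) else 0)"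
        by (simp add: p_def coeff_sum)
      also have "\<dots> = (\<Sum>\<beta>\<in>B. c \<beta> * (\<Prod>i<r. y i ^ \<beta> i))"
        using Suc.prems(1) by (simp add: B_def sum.inter_filter)
      finally show "(\<Sum>\<beta>\<in>B. c \<beta> * (\<Prod>i<r. y i ^ \<beta> i)) = 0" by simp
    qed
  qed
qed

lemma expos_eqI: "\<alpha> \<in> expos r \<Longrightarrow> \<beta> \<in> expos r \<Longrightarrow> (\<And>i. i < r \<Longrightarrow> \<alpha> i = \<beta> i) \<Longrightarrow> \<alpha> = \<beta>"
  unfolding expos_def by (rule ext) (metis (mono_tags) leI mem_Collect_eq)

lemma has_field_derivative_poly_comp:
  assumes "\<And>t. f t = poly p t"
  shows "(f has_field_derivative poly (pderiv p) a) (at a)"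
proof -
  have "f = poly p" using assms by auto
  then show ?thesis by (auto intro: poly_DERIV)
qed

section \<open>Linear functionals, coordinates and dual bases\<close>

locale coordinate_space = finite_dimensional_vector_space scale Basis
  for scale :: "complex \<Rightarrow> 'v::ab_group_add \<Rightarrow> 'v" and Basis +
  fixes r :: nat and X :: "nat \<Rightarrow> 'v \<Rightarrow> complex" and e :: "nat \<Rightarrow> 'v"
  assumes X_linear: "\<And>i. i < r \<Longrightarrow> Vector_Spaces.linear scale (*) (X i)"
    and X_e: "\<And>i j. i < r \<Longrightarrow> j < r \<Longrightarrow> X i (e j) = (if i = j then 1 else 0)"
    and X_expand: "\<And>v. v = (\<Sum>i<r. scale (X i v) (e i))"
begin

abbreviation "linf l \<equiv> Vector_Spaces.linear scale (*) l"
abbreviation "linm A \<equiv> Vector_Spaces.linear scale scale A"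

lemma linf_iff: "linf l \<longleftrightarrow> (\<forall>x y. l (x + y) = l x + l y) \<and> (\<forall>c x. l (scale c x) = c * l x)"
proof -
  have "Vector_Spaces.vector_space ((*) :: complex \<Rightarrow> complex \<Rightarrow> complex)"
    by unfold_locales (auto simp: algebra_simps)
  then show ?thesis
    by (auto simp: Vector_Spaces.linear_iff vector_space_axioms)
qed

lemma linm_iff: "linm A \<longleftrightarrow> (\<forall>x y. A (x + y) = A x + A y) \<and> (\<forall>c x. A (scale c x) = scale c (A x))"
  by (auto simp: Vector_Spaces.linear_iff vector_space_axioms)

lemma linf_add: "linf l \<Longrightarrow> l (x + y) = l x + l y"
  and linf_scale: "linf l \<Longrightarrow> l (scale c x) = c * l x"
  by (auto simp: linf_iff)

lemma linm_add: "linm A \<Longrightarrow> A (x + y) = A x + A y"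
  and linm_scale: "linm A \<Longrightarrow> A (scale c x) = scale c (A x)"
  by (auto simp: linm_iff)

lemma linf_zero: "linf l \<Longrightarrow> l 0 = 0"
  using linf_scale[of l 0 0] by simp

lemma linf_minus: "linf l \<Longrightarrow> l (- x) = - l x"
  using linf_scale[of l "-1" x] by (simp add: scale_minus_left)

lemma linf_diff: "linf l \<Longrightarrow> l (x - y) = l x - l y"
  using linf_add[of l x "- y"] by (simp add: linf_minus)

lemma linf_sum: "linf l \<Longrightarrow> l (\<Sum>i\<in>I. f i) = (\<Sum>i\<in>I. l (f i))"
  by (induction I rule: infinite_finite_induct) (auto simp: linf_zero linf_add)

lemma linf_comp: "linf l \<Longrightarrow> linm A \<Longrightarrow> linf (\<lambda>v. l (A v))"
  by (auto simp: linf_iff linm_iff)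

lemma linf_lincomb: "(\<And>i. i \<in> I \<Longrightarrow> linf (f i)) \<Longrightarrow> linf (lincomb I f c)"
  by (auto simp: lincomb_def linf_iff sum.distrib distrib_left sum_distrib_left mult_ac intro!: sum.cong)

text \<open>As \<open>r\<close> is the dimension of \<open>V\<close>, having 0 as the only common
  zero makes \<open>r\<close> functionals a basis of the dual space. For differentials at a point
  this kernel condition is the form that can be checked directly.\<close>

definition cobasis :: "(nat \<Rightarrow> 'v \<Rightarrow> complex) \<Rightarrow> bool" where
  "cobasis Y \<longleftrightarrow> (\<forall>i<r. linf (Y i)) \<and> (\<forall>v. (\<forall>i<r. Y i v = 0) \<longrightarrow> v = 0)"

definition dual_basis :: "(nat \<Rightarrow> 'v \<Rightarrow> complex) \<Rightarrow> (nat \<Rightarrow> 'v) \<Rightarrow> bool" where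
  "dual_basis Y f \<longleftrightarrow> (\<forall>i<r. \<forall>j<r. Y i (f j) = (if i = j then 1 else 0)) \<and>
     (\<forall>v. v = (\<Sum>i<r. scale (Y i v) (f i)))"

lemma cobasis_X: "cobasis X"
  unfolding cobasis_def
proof (intro conjI allI impI)
  fix v assume "\<forall>i<r. X i v = 0"
  then have "(\<Sum>i<r. scale (X i v) (e i)) = 0" by simp
  with X_expand[of v] show "v = 0" by simp
qed (use X_linear in auto)

lemma cobasis_linf: "cobasis Y \<Longrightarrow> i < r \<Longrightarrow> linf (Y i)"
  by (simp add: cobasis_def)

text \<open>The endomorphism \<open>L\<close> with coordinates \<open>Y i\<close> is injective by
  the kernel condition and hence surjective; preimages of the \<open>e j\<close> form the dual
  basis.\<close>

lemma cobasis_dual: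
  assumes "cobasis Y"
  obtains f where "dual_basis Y f"
proof -
  have Y: "linf (Y i)" if "i < r" for i using assms that by (auto simp: cobasis_def)
  define L where "L v = (\<Sum>i<r. scale (Y i v) (e i))" for v
  have L: "linm L"
    unfolding linm_iff L_def
    by (auto simp: linf_add[OF Y] linf_scale[OF Y] scale_left_distrib sum.distrib scale_sum_right
        intro!: sum.cong)
  have XL: "X i (L v) = Y i v" if "i < r" for i v
  proof -
    have "X i (L v) = (\<Sum>j<r. Y j v * X i (e j))"
      using that by (simp add: L_def linf_sum[OF X_linear] linf_scale[OF X_linear])
    also have "\<dots> = (\<Sum>j<r. if i = j then Y j v else 0)" using that by (intro sum.cong) (auto simp: X_e)
    finally show ?thesis using that by simp
  qed
  have "inj L"
  proof (rule injI)
    fix x y assume "L x = L y"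
    then have "Y i (x - y) = 0" if "i < r" for i
      using XL[OF that, of x] XL[OF that, of y] Y[OF that] that by (simp add: linf_diff)
    with assms have "x - y = 0" unfolding cobasis_def by blast
    then show "x = y" by simp
  qed
  with L have "surj L" by (rule linear_inj_imp_surj)
  define f where "f j = inv_into UNIV L (e j)" for j
  have f: "L (f j) = e j" for j unfolding f_def using \<open>surj L\<close> by (rule surj_f_inv_f)
  have 1: "Y i (f j) = (if i = j then 1 else 0)" if "i < r" "j < r" for i j
    using XL[of i "f j"] X_e that f by simp
  have 2: "v = (\<Sum>i<r. scale (Y i v) (f i))" for v
  proof -
    have "Y k (v - (\<Sum>i<r. scale (Y i v) (f i))) = 0" if "k < r" for k
    proof -
      have "Y k (\<Sum>i<r. scale (Y i v) (f i)) = (\<Sum>i<r. Y i v * Y k (f i))"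
        by (simp add: linf_sum[OF Y[OF that]] linf_scale[OF Y[OF that]])
      also have "\<dots> = (\<Sum>i<r. if k = i then Y i v else 0)" using that by (intro sum.cong) (auto simp: 1)
      finally show ?thesis using that by (simp add: linf_diff[OF Y[OF that]])
    qed
    with assms have "v - (\<Sum>i<r. scale (Y i v) (f i)) = 0" unfolding cobasis_def by blast
    then show ?thesis by (rule eq_iff_diff_eq_0[THEN iffD2])
  qed
  have "dual_basis Y f" unfolding dual_basis_def
    by (intro conjI allI impI) (rule 1, assumption+, rule 2)
  then show thesis by (rule that)
qed

lemma dual_basis_combination:
  assumes "cobasis Y" "dual_basis Y f" "i < r"
  shows "Y i (\<Sum>k<r. scale (y k) (f k)) = y i"
proof -
  have l: "linf (Y i)" using assms by (simp add: cobasis_def)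
  have "Y i (\<Sum>k<r. scale (y k) (f k)) = (\<Sum>k<r. y k * Y i (f k))"
    by (simp add: linf_sum[OF l] linf_scale[OF l])
  also have "\<dots> = (\<Sum>k<r. if i = k then y k else 0)"
    using assms by (intro sum.cong) (auto simp: dual_basis_def)
  finally show ?thesis using assms(3) by simp
qed

lemma linf_expand:
  assumes "dual_basis Y f" "linf l"
  shows "l v = (\<Sum>i<r. l (f i) * Y i v)"
proof -
  have "v = (\<Sum>i<r. scale (Y i v) (f i))" using assms(1) unfolding dual_basis_def by blast
  then have "l v = l (\<Sum>i<r. scale (Y i v) (f i))" by (rule arg_cong)
  then show ?thesis by (simp add: linf_sum[OF assms(2)] linf_scale[OF assms(2)] mult.commute)
qed

text \<open>A dual basis supplies points at which the \<open>Y i\<close> take arbitrary prescribed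
  values, which reduces the claim to formal monomials.\<close>

lemma algind_cobasis:
  assumes "cobasis Y"
  shows "algind r Y"
  unfolding algind_def indep_family_def
proof (intro allI impI)
  fix A c assume A: "finite A" "A \<subseteq> expos r" "lincomb A (pmono r Y) c = 0"
  obtain f where f: "dual_basis Y f" using cobasis_dual[OF assms] .
  have 1: "(\<Sum>\<alpha>\<in>A. c \<alpha> * (\<Prod>i<r. y i ^ \<alpha> i)) = 0" for y
  proof -
    have "0 = lincomb A (pmono r Y) c (\<Sum>k<r. scale (y k) (f k))" using A(3) by simp
    also have "\<dots> = (\<Sum>\<alpha>\<in>A. c \<alpha> * (\<Prod>i<r. y i ^ \<alpha> i))"
      by (simp add: lincomb_def pmono_def dual_basis_combination[OF assms f])
    finally show ?thesis by simp
  qed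
  have 2: "\<forall>\<alpha>\<in>A. \<forall>\<beta>\<in>A. (\<forall>i<r. \<alpha> i = \<beta> i) \<longrightarrow> \<alpha> = \<beta>"
  proof (intro ballI impI)
    fix \<beta> \<gamma> assume "\<beta> \<in> A" "\<gamma> \<in> A" "\<forall>i<r. \<beta> i = \<gamma> i"
    with A(2) show "\<beta> = \<gamma>" by (intro expos_eqI[of \<beta> r \<gamma>]) auto
  qed
  show "\<forall>\<alpha>\<in>A. c \<alpha> = 0"
  proof
    fix \<alpha> assume "\<alpha> \<in> A"
    with A(1) 2 1 show "c \<alpha> = 0" by (intro monomials_indep[where A = A and r = r and c = c and \<alpha> = \<alpha>]) auto
  qed
qed

subsection \<open>Homogeneous polynomial functions\<close>

abbreviation "S \<equiv> sym_comp scale"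

lemma sym_comp_add: "f \<in> S j \<Longrightarrow> g \<in> S j \<Longrightarrow> (\<lambda>v. f v + g v) \<in> S j"
  using fs.span_add[of f _ g] by (simp add: sym_comp_def plus_fun_def)

lemma sym_comp_scale: "f \<in> S j \<Longrightarrow> (\<lambda>v. c * f v) \<in> S j"
  using fs.span_scale[of f _ c] by (simp add: sym_comp_def fscale_def)

lemma sym_comp_zero: "(\<lambda>_. 0) \<in> S j"
  using fs.span_zero by (simp add: sym_comp_def zero_fun_def)

lemma sym_comp_sum: "(\<And>i. i \<in> I \<Longrightarrow> f i \<in> S j) \<Longrightarrow> (\<lambda>v. \<Sum>i\<in>I. f i v) \<in> S j"
  by (induction I rule: infinite_finite_induct) (auto intro: sym_comp_zero sym_comp_add)

lemma sym_comp_lincomb: "(\<And>i. i \<in> I \<Longrightarrow> f i \<in> S j) \<Longrightarrow> lincomb I f c \<in> S j"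
  unfolding lincomb_def by (intro sym_comp_sum sym_comp_scale)

lemma sym_comp_gen: "(\<And>i. i < j \<Longrightarrow> linf (l i)) \<Longrightarrow> (\<lambda>v. \<Prod>i<j. l i v) \<in> S j"
  unfolding sym_comp_def by (rule fs.span_base) blast

lemma sym_comp_const: "(\<lambda>_. c) \<in> S 0"
  using sym_comp_scale[OF sym_comp_gen[of 0 "\<lambda>_. undefined"], of c] by simp

lemma linf_sym_comp: "linf l \<Longrightarrow> l \<in> S 1"
  using sym_comp_gen[of 1 "\<lambda>_. l"] by simp

lemma sym_comp_induct [consumes 1, case_names zero step]:
  assumes "f \<in> S j" and "P (\<lambda>_. 0)"
    and "\<And>c l f. (\<forall>i<j. linf (l i)) \<Longrightarrow> f \<in> S j \<Longrightarrow> P f \<Longrightarrow> P (\<lambda>v. c * (\<Prod>i<j. l i v) + f v)"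
  shows "P f"
proof -
  have "f \<in> fs.span {(\<lambda>v. \<Prod>i<j. l i v) | l. \<forall>i<j. linf (l i)}"
    using assms(1) by (simp add: sym_comp_def)
  then have "f \<in> S j \<and> P f"
  proof (induction rule: fs.span_induct_alt)
    case base
    show ?case using assms(2) sym_comp_zero by (simp add: zero_fun_def)
  next
    case (step c x y)
    then obtain l where l: "x = (\<lambda>v. \<Prod>i<j. l i v)" "\<forall>i<j. linf (l i)" by blast
    have "fscale c x + y = (\<lambda>v. c * (\<Prod>i<j. l i v) + y v)" by (auto simp: l fscale_def)
    moreover have "(\<lambda>v. c * (\<Prod>i<j. l i v) + y v) \<in> S j"
      using l step by (intro sym_comp_add sym_comp_scale sym_comp_gen) auto
    ultimately show ?case using assms(3)[OF l(2)] step by metis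
  qed
  then show ?thesis ..
qed

lemma sym_comp_mult_linf:
  assumes "f \<in> S j" "linf m"
  shows "(\<lambda>v. f v * m v) \<in> S (Suc j)"
  using assms(1)
proof (induction rule: sym_comp_induct)
  case zero
  show ?case by (simp add: sym_comp_zero)
next
  case (step c l f)
  have "(\<lambda>v. c * (\<Prod>i<Suc j. (if i < j then l i else m) v) + f v * m v) \<in> S (Suc j)"
    using step assms(2) by (intro sym_comp_add sym_comp_scale sym_comp_gen) auto
  then show ?case by (simp add: algebra_simps)
qed

lemma sym_comp_mult:
  assumes "f \<in> S i" "g \<in> S j"
  shows "(\<lambda>v. f v * g v) \<in> S (i + j)"
  using assms(2)
proof (induction rule: sym_comp_induct)
  case zero
  show ?case by (simp add: sym_comp_zero)
next
  case (step c l g)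
  have "(\<lambda>v. f v * (\<Prod>k<n. l k v)) \<in> S (i + n)" if "n \<le> j" for n
    using that
  proof (induction n)
    case 0
    show ?case using assms(1) by simp
  next
    case (Suc n)
    then show ?case using sym_comp_mult_linf[of "\<lambda>v. f v * (\<Prod>k<n. l k v)" "i + n" "l n"] step(1)
      by (simp add: mult_ac)
  qed
  then have "(\<lambda>v. c * (f v * (\<Prod>k<j. l k v)) + f v * g v) \<in> S (i + j)"
    using step by (intro sym_comp_add sym_comp_scale) auto
  then show ?case by (simp add: algebra_simps)
qed

lemma sym_comp_power: "f \<in> S j \<Longrightarrow> (\<lambda>v. f v ^ n) \<in> S (n * j)"
proof (induction n)
  case 0
  show ?case using sym_comp_const[of 1] by simp
next
  case (Suc n)
  then show ?case using sym_comp_mult[of f j "\<lambda>v. f v ^ n" "n * j"] by simp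
qed

lemma sym_comp_prod:
  "(\<And>i. i \<in> I \<Longrightarrow> f i \<in> S (d i)) \<Longrightarrow> (\<lambda>v. \<Prod>i\<in>I. f i v) \<in> S (\<Sum>i\<in>I. d i)"
proof (induction I rule: infinite_finite_induct)
  case (insert i I)
  then show ?case using sym_comp_mult[of "f i" "d i" "\<lambda>v. \<Prod>i\<in>I. f i v"] by simp
qed (use sym_comp_const[of 1] in auto)

lemma sym_comp_pmono:
  "(\<And>i. i < r' \<Longrightarrow> F i \<in> S (d i)) \<Longrightarrow> pmono r' F \<alpha> \<in> S (wdeg r' d \<alpha>)"
  unfolding pmono_def wdeg_def by (rule sym_comp_prod) (auto intro: sym_comp_power)

lemma sym_comp_comp:
  assumes "f \<in> S j" "linm A"
  shows "(\<lambda>v. f (A v)) \<in> S j"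
  using assms(1)
proof (induction rule: sym_comp_induct)
  case (step c l f)
  then show ?case using assms(2)
    by (intro sym_comp_add sym_comp_scale sym_comp_gen) (auto intro: linf_comp)
qed (rule sym_comp_zero)

lemma sym_comp_homogeneous:
  assumes "f \<in> S j"
  shows "f (scale c v) = c ^ j * f v"
  using assms
proof (induction rule: sym_comp_induct)
  case (step a l f)
  then have "(\<Prod>i<j. l i (scale c v)) = (\<Prod>i<j. c * l i v)"
    by (intro prod.cong) (auto intro: linf_scale)
  with step show ?case by (simp add: algebra_simps prod.distrib)
qed simp

text \<open>A product of functionals is expanded one factor at a time in the basis \<open>Y\<close>,
  each expansion raising a single exponent by one.\<close>

lemma sym_comp_subset_span_pmono:
  assumes "cobasis Y"
  shows "S j \<subseteq> fs.span (pmono r Y ` expos_deg r (\<lambda>_. 1) j)"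
proof -
  obtain f where f: "dual_basis Y f" using cobasis_dual[OF assms] .
  let ?P = "\<lambda>j. fs.span (pmono r Y ` expos_deg r (\<lambda>_. 1) j)"
  have mult: "(\<lambda>v. m v * g v) \<in> ?P (Suc j)" if "g \<in> ?P j" "linf m" for g m j
    using that(1)
  proof (induction rule: fs.span_induct_alt)
    case base
    show ?case using fs.span_zero by (simp add: zero_fun_def)
  next
    case (step c x y)
    then obtain \<alpha> where \<alpha>: "\<alpha> \<in> expos_deg r (\<lambda>_. 1) j" "x = pmono r Y \<alpha>" by blast
    have 1: "pmono r Y (\<lambda>i. ((\<lambda>_. 0)(k := 1)) i + \<alpha> i) \<in> ?P (Suc j)" if "k < r" for k
    proof (intro fs.span_base imageI)
      have "(\<Sum>i<r. ((\<lambda>_. 0)(k := 1)) i) = (\<Sum>i<r. if i = k then 1 else (0::nat))"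
        by (rule sum.cong) auto
      then have "(\<Sum>i<r. ((\<lambda>_. 0)(k := 1)) i) = (1 :: nat)" using that by simp
      then show "(\<lambda>i. ((\<lambda>_. 0)(k := 1)) i + \<alpha> i) \<in> expos_deg r (\<lambda>_. 1) (Suc j)"
        using that \<alpha> by (auto simp: expos_deg_def expos_def wdeg_def sum.distrib simp del: fun_upd_apply)
          (auto)
    qed
    have "m v * x v = (\<Sum>k<r. m (f k) * pmono r Y (\<lambda>i. ((\<lambda>_. 0)(k := 1)) i + \<alpha> i) v)" for v
      unfolding \<alpha>(2) linf_expand[OF f that(2), of v] sum_distrib_right
      by (rule sum.cong) (auto simp only: pmono_mult[symmetric] pmono_unit lessThan_iff mult.assoc)
    then have "(\<lambda>v. m v * (fscale c x + y) v) =
        (\<Sum>k<r. fscale (c * m (f k)) (pmono r Y (\<lambda>i. ((\<lambda>_. 0)(k := 1)) i + \<alpha> i))) + (\<lambda>v. m v * y v)"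
      by (auto simp: fun_eq_iff sum_fun_apply fscale_def algebra_simps sum_distrib_left)
    also have "\<dots> \<in> ?P (Suc j)"
      using step 1 by (intro fs.span_add fs.span_sum fs.span_scale) auto
    finally show ?case .
  qed
  have gen: "(\<lambda>v. \<Prod>i<j. l i v) \<in> ?P j" if "\<forall>i<j. linf (l i)" for l j
    using that
  proof (induction j)
    case 0
    have "pmono r Y (\<lambda>_. 0) \<in> ?P 0"
      by (intro fs.span_base imageI) (auto simp: expos_deg_def expos_def wdeg_def)
    then show ?case by simp
  next
    case (Suc j)
    then show ?case using mult[of "\<lambda>v. \<Prod>i<j. l i v" j "l j"] by (simp add: mult.commute)
  qed
  show ?thesis
    unfolding sym_comp_def by (rule fs.span_minimal) (use gen in auto)
qed

lemma frame_sym_comp: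
  assumes "cobasis Y"
  shows "frame (expos_deg r (\<lambda>_. 1) j) (pmono r Y) (S j)"
  unfolding frame_def
proof (intro conjI)
  show fin: "finite (expos_deg r (\<lambda>_. 1) j)" by (rule finite_expos_deg) simp
  show "indep_family (expos_deg r (\<lambda>_. 1) j) (pmono r Y)"
    using algind_cobasis[OF assms] fin by (auto simp: algind_def expos_deg_def)
  have "pmono r Y \<alpha> \<in> S j" if "\<alpha> \<in> expos_deg r (\<lambda>_. 1) j" for \<alpha>
    using sym_comp_pmono[of r Y "\<lambda>_. 1" \<alpha>] linf_sym_comp[OF cobasis_linf[OF assms]] that
    by (auto simp: expos_deg_def)
  then have "range (lincomb (expos_deg r (\<lambda>_. 1) j) (pmono r Y)) \<subseteq> S j"
    by (auto intro: sym_comp_lincomb)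
  with sym_comp_subset_span_pmono[OF assms, of j]
  show "S j = range (lincomb (expos_deg r (\<lambda>_. 1) j) (pmono r Y))"
    unfolding range_lincomb_eq_span[OF fin] by blast
qed

lemma sym_comp_subset_sym_alg: "S j \<subseteq> sym_alg scale"
  unfolding sym_alg_def using fs.span_superset by blast

lemma sym_alg_eq_polyalg:
  assumes "cobasis Y"
  shows "sym_alg scale = polyalg r Y"
proof
  have "S j \<subseteq> polyalg r Y" for j
  proof -
    have "fs.span (pmono r Y ` expos_deg r (\<lambda>_. 1) j) \<subseteq> polyalg r Y"
      unfolding polyalg_def by (rule fs.span_mono) (auto simp: expos_deg_def)
    with sym_comp_subset_span_pmono[OF assms, of j] show ?thesis by blast
  qed
  then show "sym_alg scale \<subseteq> polyalg r Y"
    unfolding sym_alg_def by (intro fs.span_minimal) (auto simp: polyalg_def)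
  have "pmono r Y \<alpha> \<in> sym_alg scale" for \<alpha>
    using sym_comp_pmono[of r Y "\<lambda>_. 1" \<alpha>] linf_sym_comp[OF cobasis_linf[OF assms]]
      sym_comp_subset_sym_alg by blast
  then show "polyalg r Y \<subseteq> sym_alg scale"
    unfolding polyalg_def by (intro fs.span_minimal) (auto simp: sym_alg_def)
qed

subsection \<open>Polynomial functions on lines\<close>

text \<open>Polynomiality along affine lines is a weak notion that is closed under sums and products
  and carries two arguments: derivatives along lines exist, and a function that is not identically 0
  on a line has finitely many zeros there.\<close>

definition linepoly :: "('v \<Rightarrow> complex) \<Rightarrow> bool" where
  "linepoly f \<longleftrightarrow> (\<forall>y w. \<exists>p. \<forall>t. f (y + scale t w) = poly p t)"

lemma linepoly_const: "linepoly (\<lambda>_. c)"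
  unfolding linepoly_def by (auto intro: exI[of _ "[:c:]"])

lemma linepoly_linf: "linf l \<Longrightarrow> linepoly l"
  unfolding linepoly_def
proof (intro allI)
  fix y w assume "linf l"
  then show "\<exists>p. \<forall>t. l (y + scale t w) = poly p t"
    by (intro exI[of _ "[:l y, l w:]"]) (simp add: linf_add linf_scale)
qed

lemma linepoly_add: "linepoly f \<Longrightarrow> linepoly g \<Longrightarrow> linepoly (\<lambda>v. f v + g v)"
  unfolding linepoly_def by (metis poly_add)

lemma linepoly_mult: "linepoly f \<Longrightarrow> linepoly g \<Longrightarrow> linepoly (\<lambda>v. f v * g v)"
  unfolding linepoly_def by (metis poly_mult)

lemma linepoly_sum: "(\<And>i. i \<in> I \<Longrightarrow> linepoly (f i)) \<Longrightarrow> linepoly (\<lambda>v. \<Sum>i\<in>I. f i v)"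
  by (induction I rule: infinite_finite_induct) (auto intro: linepoly_const linepoly_add)

lemma linepoly_prod: "(\<And>i. i \<in> I \<Longrightarrow> linepoly (f i)) \<Longrightarrow> linepoly (\<lambda>v. \<Prod>i\<in>I. f i v)"
  by (induction I rule: infinite_finite_induct) (auto intro: linepoly_const linepoly_mult)

lemma linepoly_power: "linepoly f \<Longrightarrow> linepoly (\<lambda>v. f v ^ n)"
  by (induction n) (auto intro: linepoly_const linepoly_mult)

lemma linepoly_polyalg:
  assumes "f \<in> polyalg s F" "\<And>i. i < s \<Longrightarrow> linepoly (F i)"
  shows "linepoly f"
proof -
  obtain A c where "f = lincomb A (pmono s F) c" using assms(1) by (auto simp: polyalg_explicit)
  then show ?thesis unfolding lincomb_def pmono_def
    using assms(2) by (auto intro!: linepoly_sum linepoly_mult linepoly_prod linepoly_power linepoly_const)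
qed

lemma linepoly_sym_alg: "f \<in> sym_alg scale \<Longrightarrow> linepoly f"
  using linepoly_polyalg[of f r X] X_linear by (auto simp: sym_alg_eq_polyalg[OF cobasis_X] intro: linepoly_linf)

lemma linepoly_sym_comp: "f \<in> S j \<Longrightarrow> linepoly f"
  using linepoly_sym_alg sym_comp_subset_sym_alg by blast

text \<open>Join a point where \<open>f k\<close> does not vanish to one where none of the others
  vanishes. On this line two nonzero polynomials have only finitely many zeros, so some point avoids
  all of them.\<close>

lemma common_nonzero:
  assumes "finite K" "\<And>k. k \<in> K \<Longrightarrow> linepoly (f k)" "\<And>k. k \<in> K \<Longrightarrow> \<exists>y. f k y \<noteq> 0"
  shows "\<exists>y. \<forall>k\<in>K. f k y \<noteq> 0"
  using assms
proof (induction K)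
  case (insert k K)
  then obtain y1 where "\<forall>i\<in>K. f i y1 \<noteq> 0" by auto
  moreover obtain y0 where "f k y0 \<noteq> 0" using insert.prems(2) by blast
  ultimately have y: "\<forall>i\<in>K. f i y1 \<noteq> 0" "f k y0 \<noteq> 0" by auto
  have g: "linepoly (\<lambda>v. \<Prod>i\<in>K. f i v)" using insert.prems by (intro linepoly_prod) auto
  obtain p where p: "\<And>t. f k (y0 + scale t (y1 - y0)) = poly p t"
    using insert.prems unfolding linepoly_def by blast
  obtain q where q: "\<And>t. (\<Prod>i\<in>K. f i (y0 + scale t (y1 - y0))) = poly q t"
    using g unfolding linepoly_def by blast
  have "poly p 0 \<noteq> 0" using p[of 0] y by simp
  moreover have "poly q 1 \<noteq> 0" using q[of 1] y insert.hyps(1) by (simp flip: q)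
  ultimately have "p * q \<noteq> 0" by auto
  then have "finite {t. poly (p * q) t = 0}" by (rule poly_roots_finite)
  then obtain t where "poly (p * q) t \<noteq> 0"
    using infinite_UNIV_char_0[where 'a = complex] by (metis (mono_tags) UNIV_eq_I mem_Collect_eq)
  then have "f k (y0 + scale t (y1 - y0)) \<noteq> 0" "(\<Prod>i\<in>K. f i (y0 + scale t (y1 - y0))) \<noteq> 0"
    unfolding p q by auto
  then show ?case using insert.hyps(1) by (intro exI[of _ "y0 + scale t (y1 - y0)"]) auto
qed auto

section \<open>Directional derivatives\<close>

definition dird :: "('v \<Rightarrow> complex) \<Rightarrow> 'v \<Rightarrow> 'v \<Rightarrow> complex" where
  "dird f y w = (THE D. ((\<lambda>t. f (y + scale t w)) has_field_derivative D) (at 0))"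

lemma dird_eqI: "((\<lambda>t. f (y + scale t w)) has_field_derivative D) (at 0) \<Longrightarrow> dird f y w = D"
  unfolding dird_def by (rule the_equality) (auto intro: DERIV_unique)

lemma dird_has_derivative:
  assumes "linepoly f"
  shows "((\<lambda>t. f (y + scale t w)) has_field_derivative dird f y w) (at 0)"
proof -
  obtain p where "\<And>t. f (y + scale t w) = poly p t" using assms unfolding linepoly_def by blast
  from has_field_derivative_poly_comp[OF this] dird_eqI show ?thesis by metis
qed

lemma dird_comp: "linm A \<Longrightarrow> dird f (A y) (A w) = dird (\<lambda>v. f (A v)) y w"
  by (simp add: dird_def linm_add linm_scale)

text \<open>Existence, homogeneity in the base point and linearity in the direction are proved in
  one induction over products of functionals. The case \<open>j = 0\<close> is separate because
  truncated subtraction would only say that the derivative is constant instead of 0.\<close>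

lemma dird_exists:
  assumes "f \<in> S j"
  shows "\<exists>D. (\<forall>y w. ((\<lambda>t. f (y + scale t w)) has_field_derivative D y w) (at 0)) \<and>
    (\<forall>w. if j = 0 then (\<forall>y. D y w = 0) else (\<lambda>y. D y w) \<in> S (j - 1)) \<and> (\<forall>y. linf (D y))"
    (is "\<exists>D. ?P j f D")
proof -
  have mult: "\<exists>D. ?P (Suc j) (\<lambda>v. f v * l v) D" if f: "f \<in> S j" "\<exists>D. ?P j f D" and l: "linf l" for f l j
  proof -
    obtain D where D: "?P j f D" using f by blast
    have l': "((\<lambda>t. l (y + scale t w)) has_field_derivative l w) (at 0)" for y w
      unfolding linf_add[OF l] linf_scale[OF l] by (auto intro!: derivative_eq_intros)
    have "?P (Suc j) (\<lambda>v. f v * l v) (\<lambda>y w. l w * f y + D y w * l y)"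
    proof (intro conjI allI)
      show "((\<lambda>t. f (y + scale t w) * l (y + scale t w)) has_field_derivative l w * f y + D y w * l y) (at 0)" for y w
        using DERIV_mult[OF D[THEN conjunct1, rule_format, of y w] l'[of y w]] by (simp add: mult_ac add.commute)
      show "if Suc j = 0 then \<forall>y. l w * f y + D y w * l y = 0
        else (\<lambda>y. l w * f y + D y w * l y) \<in> S (Suc j - 1)" for w
      proof (cases "j = 0")
        case True
        with D have "\<And>y. D y w = 0" by auto
        with f sym_comp_scale[of f j "l w"] show ?thesis by simp
      next
        case False
        with D have "(\<lambda>y. D y w) \<in> S (j - 1)" by auto
        from sym_comp_mult_linf[OF this l] False have "(\<lambda>y. D y w * l y) \<in> S j" by simp
        with f show ?thesis by (auto intro!: sym_comp_add sym_comp_scale)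
      qed
      show "linf (\<lambda>w. l w * f y + D y w * l y)" for y
        using D[THEN conjunct2, THEN conjunct2, rule_format, of y] l by (auto simp: linf_iff algebra_simps)
    qed
    then show ?thesis by (rule exI[of _ "\<lambda>y w. l w * f y + D y w * l y"])
  qed
  have gen: "\<exists>D. ?P j (\<lambda>v. \<Prod>i<j. l i v) D" if "\<forall>i<j. linf (l i)" for l j
    using that
  proof (induction j)
    case 0
    show ?case by (rule exI[of _ "\<lambda>_ _. 0"]) (auto simp: linf_iff)
  next
    case (Suc j)
    then show ?case using mult[of "\<lambda>v. \<Prod>i<j. l i v" j "l j"] sym_comp_gen[of j l] by simp
  qed
  show ?thesis
    using assms
  proof (induction rule: sym_comp_induct)
    case zero
    show ?case by (rule exI[of _ "\<lambda>_ _. 0"]) (auto simp: linf_iff sym_comp_zero)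
  next
    case (step c l f)
    obtain D1 where D1: "?P j (\<lambda>v. \<Prod>i<j. l i v) D1" using gen[OF step(1)] by blast
    obtain D2 where D2: "?P j f D2" using step(3) by blast
    have "?P j (\<lambda>v. c * (\<Prod>i<j. l i v) + f v) (\<lambda>y w. c * D1 y w + D2 y w)"
    proof (intro conjI allI)
      show "((\<lambda>t. c * (\<Prod>i<j. l i (y + scale t w)) + f (y + scale t w)) has_field_derivative c * D1 y w + D2 y w) (at 0)" for y w
        by (intro DERIV_add DERIV_cmult) (use D1 D2 in auto)
      show "if j = 0 then \<forall>y. c * D1 y w + D2 y w = 0 else (\<lambda>y. c * D1 y w + D2 y w) \<in> S (j - 1)" for w
        using D1 D2 by (auto intro!: sym_comp_add sym_comp_scale split: if_splits)
      show "linf (\<lambda>w. c * D1 y w + D2 y w)" for y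
        using D1[THEN conjunct2, THEN conjunct2, rule_format, of y]
          D2[THEN conjunct2, THEN conjunct2, rule_format, of y] by (auto simp: linf_iff algebra_simps)
    qed
    then show ?case by (rule exI[of _ "\<lambda>y w. c * D1 y w + D2 y w"])
  qed
qed

lemma
  assumes "f \<in> S j"
  shows dird_linf: "linf (dird f y)"
    and dird_sym_comp: "j \<ge> 1 \<Longrightarrow> (\<lambda>y. dird f y w) \<in> S (j - 1)"
proof -
  obtain D where D: "\<forall>y w. ((\<lambda>t. f (y + scale t w)) has_field_derivative D y w) (at 0)"
      "\<forall>w. if j = 0 then (\<forall>y. D y w = 0) else (\<lambda>y. D y w) \<in> S (j - 1)" "\<forall>y. linf (D y)"
    using dird_exists[OF assms] by blast
  from D(1) have "dird f = D" by (auto simp: fun_eq_iff intro: dird_eqI)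
  with D show "linf (dird f y)" "j \<ge> 1 \<Longrightarrow> (\<lambda>y. dird f y w) \<in> S (j - 1)"
    by (auto split: if_splits)
qed

end

subsection \<open>Alternating forms\<close>

text \<open>Some enumeration, not necessarily increasing: another choice would change the form
  attached to \<open>I\<close> by a sign only, and one fixed choice is used throughout.\<close>

definition enum_set :: "nat set \<Rightarrow> nat \<Rightarrow> nat" where
  "enum_set I = (SOME h. bij_betw h {..<card I} I)"

lemma enum_set: "finite I \<Longrightarrow> bij_betw (enum_set I) {..<card I} I"
  unfolding enum_set_def
  using someI_ex[OF ex_bij_betw_nat_finite[of I]] by (simp add: atLeast0LessThan)

definition subsets_of_card :: "nat \<Rightarrow> nat \<Rightarrow> nat set set" where
  "subsets_of_card r p = {I. I \<subseteq> {..<r} \<and> card I = p}"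

lemma finite_subsets_of_card: "finite (subsets_of_card r p)"
  unfolding subsets_of_card_def by simp

lemma subsets_of_cardD:
  assumes "I \<in> subsets_of_card r p"
  shows "finite I" "card I = p" "I \<subseteq> {..<r}" "bij_betw (enum_set I) {..<p} I"
    "b < p \<Longrightarrow> enum_set I b < r"
proof -
  show *: "finite I" "card I = p" "I \<subseteq> {..<r}"
    using assms finite_subset[of I "{..<r}"] by (auto simp: subsets_of_card_def)
  then show bij: "bij_betw (enum_set I) {..<p} I" using enum_set by blast
  show "enum_set I b < r" if "b < p"
    using bij_betwE[OF bij] that * by blast
qed

lemma permutes_lessThan: "\<sigma> permutes {..<p} \<Longrightarrow> \<sigma> b < p \<longleftrightarrow> b < (p::nat)"
  using permutes_in_image[of \<sigma> "{..<p}" b] by simp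

lemma sign_mult_self: "of_int (sign \<sigma>) * of_int (sign \<sigma>) = (1 :: complex)"
  by (cases "sign \<sigma> = 1") (auto simp: sign_def)

context coordinate_space
begin

lemma linf_sum_fun: "(\<And>i. i \<in> I \<Longrightarrow> linf (f i)) \<Longrightarrow> linf (\<lambda>x. \<Sum>i\<in>I. f i x)"
  by (auto simp: linf_iff sum.distrib sum_distrib_left intro!: sum.cong)

lemma linf_scale_fun: "linf f \<Longrightarrow> linf (\<lambda>x. c * f x)"
  by (auto simp: linf_iff algebra_simps)

lemma sym_comp_scale_right: "f \<in> S j \<Longrightarrow> (\<lambda>v. f v * c) \<in> S j"
  using sym_comp_scale[of f j c] by (simp add: mult.commute[of c])

text \<open>The \<open>p\<close> arguments are the first \<open>p\<close> values of an infinite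
  sequence, which gives forms of all degrees the same type; the first clause makes the remaining
  values irrelevant.\<close>

definition mlin :: "nat \<Rightarrow> ((nat \<Rightarrow> 'v) \<Rightarrow> complex) \<Rightarrow> bool" where
  "mlin p \<psi> \<longleftrightarrow> (\<forall>w w'. (\<forall>b<p. w b = w' b) \<longrightarrow> \<psi> w = \<psi> w') \<and>
     (\<forall>a<p. \<forall>w. linf (\<lambda>x. \<psi> (w(a := x))))"

definition alt :: "nat \<Rightarrow> ((nat \<Rightarrow> 'v) \<Rightarrow> complex) \<Rightarrow> bool" where
  "alt p \<psi> \<longleftrightarrow> mlin p \<psi> \<and> (\<forall>\<sigma> w. \<sigma> permutes {..<p} \<longrightarrow> \<psi> (w \<circ> \<sigma>) = of_int (sign \<sigma>) * \<psi> w)"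

text \<open>Without the factor \<open>1 / p!\<close>, so that \<open>dform p l\<close> is the
  determinant of the values of the functionals \<open>l b\<close> on the vectors and equals 1 on a
  dual basis.\<close>

definition altz :: "nat \<Rightarrow> ((nat \<Rightarrow> 'v) \<Rightarrow> complex) \<Rightarrow> (nat \<Rightarrow> 'v) \<Rightarrow> complex" where
  "altz p \<psi> w = (\<Sum>\<sigma> | \<sigma> permutes {..<p}. of_int (sign \<sigma>) * \<psi> (w \<circ> \<sigma>))"

definition dform :: "nat \<Rightarrow> (nat \<Rightarrow> 'v \<Rightarrow> complex) \<Rightarrow> (nat \<Rightarrow> 'v) \<Rightarrow> complex" where
  "dform p l = altz p (\<lambda>w. \<Prod>b<p. l b (w b))"

lemma mlin_cong: "mlin p \<psi> \<Longrightarrow> (\<And>b. b < p \<Longrightarrow> w b = w' b) \<Longrightarrow> \<psi> w = \<psi> w'"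
  unfolding mlin_def by blast

lemma mlin_linf: "mlin p \<psi> \<Longrightarrow> a < p \<Longrightarrow> linf (\<lambda>x. \<psi> (w(a := x)))"
  unfolding mlin_def by blast

lemma alt_mlin: "alt p \<psi> \<Longrightarrow> mlin p \<psi>"
  by (simp add: alt_def)

lemma alt_permute: "alt p \<psi> \<Longrightarrow> \<sigma> permutes {..<p} \<Longrightarrow> \<psi> (w \<circ> \<sigma>) = of_int (sign \<sigma>) * \<psi> w"
  by (simp add: alt_def)

lemma mlin_permute:
  assumes "mlin p \<psi>" "\<sigma> permutes {..<p}"
  shows "mlin p (\<lambda>w. \<psi> (w \<circ> \<sigma>))"
  unfolding mlin_def
proof (intro conjI allI impI)
  fix w w' :: "nat \<Rightarrow> 'v" assume "\<forall>b<p. w b = w' b"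
  then show "\<psi> (w \<circ> \<sigma>) = \<psi> (w' \<circ> \<sigma>)"
    using permutes_lessThan[OF assms(2)] by (intro mlin_cong[OF assms(1)]) simp
next
  fix a and w :: "nat \<Rightarrow> 'v" assume a: "a < p"
  have eq: "(w(a := x)) \<circ> \<sigma> = (w \<circ> \<sigma>)(inv_into UNIV \<sigma> a := x)" for x
    using permutes_inverses[OF assms(2)] by (auto simp: fun_eq_iff)
  have "inv_into UNIV \<sigma> a < p" using permutes_lessThan[OF permutes_inv[OF assms(2)], of a] a by simp
  from mlin_linf[OF assms(1) this] show "linf (\<lambda>x. \<psi> ((w(a := x)) \<circ> \<sigma>))" unfolding eq .
qed

lemma mlin_sum: "(\<And>i. i \<in> I \<Longrightarrow> mlin p (\<psi> i)) \<Longrightarrow> mlin p (\<lambda>w. \<Sum>i\<in>I. \<psi> i w)"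
proof -
  assume *: "\<And>i. i \<in> I \<Longrightarrow> mlin p (\<psi> i)"
  show ?thesis unfolding mlin_def
  proof (intro conjI allI impI)
    fix w w' :: "nat \<Rightarrow> 'v" assume "\<forall>b<p. w b = w' b"
    then show "(\<Sum>i\<in>I. \<psi> i w) = (\<Sum>i\<in>I. \<psi> i w')"
      by (intro sum.cong mlin_cong[OF *]) auto
  next
    fix a w assume "a < p"
    with * show "linf (\<lambda>x. \<Sum>i\<in>I. \<psi> i (w(a := x)))"
      by (intro linf_sum_fun mlin_linf[of p]) auto
  qed
qed

lemma mlin_scale: "mlin p \<psi> \<Longrightarrow> mlin p (\<lambda>w. c * \<psi> w)"
  unfolding mlin_def by (auto intro: linf_scale_fun)

lemma alt_altz:
  assumes "mlin p \<psi>"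
  shows "alt p (altz p \<psi>)"
  unfolding alt_def
proof (intro conjI allI impI)
  show "mlin p (altz p \<psi>)"
    unfolding altz_def[abs_def]
    by (intro mlin_sum mlin_scale mlin_permute[OF assms]) simp
next
  fix \<tau> w assume \<tau>: "\<tau> permutes {..<p}"
  have "altz p \<psi> w = (\<Sum>\<sigma> | \<sigma> permutes {..<p}. of_int (sign (\<tau> \<circ> \<sigma>)) * \<psi> (w \<circ> (\<tau> \<circ> \<sigma>)))"
    unfolding altz_def by (rule setum_permutations_compose_left[OF \<tau>])
  also have "\<dots> = (\<Sum>\<sigma> | \<sigma> permutes {..<p}. of_int (sign \<tau>) * (of_int (sign \<sigma>) * \<psi> (w \<circ> \<tau> \<circ> \<sigma>)))"
  proof (rule sum.cong)
    fix \<sigma> assume "\<sigma> \<in> {\<sigma>. \<sigma> permutes {..<p}}"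
    then have "sign (\<tau> \<circ> \<sigma>) = sign \<tau> * sign \<sigma>"
      using \<tau> by (intro sign_compose) (auto intro: permutes_imp_permutation[OF finite_lessThan])
    then show "of_int (sign (\<tau> \<circ> \<sigma>)) * \<psi> (w \<circ> (\<tau> \<circ> \<sigma>)) =
        of_int (sign \<tau>) * (of_int (sign \<sigma>) * \<psi> (w \<circ> \<tau> \<circ> \<sigma>))"
      by (simp add: comp_assoc)
  qed simp
  also have "\<dots> = of_int (sign \<tau>) * altz p \<psi> (w \<circ> \<tau>)"
    by (simp add: altz_def sum_distrib_left)
  finally show "altz p \<psi> (w \<circ> \<tau>) = of_int (sign \<tau>) * altz p \<psi> w"
    using sign_mult_self[of \<tau>] by (simp add: mult.assoc[symmetric])
qed

text \<open>A form tensored with functionals in the remaining slots; antisymmetrising it produces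
  the wedge product with complementary differentials.\<close>

lemma mlin_mult_prod:
  assumes "mlin p \<psi>" "p \<le> s" "\<And>b. p \<le> b \<Longrightarrow> b < s \<Longrightarrow> linf (l b)"
  shows "mlin s (\<lambda>w. \<psi> w * (\<Prod>b\<in>{p..<s}. l b (w b)))"
  unfolding mlin_def
proof (intro conjI allI impI)
  fix w w' :: "nat \<Rightarrow> 'v" assume *: "\<forall>b<s. w b = w' b"
  then have "\<psi> w = \<psi> w'" using assms(2) by (intro mlin_cong[OF assms(1)]) auto
  with * show "\<psi> w * (\<Prod>b\<in>{p..<s}. l b (w b)) = \<psi> w' * (\<Prod>b\<in>{p..<s}. l b (w' b))" by simp
next
  fix a w assume a: "a < s"
  show "linf (\<lambda>x. \<psi> (w(a := x)) * (\<Prod>b\<in>{p..<s}. l b ((w(a := x)) b)))"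
  proof (cases "a < p")
    case True
    then have "(\<lambda>x. \<psi> (w(a := x)) * (\<Prod>b\<in>{p..<s}. l b ((w(a := x)) b))) =
        (\<lambda>x. (\<Prod>b\<in>{p..<s}. l b (w b)) * \<psi> (w(a := x)))"
      by (auto simp: fun_eq_iff intro!: prod.cong)
    then show ?thesis using linf_scale_fun[OF mlin_linf[OF assms(1) True]] by simp
  next
    case False
    then have "\<psi> (w(a := x)) = \<psi> w" for x by (intro mlin_cong[OF assms(1)]) auto
    moreover have "(\<Prod>b\<in>{p..<s}. l b ((w(a := x)) b)) = l a x * (\<Prod>b\<in>{p..<s} - {a}. l b (w b))" for x
      using a False by (subst prod.remove[of _ a]) (auto intro!: prod.cong)
    ultimately have "(\<lambda>x. \<psi> (w(a := x)) * (\<Prod>b\<in>{p..<s}. l b ((w(a := x)) b))) =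
        (\<lambda>x. (\<psi> w * (\<Prod>b\<in>{p..<s} - {a}. l b (w b))) * l a x)"
      by (simp add: mult_ac)
    then show ?thesis using linf_scale_fun[OF assms(3)[of a]] a False by simp
  qed
qed

lemma mlin_one: "mlin 0 (\<lambda>_. 1)"
  by (simp add: mlin_def)

lemma alt_dform: "(\<And>b. b < p \<Longrightarrow> linf (l b)) \<Longrightarrow> alt p (dform p l)"
  unfolding dform_def using mlin_mult_prod[OF mlin_one, of p l]
  by (intro alt_altz) (simp add: atLeast0LessThan)

lemma alt_sum: "(\<And>i. i \<in> I \<Longrightarrow> alt p (\<psi> i)) \<Longrightarrow> alt p (\<lambda>w. \<Sum>i\<in>I. \<psi> i w)"
  unfolding alt_def by (auto intro: mlin_sum simp: sum_distrib_left)

lemma alt_scale: "alt p \<psi> \<Longrightarrow> alt p (\<lambda>w. c * \<psi> w)"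
  unfolding alt_def by (auto intro: mlin_scale)

lemma alt_repeat:
  assumes "alt p \<psi>" "a < p" "b < p" "a \<noteq> b" "w a = w b"
  shows "\<psi> w = 0"
proof -
  let ?\<tau> = "Transposition.transpose a b"
  have "\<psi> (w \<circ> ?\<tau>) = of_int (sign ?\<tau>) * \<psi> w"
    using assms by (intro alt_permute) (auto intro: permutes_swap_id)
  moreover have "w \<circ> ?\<tau> = w" using assms(5) by (auto simp: fun_eq_iff Transposition.transpose_def)
  ultimately show ?thesis using assms(4) by (simp add: sign_swap_id)
qed

text \<open>Passing to inverse permutations moves the permutation from the vectors to the
  functionals, as for the determinant of a transposed matrix.\<close>

lemma dform_eq: "dform p l w = (\<Sum>\<sigma> | \<sigma> permutes {..<p}. of_int (sign \<sigma>) * (\<Prod>b<p. l (\<sigma> b) (w b)))"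
proof -
  have "dform p l w = (\<Sum>\<sigma> | \<sigma> permutes {..<p}. of_int (sign (inv_into UNIV \<sigma>)) *
      (\<Prod>b<p. l b (w (inv_into UNIV \<sigma> b))))"
    unfolding dform_def altz_def
    using sum_permutations_inverse[of "\<lambda>\<sigma>. of_int (sign \<sigma>) * (\<Prod>b<p. l b (w (\<sigma> b)))" "{..<p}"] by simp
  also have "\<dots> = (\<Sum>\<sigma> | \<sigma> permutes {..<p}. of_int (sign \<sigma>) * (\<Prod>b<p. l (\<sigma> b) (w b)))"
  proof (rule sum.cong)
    fix \<sigma> assume \<sigma>: "\<sigma> \<in> {\<sigma>. \<sigma> permutes {..<p}}"
    have "(\<Prod>b<p. l b (w (inv_into UNIV \<sigma> b))) = (\<Prod>b<p. l (\<sigma> b) (w (inv_into UNIV \<sigma> (\<sigma> b))))"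
      using permutes_imp_bij[of \<sigma> "{..<p}"] \<sigma>
      by (intro prod.reindex_bij_betw[symmetric]) auto
    also have "\<dots> = (\<Prod>b<p. l (\<sigma> b) (w b))" using \<sigma> permutes_inverses(2)[of \<sigma> "{..<p}"] by simp
    finally show "of_int (sign (inv_into UNIV \<sigma>)) * (\<Prod>b<p. l b (w (inv_into UNIV \<sigma> b))) =
        of_int (sign \<sigma>) * (\<Prod>b<p. l (\<sigma> b) (w b))"
      using \<sigma> by (simp add: sign_inverse permutes_imp_permutation[OF finite_lessThan])
  qed simp
  finally show ?thesis .
qed

lemma dform_dual:
  assumes Y: "dual_basis Y f" and I: "I \<in> subsets_of_card r p" "J \<in> subsets_of_card r p"
  shows "dform p (\<lambda>b. Y (enum_set I b)) (\<lambda>b. f (enum_set J b)) = (if I = J then 1 else 0)"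
proof -
  note I' = subsets_of_cardD[OF I(1)] and J' = subsets_of_cardD[OF I(2)]
  have prod_eq: "(\<Prod>b<p. Y (enum_set I (\<sigma> b)) (f (enum_set J b))) = (if I = J \<and> \<sigma> = id then 1 else 0)"
    if \<sigma>: "\<sigma> permutes {..<p}" for \<sigma>
  proof (cases "\<forall>b<p. enum_set I (\<sigma> b) = enum_set J b")
    case True
    then have "enum_set J ` {..<p} = enum_set I ` (\<sigma> ` {..<p})"
      unfolding image_image by (intro image_cong) auto
    then have IJ: "I = J" using I'(4) J'(4) permutes_image[OF \<sigma>] by (simp add: bij_betw_def)
    have "\<sigma> b = b" for b
    proof (cases "b < p")
      case True
      with \<open>\<forall>b<p. enum_set I (\<sigma> b) = enum_set J b\<close> have "enum_set I (\<sigma> b) = enum_set I b" using IJ by auto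
      then show ?thesis
        using inj_onD[OF bij_betw_imp_inj_on[OF I'(4)], of "\<sigma> b" b] True permutes_lessThan[OF \<sigma>, of b] by simp
    next
      case False
      then show ?thesis using permutes_not_in[OF \<sigma>] by simp
    qed
    then have "\<sigma> = id" by auto
    moreover have "Y (enum_set I b) (f (enum_set J b)) = 1" if "b < p" for b
      using Y I'(5)[OF that] IJ by (simp add: dual_basis_def)
    ultimately show ?thesis using IJ by simp
  next
    case False
    then obtain b where b: "b < p" "enum_set I (\<sigma> b) \<noteq> enum_set J b" by blast
    then have "Y (enum_set I (\<sigma> b)) (f (enum_set J b)) = 0"
      using Y I'(5)[of "\<sigma> b"] J'(5)[of b] permutes_lessThan[OF \<sigma>] by (simp add: dual_basis_def)
    with b(1) have "(\<Prod>b<p. Y (enum_set I (\<sigma> b)) (f (enum_set J b))) = 0" by (intro prod_zero) auto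
    moreover have "\<not> (I = J \<and> \<sigma> = id)" using b by auto
    ultimately show ?thesis by auto
  qed
  have "dform p (\<lambda>b. Y (enum_set I b)) (\<lambda>b. f (enum_set J b)) =
      (\<Sum>\<sigma> | \<sigma> permutes {..<p}. if \<sigma> = id then (if I = J then 1 else 0) else 0)"
    unfolding dform_eq by (rule sum.cong) (auto simp: prod_eq)
  also have "\<dots> = (if I = J then 1 else 0)"
    by (subst sum.delta) (auto simp: finite_permutations permutes_id)
  finally show ?thesis .
qed

text \<open>The slots are expanded one after another: after \<open>m\<close> steps the first
  \<open>m\<close> slots hold basis vectors and the others still hold \<open>w\<close>.\<close>

lemma mlin_expand:
  assumes Y: "dual_basis Y f" and \<psi>: "mlin p \<psi>"
  shows "\<psi> w = (\<Sum>c\<in>PiE {..<p} (\<lambda>_. {..<r}). (\<Prod>b<p. Y (c b) (w b)) * \<psi> (\<lambda>b. f (c b)))"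
proof -
  have "\<psi> w = (\<Sum>c\<in>PiE {..<m} (\<lambda>_. {..<r}). (\<Prod>b<m. Y (c b) (w b)) *
      \<psi> (\<lambda>b. if b < m then f (c b) else w b))" if "m \<le> p" for m
    using that
  proof (induction m)
    case 0
    show ?case by simp
  next
    case (Suc m)
    let ?C = "PiE {..<m} (\<lambda>_. {..<r})"
    define g where "g c = (\<Prod>b<Suc m. Y (c b) (w b)) * \<psi> (\<lambda>b. if b < Suc m then f (c b) else w b)" for c
    have step: "(\<Prod>b<m. Y (c b) (w b)) * \<psi> (\<lambda>b. if b < m then f (c b) else w b) =
        (\<Sum>i<r. g (c(m := i)))" for c
    proof -
      define u where "u = (\<lambda>b. if b < m then f (c b) else w b)"
      have lin: "linf (\<lambda>x. \<psi> (u(m := x)))" using \<psi> Suc.prems by (intro mlin_linf) auto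
      have "\<psi> u = \<psi> (u(m := w m))" by (rule arg_cong[of _ _ \<psi>]) (auto simp: u_def)
      also have "\<dots> = (\<Sum>i<r. \<psi> (u(m := f i)) * Y i (w m))"
        by (rule linf_expand[OF Y lin])
      finally have "(\<Prod>b<m. Y (c b) (w b)) * \<psi> u =
          (\<Sum>i<r. (\<Prod>b<m. Y (c b) (w b)) * (\<psi> (u(m := f i)) * Y i (w m)))"
        by (simp only: sum_distrib_left)
      also have "\<dots> = (\<Sum>i<r. g (c(m := i)))"
      proof (rule sum.cong)
        fix i
        have "u(m := f i) = (\<lambda>b. if b < Suc m then f ((c(m := i)) b) else w b)"
          by (auto simp: fun_eq_iff less_Suc_eq u_def)
        then show "(\<Prod>b<m. Y (c b) (w b)) * (\<psi> (u(m := f i)) * Y i (w m)) = g (c(m := i))"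
          by (simp add: g_def mult_ac)
      qed simp
      finally show ?thesis unfolding u_def .
    qed
    have "\<psi> w = (\<Sum>c\<in>?C. (\<Prod>b<m. Y (c b) (w b)) * \<psi> (\<lambda>b. if b < m then f (c b) else w b))"
      by (rule Suc.IH) (use Suc.prems in simp)
    also have "\<dots> = (\<Sum>c\<in>?C. \<Sum>i<r. g (c(m := i)))" by (simp only: step)
    also have "\<dots> = (\<Sum>i<r. \<Sum>c\<in>?C. g (c(m := i)))" by (rule sum.swap)
    also have "\<dots> = (\<Sum>z\<in>{..<r} \<times> ?C. g ((\<lambda>(i, c). c(m := i)) z))"
      unfolding sum.cartesian_product by (rule sum.cong) auto
    also have "\<dots> = sum g ((\<lambda>(i, c). c(m := i)) ` ({..<r} \<times> ?C))"
      by (rule sum.reindex[symmetric, unfolded comp_def]) (rule inj_combinator, simp)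
    also have "(\<lambda>(i, c). c(m := i)) ` ({..<r} \<times> ?C) = PiE {..<Suc m} (\<lambda>_. {..<r})"
      by (simp add: lessThan_Suc PiE_insert_eq)
    finally show ?case unfolding g_def .
  qed
  from this[of p] have "\<psi> w = (\<Sum>c\<in>PiE {..<p} (\<lambda>_. {..<r}). (\<Prod>b<p. Y (c b) (w b)) *
      \<psi> (\<lambda>b. if b < p then f (c b) else w b))" by simp
  also have "\<dots> = (\<Sum>c\<in>PiE {..<p} (\<lambda>_. {..<r}). (\<Prod>b<p. Y (c b) (w b)) * \<psi> (\<lambda>b. f (c b)))"
    by (intro sum.cong arg_cong[of _ _ "\<lambda>z. _ * z"] mlin_cong[OF \<psi>]) auto
  finally show ?thesis .
qed

lemma injections_onto:
  assumes I: "I \<in> subsets_of_card r p"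
  shows "(\<Sum>c | c \<in> PiE {..<p} (\<lambda>_. {..<r}) \<and> inj_on c {..<p} \<and> c ` {..<p} = I. h c) =
    (\<Sum>\<sigma> | \<sigma> permutes {..<p}. h (restrict (enum_set I \<circ> \<sigma>) {..<p}))"
proof (rule sum.reindex_bij_witness[where
      i = "\<lambda>\<sigma>. restrict (enum_set I \<circ> \<sigma>) {..<p}" and
      j = "\<lambda>c b. if b < p then inv_into {..<p} (enum_set I) (c b) else b"])
  note I' = subsets_of_cardD[OF I]
  have inj: "inj_on (enum_set I) {..<p}" and img: "enum_set I ` {..<p} = I"
    using I'(4) by (auto simp: bij_betw_def)
  {
    fix c assume c: "c \<in> {c \<in> PiE {..<p} (\<lambda>_. {..<r}). inj_on c {..<p} \<and> c ` {..<p} = I}"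
    have fI: "enum_set I (inv_into {..<p} (enum_set I) (c b)) = c b" if "b < p" for b
      using c that img by (intro f_inv_into_f) auto
    have bij: "bij_betw (\<lambda>b. inv_into {..<p} (enum_set I) (c b)) {..<p} {..<p}"
      using bij_betw_trans[of c "{..<p}" I "inv_into {..<p} (enum_set I)" "{..<p}"] c
        bij_betw_inv_into[OF I'(4)] by (auto simp: bij_betw_def comp_def)
    show "(\<lambda>b. if b < p then inv_into {..<p} (enum_set I) (c b) else b) \<in> {\<sigma>. \<sigma> permutes {..<p}}"
    proof (simp, rule bij_imp_permutes)
      show "bij_betw (\<lambda>b. if b < p then inv_into {..<p} (enum_set I) (c b) else b) {..<p} {..<p}"
        using bij by (rule bij_betw_cong[THEN iffD1, rotated]) auto
    qed auto
    show eq: "restrict (enum_set I \<circ> (\<lambda>b. if b < p then inv_into {..<p} (enum_set I) (c b) else b)) {..<p} = c"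
    proof
      fix b
      show "restrict (enum_set I \<circ> (\<lambda>b. if b < p then inv_into {..<p} (enum_set I) (c b) else b)) {..<p} b = c b"
        using c fI[of b] by (auto simp: PiE_def extensional_def)
    qed
    show "h (restrict (enum_set I \<circ> (\<lambda>b. if b < p then inv_into {..<p} (enum_set I) (c b) else b)) {..<p}) = h c"
      by (simp only: eq)
  }
  fix \<sigma> assume "\<sigma> \<in> {\<sigma>. \<sigma> permutes {..<p}}"
  then have \<sigma>: "\<sigma> permutes {..<p}" by simp
  show "(\<lambda>b. if b < p then inv_into {..<p} (enum_set I) (restrict (enum_set I \<circ> \<sigma>) {..<p} b) else b) = \<sigma>"
  proof
    fix b
    show "(if b < p then inv_into {..<p} (enum_set I) (restrict (enum_set I \<circ> \<sigma>) {..<p} b) else b) = \<sigma> b"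
      using permutes_lessThan[OF \<sigma>, of b] inj permutes_not_in[OF \<sigma>, of b] by auto
  qed
  have "inj_on (enum_set I \<circ> \<sigma>) {..<p}" "(enum_set I \<circ> \<sigma>) ` {..<p} = I"
    using bij_betw_trans[OF permutes_imp_bij[OF \<sigma>] I'(4)] by (auto simp: bij_betw_def)
  moreover have "restrict (enum_set I \<circ> \<sigma>) {..<p} \<in> PiE {..<p} (\<lambda>_. {..<r})"
    using I'(5) permutes_lessThan[OF \<sigma>] by auto
  ultimately show "restrict (enum_set I \<circ> \<sigma>) {..<p} \<in>
      {c \<in> PiE {..<p} (\<lambda>_. {..<r}). inj_on c {..<p} \<and> c ` {..<p} = I}"
    by (simp add: inj_on_restrict_eq)
qed

text \<open>In the multilinear expansion, index choices with a repetition contribute 0. The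
  injective ones are grouped by their image \<open>I\<close>; they are the rearrangements of one
  enumeration of \<open>I\<close>, and their signs assemble to a determinant.\<close>

lemma alt_expand:
  assumes Y: "dual_basis Y f" and \<psi>: "alt p \<psi>"
  shows "\<psi> w = (\<Sum>I\<in>subsets_of_card r p. \<psi> (\<lambda>b. f (enum_set I b)) * dform p (\<lambda>b. Y (enum_set I b)) w)"
proof -
  let ?h = "\<lambda>c. (\<Prod>b<p. Y (c b) (w b)) * \<psi> (\<lambda>b. f (c b))"
  let ?C = "PiE {..<p} (\<lambda>_. {..<r})"
  let ?D = "{c \<in> ?C. inj_on c {..<p}}"
  have fin: "finite ?C" by (intro finite_PiE) auto
  have "\<psi> w = sum ?h ?C" by (rule mlin_expand[OF Y alt_mlin[OF \<psi>]])
  also have "\<dots> = sum ?h ?D"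
  proof (rule sum.mono_neutral_right[OF fin])
    show "\<forall>c\<in>?C - ?D. ?h c = 0"
    proof
      fix c assume "c \<in> ?C - ?D"
      then obtain a b where "a < p" "b < p" "a \<noteq> b" "c a = c b" by (auto simp: inj_on_def)
      then have "\<psi> (\<lambda>b. f (c b)) = 0" by (intro alt_repeat[OF \<psi>, of a b]) auto
      then show "?h c = 0" by simp
    qed
  qed auto
  also have "\<dots> = (\<Sum>I\<in>subsets_of_card r p. sum ?h {c \<in> ?D. c ` {..<p} = I})"
  proof (rule sum.group[symmetric])
    show "finite ?D" by (rule finite_subset[OF _ fin]) auto
    show "(\<lambda>c. c ` {..<p}) ` ?D \<subseteq> subsets_of_card r p"
    proof (rule image_subsetI)
      fix c assume c: "c \<in> ?D"
      then have "c ` {..<p} \<subseteq> {..<r}" by (simp add: PiE_def Pi_def image_subset_iff)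
      then show "c ` {..<p} \<in> subsets_of_card r p"
        using c by (simp add: subsets_of_card_def card_image)
    qed
  qed (rule finite_subsets_of_card)
  also have "\<dots> = (\<Sum>I\<in>subsets_of_card r p. \<psi> (\<lambda>b. f (enum_set I b)) * dform p (\<lambda>b. Y (enum_set I b)) w)"
  proof (rule sum.cong)
    fix I assume I: "I \<in> subsets_of_card r p"
    have "sum ?h {c \<in> ?D. c ` {..<p} = I} =
        (\<Sum>\<sigma> | \<sigma> permutes {..<p}. ?h (restrict (enum_set I \<circ> \<sigma>) {..<p}))"
      using injections_onto[OF I, of ?h] by (simp add: conj_assoc)
    also have "\<dots> = (\<Sum>\<sigma> | \<sigma> permutes {..<p}. \<psi> (\<lambda>b. f (enum_set I b)) *
        (of_int (sign \<sigma>) * (\<Prod>b<p. Y (enum_set I (\<sigma> b)) (w b))))"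
    proof (rule sum.cong)
      fix \<sigma> assume "\<sigma> \<in> {\<sigma>. \<sigma> permutes {..<p}}"
      then have \<sigma>: "\<sigma> permutes {..<p}" by simp
      have "\<psi> (\<lambda>b. f (restrict (enum_set I \<circ> \<sigma>) {..<p} b)) = \<psi> ((\<lambda>b. f (enum_set I b)) \<circ> \<sigma>)"
        by (rule mlin_cong[OF alt_mlin[OF \<psi>]]) simp
      also have "\<dots> = of_int (sign \<sigma>) * \<psi> (\<lambda>b. f (enum_set I b))" by (rule alt_permute[OF \<psi> \<sigma>])
      finally show "?h (restrict (enum_set I \<circ> \<sigma>) {..<p}) = \<psi> (\<lambda>b. f (enum_set I b)) *
        (of_int (sign \<sigma>) * (\<Prod>b<p. Y (enum_set I (\<sigma> b)) (w b)))"
        by (simp add: mult_ac)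
    qed simp
    also have "\<dots> = \<psi> (\<lambda>b. f (enum_set I b)) * dform p (\<lambda>b. Y (enum_set I b)) w"
      by (simp add: dform_eq sum_distrib_left)
    finally show "sum ?h {c \<in> ?D. c ` {..<p} = I} =
        \<psi> (\<lambda>b. f (enum_set I b)) * dform p (\<lambda>b. Y (enum_set I b)) w" .
  qed simp
  finally show ?thesis .
qed

subsection \<open>Differential forms with polynomial coefficients\<close>

text \<open>Base point and vectors are arguments of one function, so that forms are complex-valued
  functions again and frames and traces apply to them. The degree \<open>j\<close> counts
  coefficients only; covectors add nothing to it.\<close>

definition forms :: "nat \<Rightarrow> nat \<Rightarrow> ('v \<times> (nat \<Rightarrow> 'v) \<Rightarrow> complex) set" where
  "forms j p = {\<phi>. (\<forall>w. (\<lambda>y. \<phi> (y, w)) \<in> S j) \<and> (\<forall>y. alt p (\<lambda>w. \<phi> (y, w)))}"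

definition form_basis :: "nat \<Rightarrow> (nat \<Rightarrow> 'v \<Rightarrow> complex) \<Rightarrow> (nat \<Rightarrow> nat) \<times> nat set \<Rightarrow> 'v \<times> (nat \<Rightarrow> 'v) \<Rightarrow> complex" where
  "form_basis p Y = (\<lambda>(\<alpha>, I) (y, w). pmono r Y \<alpha> y * dform p (\<lambda>b. Y (enum_set I b)) w)"

lemma forms_lincomb: "(\<And>i. i \<in> I \<Longrightarrow> \<phi> i \<in> forms j p) \<Longrightarrow> lincomb I \<phi> c \<in> forms j p"
  unfolding forms_def lincomb_def
  by (auto intro!: sym_comp_sum sym_comp_scale alt_sum alt_scale)

lemma frame_forms:
  assumes Y: "cobasis Y"
  shows "frame (expos_deg r (\<lambda>_. 1) j \<times> subsets_of_card r p) (form_basis p Y) (forms j p)"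
    (is "frame ?J _ _")
  unfolding frame_def
proof (intro conjI)
  obtain f where f: "dual_basis Y f" using cobasis_dual[OF Y] .
  note S = frame_sym_comp[OF Y, of j]
  show fin: "finite ?J"
    using S finite_subsets_of_card by (auto simp: frame_def)
  have mem: "form_basis p Y i \<in> forms j p" if "i \<in> ?J" for i
  proof -
    obtain \<alpha> I where i1: "i = (\<alpha>, I)" by (cases i)
    with that have i: "i = (\<alpha>, I)" "\<alpha> \<in> expos_deg r (\<lambda>_. 1) j" "I \<in> subsets_of_card r p" by blast+
    have "alt p (dform p (\<lambda>b. Y (enum_set I b)))"
      using cobasis_linf[OF Y] subsets_of_cardD(5)[OF i(3)] by (intro alt_dform) auto
    moreover have "pmono r Y \<alpha> \<in> S j" using frame_elem[OF S i(2)] .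
    then have "(\<lambda>y. pmono r Y \<alpha> y * dform p (\<lambda>b. Y (enum_set I b)) w) \<in> S j" for w
      by (rule sym_comp_scale_right)
    ultimately show ?thesis
      by (auto simp: forms_def form_basis_def i intro!: alt_scale)
  qed
  show "forms j p = range (lincomb ?J (form_basis p Y))"
  proof (intro subset_antisym subsetI)
    fix \<phi> assume "\<phi> \<in> range (lincomb ?J (form_basis p Y))"
    then show "\<phi> \<in> forms j p" using forms_lincomb[OF mem] by auto
  next
    fix \<phi> assume \<phi>: "\<phi> \<in> forms j p"
    then have "\<forall>I\<in>subsets_of_card r p. (\<lambda>y. \<phi> (y, \<lambda>b. f (enum_set I b))) \<in> S j"
      by (auto simp: forms_def)
    from frame_coeffs[OF S this] obtain m where m: "\<And>I. I \<in> subsets_of_card r p \<Longrightarrow>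
        (\<lambda>y. \<phi> (y, \<lambda>b. f (enum_set I b))) = lincomb (expos_deg r (\<lambda>_. 1) j) (pmono r Y) (\<lambda>\<alpha>. m \<alpha> I)" by blast
    have "\<phi> (y, w) = lincomb ?J (form_basis p Y) (\<lambda>(\<alpha>, I). m \<alpha> I) (y, w)" for y w
    proof -
      have "\<phi> (y, w) = (\<Sum>I\<in>subsets_of_card r p. \<phi> (y, \<lambda>b. f (enum_set I b)) * dform p (\<lambda>b. Y (enum_set I b)) w)"
        using \<phi> by (intro alt_expand[OF f]) (auto simp: forms_def)
      also have "\<dots> = (\<Sum>I\<in>subsets_of_card r p. \<Sum>\<alpha>\<in>expos_deg r (\<lambda>_. 1) j.
          m \<alpha> I * form_basis p Y (\<alpha>, I) (y, w))"
        by (rule sum.cong) (auto simp: m[THEN fun_cong] lincomb_def sum_distrib_right form_basis_def mult.assoc)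
      also have "\<dots> = lincomb ?J (form_basis p Y) (\<lambda>(\<alpha>, I). m \<alpha> I) (y, w)"
        by (subst sum.swap) (simp add: sum.cartesian_product lincomb_def case_prod_unfold)
      finally show ?thesis .
    qed
    then have "\<phi> = lincomb ?J (form_basis p Y) (\<lambda>(\<alpha>, I). m \<alpha> I)" by (intro ext) auto
    then show "\<phi> \<in> range (lincomb ?J (form_basis p Y))" by simp
  qed
  show "indep_family ?J (form_basis p Y)"
    unfolding indep_family_def
  proof (intro allI impI)
    fix c assume c: "lincomb ?J (form_basis p Y) c = 0"
    show "\<forall>i\<in>?J. c i = 0"
    proof
      fix i assume "i \<in> ?J"
      moreover obtain \<alpha> K where "i = (\<alpha>, K)" by (cases i)
      ultimately have i: "i = (\<alpha>, K)" "\<alpha> \<in> expos_deg r (\<lambda>_. 1) j" "K \<in> subsets_of_card r p" by blast+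
      have "(\<Sum>\<alpha>\<in>expos_deg r (\<lambda>_. 1) j. c (\<alpha>, K) * pmono r Y \<alpha> y) = 0" for y
      proof -
        have "0 = lincomb ?J (form_basis p Y) c (y, \<lambda>b. f (enum_set K b))" using c by simp
        also have "\<dots> = (\<Sum>\<alpha>\<in>expos_deg r (\<lambda>_. 1) j. \<Sum>I\<in>subsets_of_card r p.
            c (\<alpha>, I) * (pmono r Y \<alpha> y * dform p (\<lambda>b. Y (enum_set I b)) (\<lambda>b. f (enum_set K b))))"
          by (simp add: lincomb_def sum.cartesian_product case_prod_unfold form_basis_def)
        also have "\<dots> = (\<Sum>\<alpha>\<in>expos_deg r (\<lambda>_. 1) j. \<Sum>I\<in>subsets_of_card r p.
            if I = K then c (\<alpha>, I) * pmono r Y \<alpha> y else 0)"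
          by (intro sum.cong) (auto simp: dform_dual[OF f _ i(3)])
        also have "\<dots> = (\<Sum>\<alpha>\<in>expos_deg r (\<lambda>_. 1) j. c (\<alpha>, K) * pmono r Y \<alpha> y)"
          using i(3) by (simp add: finite_subsets_of_card)
        finally show ?thesis by simp
      qed
      then have "c (\<alpha>, K) = 0"
        using S i(2) by (intro indep_familyD[where c = "\<lambda>\<alpha>. c (\<alpha>, K)" and j = \<alpha>]) (auto simp: frame_def)
      then show "c i = 0" by (simp add: i)
    qed
  qed
qed

end

subsection \<open>Generating functions\<close>

text \<open>The coefficient of \<open>z ^ j\<close> in the product of the
  \<open>1 / (1 - c i * z ^ d i)\<close>. It is the trace in degree \<open>j\<close> of the algebra
  map that scales the generator of degree \<open>d i\<close> by \<open>c i\<close>; for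
  \<open>d = (\<lambda>_. 1)\<close> it is a complete homogeneous symmetric polynomial.\<close>

definition hsum :: "nat \<Rightarrow> (nat \<Rightarrow> nat) \<Rightarrow> (nat \<Rightarrow> complex) \<Rightarrow> nat \<Rightarrow> complex" where
  "hsum r d c j = (\<Sum>\<alpha>\<in>expos_deg r d j. \<Prod>i<r. c i ^ \<alpha> i)"

definition fac :: "(nat \<Rightarrow> complex) \<Rightarrow> (nat \<Rightarrow> nat) \<Rightarrow> nat \<Rightarrow> complex poly" where
  "fac c d i = 1 - Polynomial.monom (c i) (d i)"

lemma poly_fac: "poly (fac c d i) z = 1 - c i * z ^ d i"
  by (simp add: fac_def poly_monom)

lemma hsum_recursion:
  assumes d: "\<And>i. i < Suc r \<Longrightarrow> d i \<ge> 1"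
  shows "hsum (Suc r) d c j = hsum r d c j + (if j < d r then 0 else c r * hsum (Suc r) d c (j - d r))"
proof -
  let ?A = "expos_deg (Suc r) d j"
  let ?m = "\<lambda>\<alpha>. \<Prod>i<Suc r. c i ^ \<alpha> i"
  have fin: "finite ?A" using d by (rule finite_expos_deg)
  have "{\<alpha> \<in> ?A. \<alpha> r = 0} = expos_deg r d j"
  proof (intro subset_antisym subsetI)
    fix \<alpha> assume "\<alpha> \<in> {\<alpha> \<in> ?A. \<alpha> r = 0}"
    moreover from this have "\<alpha> i = 0" if "i \<ge> r" for i
      using that by (cases "i = r") (auto simp: expos_deg_def expos_def)
    ultimately show "\<alpha> \<in> expos_deg r d j" by (auto simp: expos_deg_def expos_def wdeg_def)
  qed (auto simp: expos_deg_def expos_def wdeg_def)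
  then have 0: "sum ?m {\<alpha> \<in> ?A. \<alpha> r = 0} = hsum r d c j"
    by (auto simp: hsum_def expos_deg_def expos_def intro!: sum.cong)
  have 1: "sum ?m {\<alpha> \<in> ?A. \<alpha> r \<noteq> 0} = (if j < d r then 0 else c r * hsum (Suc r) d c (j - d r))"
  proof (cases "j < d r")
    case True
    have "\<alpha> r = 0" if "\<alpha> \<in> ?A" for \<alpha>
    proof (rule ccontr)
      assume "\<alpha> r \<noteq> 0"
      then have "d r \<le> \<alpha> r * d r" by simp
      also have "\<dots> \<le> j" using that by (auto simp: expos_deg_def wdeg_def)
      finally show False using True by simp
    qed
    then have "\<forall>\<alpha>\<in>?A. \<alpha> r = 0" by blast
    then have "{\<alpha> \<in> ?A. \<alpha> r \<noteq> 0} = {}" by auto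
    then show ?thesis using True by (simp only: sum.empty if_True)
  next
    case False
    have "sum ?m {\<alpha> \<in> ?A. \<alpha> r \<noteq> 0} = (\<Sum>\<alpha>\<in>expos_deg (Suc r) d (j - d r). c r * ?m \<alpha>)"
    proof (rule sum.reindex_bij_witness[where
          i = "\<lambda>\<alpha>. \<alpha>(r := Suc (\<alpha> r))" and j = "\<lambda>\<alpha>. \<alpha>(r := \<alpha> r - 1)"])
      fix \<alpha> assume a: "\<alpha> \<in> {\<alpha> \<in> ?A. \<alpha> r \<noteq> 0}"
      then obtain n where n: "\<alpha> r = Suc n" by (cases "\<alpha> r") auto
      show "(\<alpha>(r := \<alpha> r - 1))(r := Suc ((\<alpha>(r := \<alpha> r - 1)) r)) = \<alpha>" using n by auto
      show "\<alpha>(r := \<alpha> r - 1) \<in> expos_deg (Suc r) d (j - d r)"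
        using a n by (auto simp: expos_deg_def expos_def wdeg_def)
      show "c r * ?m (\<alpha>(r := \<alpha> r - 1)) = ?m \<alpha>" by (simp add: n)
    next
      fix \<alpha> assume a: "\<alpha> \<in> expos_deg (Suc r) d (j - d r)"
      show "(\<alpha>(r := Suc (\<alpha> r)))(r := (\<alpha>(r := Suc (\<alpha> r))) r - 1) = \<alpha>" by auto
      show "\<alpha>(r := Suc (\<alpha> r)) \<in> {\<alpha> \<in> ?A. \<alpha> r \<noteq> 0}"
        using a False by (auto simp: expos_deg_def expos_def wdeg_def)
    qed
    then show ?thesis using False by (simp add: hsum_def sum_distrib_left)
  qed
  have "hsum (Suc r) d c j = sum ?m ({\<alpha> \<in> ?A. \<alpha> r = 0} \<union> {\<alpha> \<in> ?A. \<alpha> r \<noteq> 0})"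
    unfolding hsum_def by (rule sum.cong) auto
  also have "\<dots> = sum ?m {\<alpha> \<in> ?A. \<alpha> r = 0} + sum ?m {\<alpha> \<in> ?A. \<alpha> r \<noteq> 0}"
    using fin by (intro sum.union_disjoint) auto
  finally show ?thesis by (simp only: 0 1)
qed

lemma fps_of_poly_fac: "fps_of_poly (fac c d i) = 1 - fps_const (c i) * fps_X ^ d i"
  by (simp add: fac_def fps_of_poly_diff fps_of_poly_monom)

lemma hsum_fps_mult:
  assumes "\<And>i. i < r \<Longrightarrow> d i \<ge> 1"
  shows "Abs_fps (hsum r d c) * (\<Prod>i<r. fps_of_poly (fac c d i)) = 1"
  using assms
proof (induction r)
  case 0
  have "expos_deg 0 d j = (if j = 0 then {\<lambda>_. 0} else {})" for j
    by (auto simp: expos_deg_def expos_def wdeg_def)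
  then show ?case by (auto simp: fps_eq_iff hsum_def)
next
  case (Suc r)
  have "Abs_fps (hsum (Suc r) d c) * fps_of_poly (fac c d r) = Abs_fps (hsum r d c)"
  proof (rule fps_ext)
    fix j
    have "(Abs_fps (hsum (Suc r) d c) * fps_of_poly (fac c d r)) =
        Abs_fps (hsum (Suc r) d c) - fps_const (c r) * (fps_X ^ d r * Abs_fps (hsum (Suc r) d c))"
      unfolding fps_of_poly_fac by (simp add: algebra_simps)
    then show "fps_nth (Abs_fps (hsum (Suc r) d c) * fps_of_poly (fac c d r)) j = fps_nth (Abs_fps (hsum r d c)) j"
      using hsum_recursion[of r d c j] Suc.prems by (simp add: fps_X_power_mult_nth)
  qed
  moreover have "Abs_fps (hsum (Suc r) d c) * (\<Prod>i<Suc r. fps_of_poly (fac c d i)) =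
      Abs_fps (hsum (Suc r) d c) * fps_of_poly (fac c d r) * (\<Prod>i<r. fps_of_poly (fac c d i))"
    by (simp only: prod.lessThan_Suc mult.assoc mult.commute[of "fps_of_poly (fac c d r)"])
  moreover have "Abs_fps (hsum r d c) * (\<Prod>i<r. fps_of_poly (fac c d i)) = 1" using Suc by simp
  ultimately show ?case by (simp only:)
qed

lemma hsum_fps:
  assumes "\<And>i. i < r \<Longrightarrow> d i \<ge> 1"
  shows "Abs_fps (hsum r d c) = inverse (fps_of_poly (\<Prod>i<r. fac c d i))"
proof -
  have "inverse (\<Prod>i<r. fps_of_poly (fac c d i)) = Abs_fps (hsum r d c)"
    using hsum_fps_mult[of r d c] assms by (intro fps_inverse_unique) (simp add: mult.commute)
  then show ?thesis by (simp add: fps_of_poly_prod)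
qed

text \<open>With \<open>rational_identity_eval\<close> this carries an identity of rational
  functions between power series at 0 and values at a point: both amount to the same identity of
  polynomials with denominators cleared.\<close>

lemma rational_identity_fps:
  fixes n q :: "'k \<Rightarrow> complex poly"
  assumes "finite K" "\<And>k. k \<in> K \<Longrightarrow> poly (q k) 0 \<noteq> 0" "poly Q 0 \<noteq> 0"
  shows "(\<Sum>k\<in>K. fps_of_poly (n k) * inverse (fps_of_poly (q k))) = fps_of_poly m * inverse (fps_of_poly Q) \<longleftrightarrow>
    (\<Sum>k\<in>K. n k * (\<Prod>l\<in>K - {k}. q l)) * Q = m * (\<Prod>k\<in>K. q k)"
proof -
  let ?P = "fps_of_poly ((\<Prod>k\<in>K. q k) * Q)"
  have inv: "inverse (fps_of_poly a) * fps_of_poly a = 1" if "poly a 0 \<noteq> 0" for a :: "complex poly"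
    using that by (intro inverse_mult_eq_1) (simp add: poly_0_coeff_0)
  have "poly ((\<Prod>k\<in>K. q k) * Q) 0 \<noteq> 0" using assms by (simp add: poly_prod)
  then have "((\<Prod>k\<in>K. q k) * Q) \<noteq> 0" by (metis poly_0)
  then have P: "?P \<noteq> 0" by simp
  have "(\<Sum>k\<in>K. fps_of_poly (n k) * inverse (fps_of_poly (q k))) * ?P =
      (\<Sum>k\<in>K. fps_of_poly (n k) * inverse (fps_of_poly (q k)) * fps_of_poly (\<Prod>k\<in>K. q k)) * fps_of_poly Q"
    by (simp add: fps_of_poly_mult sum_distrib_right mult.assoc)
  also have "\<dots> = (\<Sum>k\<in>K. fps_of_poly (n k) * (inverse (fps_of_poly (q k)) * fps_of_poly (q k)) *
        fps_of_poly (\<Prod>l\<in>K - {k}. q l)) * fps_of_poly Q"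
    by (intro arg_cong[of _ _ "\<lambda>x. x * fps_of_poly Q"] sum.cong refl)
      (simp only: prod.remove[OF assms(1)] fps_of_poly_mult mult.assoc)
  also have "\<dots> = fps_of_poly ((\<Sum>k\<in>K. n k * (\<Prod>l\<in>K - {k}. q l)) * Q)"
    using assms(2) by (simp add: inv fps_of_poly_mult fps_of_poly_sum)
  finally have 1: "(\<Sum>k\<in>K. fps_of_poly (n k) * inverse (fps_of_poly (q k))) * ?P = \<dots>" .
  have "fps_of_poly m * inverse (fps_of_poly Q) * ?P =
      fps_of_poly m * (inverse (fps_of_poly Q) * fps_of_poly Q) * fps_of_poly (\<Prod>k\<in>K. q k)"
    by (simp add: fps_of_poly_mult mult_ac)
  then have 2: "fps_of_poly m * inverse (fps_of_poly Q) * ?P = fps_of_poly (m * (\<Prod>k\<in>K. q k))"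
    using assms(3) by (simp add: inv fps_of_poly_mult)
  let ?l = "\<Sum>k\<in>K. fps_of_poly (n k) * inverse (fps_of_poly (q k))"
  let ?r = "fps_of_poly m * inverse (fps_of_poly Q)"
  have "?l = ?r \<longleftrightarrow> ?l * ?P = ?r * ?P" using P by (simp only: mult_cancel_right) blast
  also have "\<dots> \<longleftrightarrow> fps_of_poly ((\<Sum>k\<in>K. n k * (\<Prod>l\<in>K - {k}. q l)) * Q) = fps_of_poly (m * (\<Prod>k\<in>K. q k))"
    by (simp only: 1 2)
  also have "\<dots> \<longleftrightarrow> (\<Sum>k\<in>K. n k * (\<Prod>l\<in>K - {k}. q l)) * Q = m * (\<Prod>k\<in>K. q k)"
    by (rule fps_of_poly_eq_iff)
  finally show ?thesis .
qed

lemma rational_identity_eval: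
  fixes n q :: "'k \<Rightarrow> complex poly"
  assumes "finite K" "\<And>k. k \<in> K \<Longrightarrow> poly (q k) z \<noteq> 0" "poly Q z \<noteq> 0"
  shows "(\<Sum>k\<in>K. poly (n k) z / poly (q k) z) = poly m z / poly Q z \<longleftrightarrow>
    poly ((\<Sum>k\<in>K. n k * (\<Prod>l\<in>K - {k}. q l)) * Q) z = poly (m * (\<Prod>k\<in>K. q k)) z"
proof -
  let ?P = "\<Prod>k\<in>K. poly (q k) z"
  have P: "?P \<noteq> 0" using assms by auto
  have "(\<Sum>k\<in>K. poly (n k) z / poly (q k) z) * ?P = (\<Sum>k\<in>K. poly (n k) z * (\<Prod>l\<in>K - {k}. poly (q l) z))"
    unfolding sum_distrib_right
    by (rule sum.cong) (use assms in \<open>auto simp: prod.remove[OF assms(1)]\<close>)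
  then have "poly ((\<Sum>k\<in>K. n k * (\<Prod>l\<in>K - {k}. q l)) * Q) z =
      (\<Sum>k\<in>K. poly (n k) z / poly (q k) z) * ?P * poly Q z"
    by (simp add: poly_sum poly_prod)
  then show ?thesis using P assms(3) by (auto simp: field_simps poly_prod)
qed

text \<open>The substitution \<open>z \<mapsto> 1/z\<close> in Molien's formula.\<close>

lemma molien_reciprocity:
  fixes lam :: "'k \<Rightarrow> nat \<Rightarrow> complex"
  assumes K: "finite K" and lam: "\<And>k i. k \<in> K \<Longrightarrow> i < r \<Longrightarrow> lam k i \<noteq> 0"
    and d: "\<And>i. i < r \<Longrightarrow> d i \<ge> 1"
    and molien: "\<And>j. (\<Sum>k\<in>K. hsum r (\<lambda>_. 1) (\<lambda>i. inverse (lam k i)) j) = of_nat (card K) * hsum r d (\<lambda>_. 1) j"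
  shows "(\<Sum>k\<in>K. (\<Prod>i<r. lam k i) * hsum r (\<lambda>_. 1) (lam k) j) =
    (if j < (\<Sum>i<r. d i - 1) then 0 else of_nat (card K) * hsum r d (\<lambda>_. 1) (j - (\<Sum>i<r. d i - 1)))"
proof -
  let ?s = "\<Sum>i<r. d i - 1"
  define q where "q k = (\<Prod>i<r. fac (\<lambda>i. inverse (lam k i)) (\<lambda>_. 1) i)" for k
  define q' where "q' k = (\<Prod>i<r. fac (lam k) (\<lambda>_. 1) i)" for k
  define Q where "Q = (\<Prod>i<r. fac (\<lambda>_. 1) d i)"
  define C where "C = [:of_nat (card K) :: complex:]"
  define L where "L k = [:\<Prod>i<r. lam k i:]" for k
  define M where "M = C * Polynomial.monom 1 ?s"
  have one_div_prod: "1 / (\<Prod>i<r. f i) = (\<Prod>i<r. 1 / f i)" for f :: "nat \<Rightarrow> complex"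
    by (simp add: prod_dividef)
  have q0: "poly (q k) 0 \<noteq> 0" "poly (q' k) 0 \<noteq> 0" for k
    by (auto simp: q_def q'_def poly_prod poly_fac)
  have Q0: "poly Q 0 \<noteq> 0" using d by (fastforce simp: Q_def poly_prod poly_fac power_0_left)
  have hQ: "Abs_fps (hsum r d (\<lambda>_. 1)) = inverse (fps_of_poly Q)" unfolding Q_def by (rule hsum_fps[OF d])
  have hq: "Abs_fps (hsum r (\<lambda>_. 1) (\<lambda>i. inverse (lam k i))) = inverse (fps_of_poly (q k))" for k
    unfolding q_def by (rule hsum_fps) simp
  have hq': "Abs_fps (hsum r (\<lambda>_. 1) (lam k)) = inverse (fps_of_poly (q' k))" for k
    unfolding q'_def by (rule hsum_fps) simp
  have "(\<Sum>k\<in>K. fps_of_poly 1 * inverse (fps_of_poly (q k))) = fps_of_poly C * inverse (fps_of_poly Q)"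
    by (rule fps_ext) (simp add: hQ[symmetric] hq[symmetric] C_def fps_sum_nth molien[unfolded One_nat_def] fps_of_poly_const)
  then have E: "(\<Sum>k\<in>K. 1 * (\<Prod>l\<in>K - {k}. q l)) * Q = C * (\<Prod>k\<in>K. q k)"
    by (subst (asm) rational_identity_fps[where q = q, OF K q0(1) Q0])
  define D where "D = (\<Sum>k\<in>K. L k * (\<Prod>l\<in>K - {k}. q' l)) * Q - M * (\<Prod>k\<in>K. q' k)"
  \<comment> \<open>\<open>D = 0\<close> is the claim with denominators cleared. The extra factor
    vanishes at 0 and at all zeros of the denominators, so only points remain where the substitution
    is legitimate.\<close>
  have "poly (D * ([:0, 1:] * (\<Prod>k\<in>K. q' k) * Q)) z = 0" for z
  proof (cases "z = 0 \<or> (\<exists>k\<in>K. poly (q' k) z = 0) \<or> poly Q z = 0")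
    case True
    then show ?thesis using K by (auto simp: poly_prod)
  next
    case False
    then have z: "z \<noteq> 0" "\<And>k. k \<in> K \<Longrightarrow> poly (q' k) z \<noteq> 0" "poly Q z \<noteq> 0" by auto
    have lz: "1 - lam k i * z \<noteq> 0" if "k \<in> K" "i < r" for k i
      using z(2)[OF that(1)] that(2) by (auto simp: q'_def poly_prod poly_fac)
    have dz: "1 - z ^ d i \<noteq> 0" if "i < r" for i
      using z(3) that by (auto simp: Q_def poly_prod poly_fac)
    have fq: "poly (fac (\<lambda>i. inverse (lam k i)) (\<lambda>_. 1) i) (1/z) = - ((1 - lam k i * z) / (lam k i * z))"
      if "k \<in> K" "i < r" for k i
      using lam[OF that] z(1) by (simp add: poly_fac field_simps)
    have fQ: "poly (fac (\<lambda>_. 1) d i) (1/z) = - ((1 - z ^ d i) / (z ^ d i))" for i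
      using z(1) by (simp add: poly_fac field_simps)
    have qz: "poly (q k) (1/z) \<noteq> 0" if "k \<in> K" for k
      using lz[OF that] lam[OF that] z(1) by (auto simp: q_def poly_prod fq[OF that] simp del: One_nat_def)
    have Qz: "poly Q (1/z) \<noteq> 0"
      using dz z(1) by (auto simp: Q_def poly_prod fQ)
    have I: "(\<Sum>k\<in>K. poly 1 (1/z) / poly (q k) (1/z)) = poly C (1/z) / poly Q (1/z)"
      using rational_identity_eval[where n = "\<lambda>_. 1" and m = C and q = q, OF K qz Qz] arg_cong[OF E, of "\<lambda>p. poly p (1/z)"] by blast
    \<comment> \<open>Each factor turns from \<open>1 / (1 - 1 / (l * z))\<close> into
      \<open>- z * l / (1 - l * z)\<close>; this is where the determinant of \<open>k\<close>
      appears.\<close>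
    have 1: "1 / poly (q k) (1/z) = (- z) ^ r * (poly (L k) z / poly (q' k) z)" if "k \<in> K" for k
    proof -
      have "1 / poly (q k) (1/z) = (\<Prod>i<r. - z * (lam k i / (1 - lam k i * z)))"
        unfolding q_def poly_prod one_div_prod
        by (rule prod.cong) (use that in \<open>auto simp: fq simp del: One_nat_def\<close>)
      also have "\<dots> = (- z) ^ r * (poly (L k) z / poly (q' k) z)"
        by (simp only: prod.distrib prod_dividef) (simp add: L_def q'_def poly_prod poly_fac)
      finally show ?thesis .
    qed
    \<comment> \<open>Here \<open>1 / (1 - 1 / z ^ d)\<close> is
      \<open>- z * z ^ (d - 1) / (1 - z ^ d)\<close>, whence the degree shift \<open>?s\<close>. The
      power of \<open>- z\<close> is the same on both sides and cancels.\<close>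
    have 2: "poly C (1/z) / poly Q (1/z) = (- z) ^ r * (poly M z / poly Q z)"
    proof -
      have "1 / poly Q (1/z) = (\<Prod>i<r. - z * (z ^ (d i - 1) / (1 - z ^ d i)))"
        unfolding Q_def poly_prod one_div_prod
      proof (rule prod.cong)
        fix i assume "i \<in> {..<r}"
        then have "z ^ d i = z * z ^ (d i - 1)" using d[of i] by (simp flip: power_Suc)
        then show "1 / poly (fac (\<lambda>_. 1) d i) (1/z) = - z * (z ^ (d i - 1) / (1 - z ^ d i))"
          by (simp add: fQ)
      qed simp
      also have "\<dots> = (- z) ^ r * (z ^ ?s / poly Q z)"
        by (simp only: prod.distrib prod_dividef) (simp add: power_sum Q_def poly_prod poly_fac)
      finally have "1 / poly Q (1/z) = (- z) ^ r * (z ^ ?s / poly Q z)" .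
      then have "of_nat (card K) * (1 / poly Q (1/z)) = of_nat (card K) * ((- z) ^ r * (z ^ ?s / poly Q z))"
        by (simp only:)
      then show ?thesis by (simp add: M_def C_def poly_monom mult_ac)
    qed
    have "(- z) ^ r * (\<Sum>k\<in>K. poly (L k) z / poly (q' k) z) = (- z) ^ r * (poly M z / poly Q z)"
      unfolding sum_distrib_left using I 1 2 by simp
    then have "(\<Sum>k\<in>K. poly (L k) z / poly (q' k) z) = poly M z / poly Q z"
      by (rule mult_left_cancel[THEN iffD1, rotated]) (use z(1) in simp)
    then have "poly D z = 0"
      unfolding D_def using rational_identity_eval[where n = L and m = M and q = q', OF K z(2,3)] by simp
    then show ?thesis by simp
  qed
  then have "D * ([:0, 1:] * (\<Prod>k\<in>K. q' k) * Q) = 0"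
    by (simp add: poly_eq_poly_eq_iff[symmetric] fun_eq_iff)
  moreover have "q' k \<noteq> 0" for k using q0(2)[of k] by auto
  then have "[:0, 1:] * (\<Prod>k\<in>K. q' k) * Q \<noteq> 0" using K Q0 by auto
  ultimately have "D = 0" by (metis mult_eq_0_iff)
  then have "(\<Sum>k\<in>K. fps_of_poly (L k) * inverse (fps_of_poly (q' k))) = fps_of_poly M * inverse (fps_of_poly Q)"
    by (subst rational_identity_fps[where q = q', OF K q0(2) Q0]) (simp add: D_def)
  then have "(\<Sum>k\<in>K. fps_const (\<Prod>i<r. lam k i) * Abs_fps (hsum r (\<lambda>_. 1) (lam k))) =
      fps_const (of_nat (card K)) * (fps_X ^ ?s * Abs_fps (hsum r d (\<lambda>_. 1)))"
    by (simp only: hQ hq' L_def M_def C_def fps_of_poly_const fps_of_poly_mult fps_of_poly_monom)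
      (simp add: mult_ac)
  from arg_cong[OF this, of "\<lambda>f. fps_nth f j"] show ?thesis
    by (simp add: fps_sum_nth fps_X_power_mult_nth)
qed

text \<open>For \<open>c \<noteq> 1\<close> numerator and denominator both tend to
  \<open>1 - c\<close>. For \<open>c = 1\<close> both have the factor \<open>1 - z\<close>; dividing
  it out leaves the \<open>d - 1\<close> powers below \<open>z ^ (d - 1)\<close> plus
  \<open>y * z ^ (d - 1)\<close> over a geometric sum with \<open>d\<close> terms.\<close>

lemma factor_limit:
  fixes c y :: complex
  assumes "d \<ge> 1"
  shows "((\<lambda>z :: real. (1 + (y * (1 - of_real z) - 1) * c * of_real z ^ (d - 1)) / (1 - c * of_real z ^ d))
    \<longlongrightarrow> (if c = 1 then (y + of_nat d - 1) / of_nat d else 1)) (at_left 1)"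
proof (cases "c = 1")
  case False
  have "((\<lambda>z :: real. (1 + (y * (1 - of_real z) - 1) * c * of_real z ^ (d - 1)) / (1 - c * of_real z ^ d))
      \<longlongrightarrow> (1 + (y * (1 - of_real 1) - 1) * c * of_real 1 ^ (d - 1)) / (1 - c * of_real 1 ^ d)) (at_left 1)"
    using False by (intro tendsto_intros) auto
  with False show ?thesis by simp
next
  case True
  have ev: "\<forall>\<^sub>F z in at_left (1::real). z < 1" by (simp add: eventually_at_filter)
  have eq: "(1 + (y * (1 - z) - 1) * z ^ (d - 1)) / (1 - z ^ d) =
      ((\<Sum>i<d-1. z ^ i) + y * z ^ (d - 1)) / (\<Sum>i<d. z ^ i)" if "z \<noteq> 1" for z :: complex
  proof -
    have "1 - z ^ d = (1 - z) * (\<Sum>i<d. z ^ i)" "1 - z ^ (d - 1) = (1 - z) * (\<Sum>i<d-1. z ^ i)"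
      by (rule one_diff_power_eq)+
    moreover from this(2) have "1 + (y * (1 - z) - 1) * z ^ (d - 1) =
        (1 - z) * ((\<Sum>i<d-1. z ^ i) + y * z ^ (d - 1))" by (simp add: algebra_simps)
    ultimately show ?thesis using that by simp
  qed
  have "((\<lambda>z :: real. ((\<Sum>i<d-1. of_real z ^ i) + y * of_real z ^ (d - 1)) / (\<Sum>i<d. of_real z ^ i))
      \<longlongrightarrow> ((\<Sum>i<d-1. of_real 1 ^ i) + y * of_real 1 ^ (d - 1)) / (\<Sum>i<d. (of_real 1 :: complex) ^ i)) (at_left 1)"
    using assms by (intro tendsto_intros) auto
  moreover have "((\<Sum>i<d-1. of_real 1 ^ i) + y * of_real 1 ^ (d - 1)) / (\<Sum>i<d. (of_real 1 :: complex) ^ i) =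
      (y + of_nat d - 1) / of_nat d"
    using assms by (simp add: of_nat_diff add.commute)
  ultimately have "((\<lambda>z :: real. ((\<Sum>i<d-1. of_real z ^ i) + y * of_real z ^ (d - 1)) / (\<Sum>i<d. of_real z ^ i))
      \<longlongrightarrow> (y + of_nat d - 1) / of_nat d) (at_left 1)" by metis
  then have "((\<lambda>z :: real. (1 + (y * (1 - of_real z) - 1) * of_real z ^ (d - 1)) / (1 - of_real z ^ d))
      \<longlongrightarrow> (y + of_nat d - 1) / of_nat d) (at_left 1)"
  proof (rule Lim_transform_eventually)
    show "\<forall>\<^sub>F z :: real in at_left 1. ((\<Sum>i<d-1. of_real z ^ i) + y * of_real z ^ (d - 1)) / (\<Sum>i<d. of_real z ^ i) =
        (1 + (y * (1 - of_real z) - 1) * of_real z ^ (d - 1)) / (1 - of_real z ^ d)"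
      using ev by eventually_elim (rule eq[symmetric], simp add: of_real_eq_1_iff)
  qed
  with True show ?thesis by simp
qed

subsection \<open>Eigenbases for maps of finite order\<close>

lemma frame_span: "finite J \<Longrightarrow> indep_family J b \<Longrightarrow> frame J b (fs.span (b ` J))"
  by (simp add: frame_def range_lincomb_eq_span)

text \<open>A discrete Fourier transform over the powers of \<open>x\<close>. The components lie in
  the span of the translates of \<open>f\<close>, so they stay in every \<open>x\<close>-stable
  subspace containing \<open>f\<close>.\<close>

lemma eigen_sum:
  fixes x :: "'a \<Rightarrow> 'a" and f :: "'a \<Rightarrow> complex"
  assumes n: "n > 0" and x: "x ^^ n = id"
  obtains g c where "f = (\<Sum>j<n. g j)" "\<And>j. (\<lambda>v. g j (x v)) = (\<lambda>v. c j * g j v)" "\<And>j. c j ^ n = 1"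
    "\<And>j. g j \<in> fs.span ((\<lambda>k v. f ((x ^^ k) v)) ` UNIV)"
proof -
  define z where "z = cis (2 * pi / real n)"
  have zn: "z ^ n = 1" using n by (simp add: z_def DeMoivre)
  have z0: "z \<noteq> 0" by (simp add: z_def)
  have zk: "z ^ k \<noteq> 1" if "0 < k" "k < n" for k
  proof
    assume "z ^ k = 1"
    then have "cis (real k * (2 * pi / real n)) = 1" by (simp add: z_def DeMoivre)
    then have "cos (2 * pi * (real k / real n)) = 1" by (simp add: complex_eq_iff mult_ac)
    then obtain m :: int where "2 * pi * (real k / real n) = of_int m * 2 * pi"
      by (auto simp: cos_one_2pi_int)
    then have "real k = of_int m * real n" using n by (simp add: field_simps)
    then have eq: "int k = m * int n" by (metis of_int_eq_iff of_int_mult of_int_of_nat_eq)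
    have "m \<ge> 1" using eq that n by (metis int_one_le_iff_zero_less of_nat_0_less_iff zero_less_mult_pos2)
    then have "int n \<le> int k" unfolding eq using n by simp
    then show False using that by simp
  qed
  have zp: "(z ^ j) ^ n = 1" for j by (metis zn mult.commute power_mult power_one)
  define g where "g j v = (1 / of_nat n) * (\<Sum>k<n. inverse (z ^ j) ^ k * f ((x ^^ k) v))" for j v
  have eig: "g j (x v) = z ^ j * g j v" for j v
  proof -
    let ?a = "\<lambda>k. inverse (z ^ j) ^ k * f ((x ^^ k) v)"
    have zj: "inverse (z ^ j) ^ n = 1" using zp[of j] by (metis inverse_1 power_inverse)
    have "?a n = ?a 0" using x zj by simp
    then have "(\<Sum>k<n. ?a (Suc k)) = (\<Sum>k<n. ?a k)"
      using sum.lessThan_Suc_shift[of ?a n] by (simp only: sum.lessThan_Suc) simp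
    moreover have "(\<Sum>k<n. ?a (Suc k)) = inverse (z ^ j) * (\<Sum>k<n. inverse (z ^ j) ^ k * f ((x ^^ k) (x v)))"
      by (simp add: sum_distrib_left mult_ac funpow_swap1)
    ultimately show ?thesis using z0 by (simp add: g_def field_simps)
  qed
  have sumg: "f v = (\<Sum>j<n. g j v)" for v
  proof -
    have "(\<Sum>j<n. g j v) = (1 / of_nat n) * (\<Sum>j<n. \<Sum>k<n. inverse (z ^ j) ^ k * f ((x ^^ k) v))"
      by (simp add: g_def sum_distrib_left)
    also have "(\<Sum>j<n. \<Sum>k<n. inverse (z ^ j) ^ k * f ((x ^^ k) v)) =
        (\<Sum>k<n. (\<Sum>j<n. inverse (z ^ k) ^ j) * f ((x ^^ k) v))"
      by (subst sum.swap) (simp add: sum_distrib_left sum_distrib_right power_inverse mult.commute flip: power_mult)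
    also have "\<dots> = (\<Sum>k<n. if k = 0 then of_nat n * f v else 0)"
    proof (rule sum.cong)
      fix k assume k: "k \<in> {..<n}"
      show "(\<Sum>j<n. inverse (z ^ k) ^ j) * f ((x ^^ k) v) = (if k = 0 then of_nat n * f v else 0)"
      proof (cases "k = 0")
        case False
        with zk k have "inverse (z ^ k) \<noteq> 1" by simp
        moreover have "inverse (z ^ k) ^ n = 1"
          using zp[of k] by (metis inverse_1 power_inverse)
        ultimately have "(\<Sum>j<n. inverse (z ^ k) ^ j) = 0" by (simp add: geometric_sum)
        with False show ?thesis by simp
      qed simp
    qed simp
    finally show ?thesis using n by simp
  qed
  show thesis
  proof (rule that[of g "\<lambda>j. z ^ j"])
    show "f = (\<Sum>j<n. g j)" using sumg by (auto simp: fun_eq_iff sum_fun_apply)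
    show "(\<lambda>v. g j (x v)) = (\<lambda>v. z ^ j * g j v)" for j using eig by auto
    show "(z ^ j) ^ n = 1" for j by (rule zp)
    show "g j \<in> fs.span ((\<lambda>k v. f ((x ^^ k) v)) ` UNIV)" for j
    proof -
      have "g j = fscale (1 / of_nat n) (lincomb {..<n} (\<lambda>k v. f ((x ^^ k) v)) (\<lambda>k. inverse (z ^ j) ^ k))"
        by (auto simp: g_def fscale_def lincomb_def fun_eq_iff)
      then show ?thesis by (simp only:) (rule fs.span_scale, rule lincomb_in_span, blast)
    qed
  qed
qed

text \<open>Applied to homogeneous components \<open>P j\<close>, this gives eigenvectors that each
  have a degree, on which the weights will depend. The Fourier components of the \<open>N i\<close>
  are eigenvectors inside the \<open>P j\<close> and span \<open>E\<close>, so a maximal independent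
  set of such vectors is a basis. Nothing is claimed about how \<open>d'\<close> relates to
  \<open>d\<close>.\<close>

lemma eigen_frame:
  fixes x :: "'a \<Rightarrow> 'a" and N :: "nat \<Rightarrow> 'a \<Rightarrow> complex"
  assumes n: "n > 0" and x: "x ^^ n = id"
    and N: "frame {..<r} N E" and stable: "\<And>f. f \<in> E \<Longrightarrow> (\<lambda>v. f (x v)) \<in> E"
    and P: "\<And>j. fs.subspace (P j)" "\<And>f j. f \<in> P j \<Longrightarrow> (\<lambda>v. f (x v)) \<in> P j" "\<And>i. i < r \<Longrightarrow> N i \<in> P (d i)"
  obtains F' c d' where "frame {..<r} F' E" "\<And>i. i < r \<Longrightarrow> F' i \<in> P (d' i)"
    "\<And>i. i < r \<Longrightarrow> (\<lambda>v. F' i (x v)) = (\<lambda>v. c i * F' i v)" "\<And>i. i < r \<Longrightarrow> c i ^ n = 1"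
proof -
  let ?G = "{f \<in> E. \<exists>c j. f \<in> P j \<and> (\<lambda>v. f (x v)) = (\<lambda>v. c * f v) \<and> c ^ n = 1}"
  have E: "E = fs.span (N ` {..<r})" using N by (simp add: frame_def range_lincomb_eq_span)
  have subE: "fs.subspace E" unfolding E by (rule fs.subspace_span)
  have pow: "(\<lambda>v. f ((x ^^ k) v)) \<in> U" if "f \<in> U" "\<And>f. f \<in> U \<Longrightarrow> (\<lambda>v. f (x v)) \<in> U" for f U k
  proof (induction k)
    case (Suc k)
    from that(2)[OF Suc] show ?case by (simp add: funpow_swap1)
  qed (use that in simp)
  have spanG: "E \<subseteq> fs.span ?G"
  proof -
    have "N i \<in> fs.span ?G" if i: "i < r" for i
    proof -
      obtain g c where g: "N i = (\<Sum>j<n. g j)" "\<And>j. (\<lambda>v. g j (x v)) = (\<lambda>v. c j * g j v)" "\<And>j. c j ^ n = 1"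
        "\<And>j. g j \<in> fs.span ((\<lambda>k v. N i ((x ^^ k) v)) ` UNIV)"
        using eigen_sum[OF n x, of "N i"] by blast
      have NE: "N i \<in> E" using frame_elem[OF N] i by simp
      have "g j \<in> ?G" for j
      proof -
        have "g j \<in> E" using g(4) fs.span_minimal[of "(\<lambda>k v. N i ((x ^^ k) v)) ` UNIV" E] pow[OF NE stable] subE by blast
        moreover have "g j \<in> P (d i)"
          using g(4) fs.span_minimal[of "(\<lambda>k v. N i ((x ^^ k) v)) ` UNIV" "P (d i)"] pow[OF P(3)[OF i] P(2)] P(1) by blast
        ultimately show ?thesis using g(2,3) by blast
      qed
      then show ?thesis unfolding g(1) by (intro fs.span_sum fs.span_base)
    qed
    then show ?thesis unfolding E by (intro fs.span_minimal) auto
  qed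
  obtain B where B: "B \<subseteq> ?G" "fs.independent B" "?G \<subseteq> fs.span B"
    using fs.maximal_independent_subset[of ?G] by blast
  have "B \<subseteq> fs.span (N ` {..<r})" using B(1) E by auto
  with fs.independent_span_bound[of "N ` {..<r}" B] B(2) have fin: "finite B" by simp
  have spanB: "fs.span B = E"
  proof
    show "fs.span B \<subseteq> E" using B(1) subE by (intro fs.span_minimal) auto
    show "E \<subseteq> fs.span B" using spanG B(3) fs.span_minimal[of ?G "fs.span B"] by (auto simp: fs.subspace_span)
  qed
  have ind: "inj_on N {..<r}" "fs.independent (N ` {..<r})"
    using indep_family_imp_independent[of "{..<r}" N] N by (auto simp: frame_def)
  have "card B = fs.dim E" using fs.dim_eq_card[of B E] spanB B(2) by (metis fs.span_span)
  also have "\<dots> = card (N ` {..<r})" using fs.dim_eq_card[of "N ` {..<r}" E] E ind(2) by (metis fs.span_span)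
  finally have "card B = r" using ind(1) by (simp add: card_image)
  then obtain u where u: "bij_betw u {..<r} B"
    using ex_bij_betw_nat_finite[OF fin] by (auto simp: atLeast0LessThan)
  have uB: "u i \<in> B" if "i < r" for i using bij_betwE[OF u] that by blast
  then have "\<forall>i\<in>{..<r}. \<exists>c j. u i \<in> P j \<and> (\<lambda>v. u i (x v)) = (\<lambda>v. c * u i v) \<and> c ^ n = 1"
    using B(1) by blast
  then obtain c d' where cd: "\<forall>i\<in>{..<r}. u i \<in> P (d' i) \<and> (\<lambda>v. u i (x v)) = (\<lambda>v. c i * u i v) \<and> c i ^ n = 1"
    by metis
  have fr: "frame B (\<lambda>f. f) E" using independent_imp_frame[OF fin B(2)] spanB by simp
  have uimg: "u ` {..<r} = B" "inj_on u {..<r}" using u by (auto simp: bij_betw_def)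
  have "indep_family {..<r} u"
    unfolding indep_family_def
  proof (intro allI impI)
    fix a assume a: "lincomb {..<r} u a = 0"
    have "lincomb B (\<lambda>f. f) (\<lambda>f. a (inv_into {..<r} u f)) = lincomb {..<r} u a"
      unfolding lincomb_eq_sum uimg(1)[symmetric] using uimg(2) by (simp add: sum.reindex)
    with a have "lincomb B (\<lambda>f. f) (\<lambda>f. a (inv_into {..<r} u f)) = 0" by (simp only:)
    moreover have "\<forall>c. lincomb B (\<lambda>f. f) c = 0 \<longrightarrow> (\<forall>f\<in>B. c f = 0)"
      using fr by (simp add: frame_def indep_family_def)
    ultimately have "\<forall>f\<in>B. a (inv_into {..<r} u f) = 0"
      using spec[where x = "\<lambda>f. a (inv_into {..<r} u f)"] by blast
    then show "\<forall>i\<in>{..<r}. a i = 0" using uB uimg(2) by (metis inv_into_f_f lessThan_iff)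
  qed
  then have "frame {..<r} u E" using frame_span[of "{..<r}" u] uimg(1) spanB by simp
  then show thesis using that[of u d' c] cd by simp
qed

text \<open>The elementary symmetric polynomial, which is the trace on the exterior power of degree
  \<open>p\<close> of a diagonal map with entries \<open>c i\<close>.\<close>

definition esum :: "nat \<Rightarrow> nat \<Rightarrow> (nat \<Rightarrow> complex) \<Rightarrow> complex" where
  "esum r p c = (\<Sum>I\<in>subsets_of_card r p. \<Prod>i\<in>I. c i)"

context coordinate_space
begin

lemma eigen_cobasis:
  assumes "n > 0" "x ^^ n = id" "linm x"
  obtains Y c where "cobasis Y" "\<And>i v. i < r \<Longrightarrow> Y i (x v) = c i * Y i v" "\<And>i. i < r \<Longrightarrow> c i ^ n = 1"
proof -
  have "indep_family {..<r} X"
    unfolding indep_family_def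
  proof (intro allI impI)
    fix a assume a: "lincomb {..<r} X a = 0"
    show "\<forall>j\<in>{..<r}. a j = 0"
    proof
      fix j assume j: "j \<in> {..<r}"
      have "0 = lincomb {..<r} X a (e j)" using a by simp
      also have "\<dots> = (\<Sum>i<r. if i = j then a i else 0)"
        unfolding lincomb_def using j by (intro sum.cong) (auto simp: X_e)
      finally show "a j = 0" using j by simp
    qed
  qed
  from frame_span[OF finite_lessThan this] have X: "frame {..<r} X (fs.span (X ` {..<r}))" .
  have E: "f \<in> fs.span (X ` {..<r}) \<longleftrightarrow> linf f" for f
  proof
    assume "f \<in> fs.span (X ` {..<r})"
    then obtain c where "f = lincomb {..<r} X c" using X by (auto simp: frame_def)
    then show "linf f" using X_linear by (auto intro: linf_lincomb)
  next
    assume l: "linf f"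
    have "dual_basis X e" unfolding dual_basis_def
      by (intro conjI allI impI) (rule X_e, assumption+, rule X_expand)
    then have "f = lincomb {..<r} X (\<lambda>i. f (e i))"
      unfolding lincomb_def using linf_expand[OF _ l] by (intro ext)
    then have "f \<in> range (lincomb {..<r} X)" by (rule image_eqI[where x = "\<lambda>i. f (e i)"]) simp
    then show "f \<in> fs.span (X ` {..<r})" using X by (simp add: frame_def)
  qed
  obtain Y c where Y: "frame {..<r} Y (fs.span (X ` {..<r}))"
      "\<And>i. i < r \<Longrightarrow> (\<lambda>v. Y i (x v)) = (\<lambda>v. c i * Y i v)" "\<And>i. i < r \<Longrightarrow> c i ^ n = 1"
    by (rule eigen_frame[OF assms(1,2) X, of "\<lambda>_. UNIV" undefined])
      (use E linf_comp assms(3) in \<open>auto simp: fs.subspace_UNIV\<close>)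
  show thesis
  proof (rule that[of Y c])
    show "cobasis Y"
      unfolding cobasis_def
    proof (intro conjI allI impI)
      show "linf (Y i)" if "i < r" for i using frame_elem[OF Y(1)] E that by simp
      fix v assume 0: "\<forall>i<r. Y i v = 0"
      have "X j v = 0" if "j < r" for j
      proof -
        have "X j \<in> range (lincomb {..<r} Y)" using frame_elem[OF X] Y(1) that by (simp add: frame_def)
        then show ?thesis using 0 by (auto simp: lincomb_def)
      qed
      then show "v = 0" using cobasis_X by (simp add: cobasis_def)
    qed
  qed (use Y in \<open>auto dest: fun_cong\<close>)
qed

lemma sym_alg_comp:
  assumes "f \<in> sym_alg scale" "linm x"
  shows "(\<lambda>v. f (x v)) \<in> sym_alg scale"
proof -
  obtain A c where A: "f = lincomb A (pmono r X) c"
    using assms(1) by (auto simp: sym_alg_eq_polyalg[OF cobasis_X] polyalg_explicit)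
  have "(\<lambda>v. f (x v)) = lincomb A (pmono r (\<lambda>i v. X i (x v))) c"
    by (simp add: A lincomb_def pmono_def)
  moreover have "(\<lambda>v. X i (x v)) \<in> polyalg r X" if "i < r" for i
    using linf_sym_comp[OF linf_comp[OF X_linear[OF that] assms(2)]] sym_comp_subset_sym_alg
    by (auto simp: sym_alg_eq_polyalg[OF cobasis_X])
  ultimately show ?thesis
    by (auto simp: sym_alg_eq_polyalg[OF cobasis_X] intro!: polyalg_lincomb polyalg_pmono)
qed

lemma dform_eigen:
  assumes "\<And>b c. b < p \<Longrightarrow> c < p \<Longrightarrow> l' b (w' c) = m b * l b (w c)"
  shows "dform p l' w' = (\<Prod>b<p. m b) * dform p l w"
proof -
  have "of_int (sign \<sigma>) * (\<Prod>b<p. l' (\<sigma> b) (w' b)) =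
      (\<Prod>b<p. m b) * (of_int (sign \<sigma>) * (\<Prod>b<p. l (\<sigma> b) (w b)))" if \<sigma>: "\<sigma> permutes {..<p}" for \<sigma>
  proof -
    have "(\<Prod>b<p. l' (\<sigma> b) (w' b)) = (\<Prod>b<p. m (\<sigma> b) * l (\<sigma> b) (w b))"
      using assms permutes_lessThan[OF \<sigma>] by (intro prod.cong) auto
    also have "\<dots> = (\<Prod>b<p. m (\<sigma> b)) * (\<Prod>b<p. l (\<sigma> b) (w b))" by (rule prod.distrib)
    also have "(\<Prod>b<p. m (\<sigma> b)) = (\<Prod>b<p. m b)"
      by (rule prod.reindex_bij_betw[OF permutes_imp_bij[OF \<sigma>]])
    finally show ?thesis by (simp add: mult_ac)
  qed
  then show ?thesis unfolding dform_eq sum_distrib_left by (intro sum.cong) auto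
qed

lemma prod_enum_set: "I \<in> subsets_of_card r p \<Longrightarrow> (\<Prod>b<p. c (enum_set I b)) = (\<Prod>i\<in>I. c i)"
  by (rule prod.reindex_bij_betw[OF subsets_of_cardD(4)])

lemma sum_enum_set: "I \<in> subsets_of_card r p \<Longrightarrow> (\<Sum>b<p. c (enum_set I b)) = (\<Sum>i\<in>I. c i)"
  by (rule sum.reindex_bij_betw[OF subsets_of_cardD(4)])

lemma form_basis_eigen:
  assumes Y: "\<And>i. i < r \<Longrightarrow> Y i y' = lam i * Y i y" "\<And>i b. i < r \<Longrightarrow> Y i (w' b) = mu i * Y i (w b)"
    and I: "I \<in> subsets_of_card r p"
  shows "form_basis p Y (\<alpha>, I) (y', w') =
    (\<Prod>i<r. lam i ^ \<alpha> i) * (\<Prod>i\<in>I. mu i) * form_basis p Y (\<alpha>, I) (y, w)"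
proof -
  have "dform p (\<lambda>b. Y (enum_set I b)) w' = (\<Prod>b<p. mu (enum_set I b)) * dform p (\<lambda>b. Y (enum_set I b)) w"
    using subsets_of_cardD(5)[OF I] Y(2) by (intro dform_eigen) auto
  moreover have "pmono r Y \<alpha> y' = (\<Prod>i<r. lam i ^ \<alpha> i) * pmono r Y \<alpha> y"
    using Y(1) by (simp add: pmono_def power_mult_distrib prod.distrib)
  ultimately show ?thesis by (simp add: form_basis_def prod_enum_set[OF I])
qed

end

subsection \<open>Invariant differential forms\<close>

lemma DERIV_zero_mult:
  "(f has_field_derivative 0) (at a) \<Longrightarrow> (g has_field_derivative 0) (at a) \<Longrightarrow>
    ((\<lambda>t. f t * g t) has_field_derivative 0) (at (a :: complex))"
  using DERIV_mult[of f 0 a UNIV g 0] by simp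

lemma DERIV_zero_prod:
  "(\<And>i. i \<in> I \<Longrightarrow> (f i has_field_derivative 0) (at a)) \<Longrightarrow>
    ((\<lambda>t. \<Prod>i\<in>I. f i t) has_field_derivative 0) (at (a :: complex))"
  by (induction I rule: infinite_finite_induct) (auto intro: DERIV_zero_mult)

lemma DERIV_zero_power:
  "(f has_field_derivative 0) (at a) \<Longrightarrow> ((\<lambda>t. f t ^ n) has_field_derivative 0) (at (a :: complex))"
  by (induction n) (auto intro: DERIV_zero_mult)

text \<open>The special case of the chain rule that is used below: if all generators are stationary
  along the curve \<open>u\<close>, so is every polynomial in them.\<close>

lemma DERIV_zero_polyalg:
  assumes "f \<in> polyalg r F" "\<And>i. i < r \<Longrightarrow> ((\<lambda>t. F i (u t)) has_field_derivative 0) (at (a :: complex))"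
  shows "((\<lambda>t. f (u t)) has_field_derivative 0) (at a)"
proof -
  obtain A c where f: "f = lincomb A (pmono r F) c" using assms(1) by (auto simp: polyalg_explicit)
  have mono: "((\<lambda>t. pmono r F \<alpha> (u t)) has_field_derivative 0) (at a)" for \<alpha>
    unfolding pmono_def by (intro DERIV_zero_prod DERIV_zero_power assms(2)) simp
  have "((\<lambda>t. \<Sum>\<alpha>\<in>A. c \<alpha> * pmono r F \<alpha> (u t)) has_field_derivative (\<Sum>\<alpha>\<in>A. c \<alpha> * 0)) (at a)"
    by (intro DERIV_sum DERIV_cmult mono)
  then show ?thesis by (simp add: f lincomb_def)
qed

text \<open>The group acts through a map \<open>A\<close> that may have a kernel. One instance is
  \<open>N\<close> acting on \<open>V\<close>; the other is \<open>G\<close> acting on the model of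
  \<open>E\<close>, where all of \<open>N\<close> acts trivially.\<close>

locale invariant_ring = coordinate_space scale Basis r X e + group \<Gamma>
  for scale :: "complex \<Rightarrow> 'v::ab_group_add \<Rightarrow> 'v" and Basis r X e and \<Gamma> :: "('k, 'm) monoid_scheme" (structure) +
  fixes A :: "'k \<Rightarrow> 'v \<Rightarrow> 'v" and F :: "nat \<Rightarrow> 'v \<Rightarrow> complex" and d :: "nat \<Rightarrow> nat"
  assumes fin: "finite (carrier \<Gamma>)"
    and A_linear: "\<And>g. g \<in> carrier \<Gamma> \<Longrightarrow> Vector_Spaces.linear scale scale (A g)"
    and A_mult: "\<And>g h v. g \<in> carrier \<Gamma> \<Longrightarrow> h \<in> carrier \<Gamma> \<Longrightarrow> A (g \<otimes> h) v = A g (A h v)"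
    and A_one: "\<And>v. A \<one> v = v"
    and F_sym: "\<And>i. i < r \<Longrightarrow> F i \<in> sym_comp scale (d i)"
    and F_inv: "\<And>i g v. i < r \<Longrightarrow> g \<in> carrier \<Gamma> \<Longrightarrow> F i (A g v) = F i v"
    and F_indep: "algind r F"
    and F_gen: "\<And>f. f \<in> sym_alg scale \<Longrightarrow> (\<And>g v. g \<in> carrier \<Gamma> \<Longrightarrow> f (A g v) = f v) \<Longrightarrow> f \<in> polyalg r F"
begin

abbreviation "K \<equiv> carrier \<Gamma>"

lemma card_K: "card K > 0"
  using fin one_closed card_gt_0_iff by blast

lemma sum_translate: "k \<in> K \<Longrightarrow> (\<Sum>h\<in>K. f (h \<otimes> k)) = (\<Sum>h\<in>K. f h)"
proof -
  assume k: "k \<in> K"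
  have inj: "inj_on (\<lambda>h. h \<otimes> k) K" using inj_on_multc[OF k] .
  have "(\<lambda>h. h \<otimes> k) ` K = K" using endo_inj_surj[OF fin _ inj] k by blast
  with inj show ?thesis using sum.reindex[OF inj, of f] by simp
qed

text \<open>A generator of degree 0 would be constant, hence linearly dependent on the monomial
  1.\<close>

lemma d_pos:
  assumes i: "i < r"
  shows "d i \<ge> 1"
proof (rule ccontr)
  assume "\<not> d i \<ge> 1"
  then have "d i = 0" by simp
  then have "F i \<in> S 0" using F_sym[OF i] by simp
  then have const: "F i v = F i 0" for v
    using sym_comp_homogeneous[of "F i" 0 0 v] by simp
  let ?u = "(\<lambda>_. 0 :: nat)(i := 1)"
  have ne: "?u \<noteq> (\<lambda>_. 0)" by (metis fun_upd_same one_neq_zero)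
  have ind: "indep_family {?u, \<lambda>_. 0} (pmono r F)"
    using F_indep i unfolding algind_def by (auto simp: expos_def)
  have "(1 :: complex) = 0"
  proof -
    have "(if ?u = ?u then 1 else - F i 0) = 0"
    proof (rule indep_familyD[OF ind, where c = "\<lambda>\<alpha>. if \<alpha> = ?u then 1 else - F i 0"])
      fix v
      show "(\<Sum>\<alpha>\<in>{?u, \<lambda>_. 0}. (if \<alpha> = ?u then 1 else - F i 0) * pmono r F \<alpha> v) = 0"
        using ne const[of v] pmono_unit[OF i, of F] by simp
    qed simp
    then show ?thesis by simp
  qed
  then show False by simp
qed

text \<open>Doubling the argument multiplies \<open>f\<close> by \<open>2 ^ j\<close> and a monomial
  by 2 to its weighted degree. Different powers of 2 are different, so independence removes all
  monomials of another degree.\<close>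

lemma invariant_polynomial:
  assumes f: "f \<in> S j" "\<And>g v. g \<in> K \<Longrightarrow> f (A g v) = f v"
  obtains c where "f = lincomb (expos_deg r d j) (pmono r F) c"
proof -
  have "f \<in> polyalg r F"
    using f sym_comp_subset_sym_alg by (intro F_gen) auto
  then obtain B c where B: "finite B" "B \<subseteq> expos r" "f = lincomb B (pmono r F) c"
    by (auto simp: polyalg_explicit)
  have hom: "pmono r F \<alpha> (scale 2 v) = 2 ^ wdeg r d \<alpha> * pmono r F \<alpha> v" for \<alpha> v
    using sym_comp_homogeneous[OF sym_comp_pmono[of r F d \<alpha>, OF F_sym], of 2 v] by simp
  have zero: "c \<alpha> * (2 ^ wdeg r d \<alpha> - 2 ^ j) = 0" if "\<alpha> \<in> B" for \<alpha>
  proof (rule indep_familyD[where J = B and b = "pmono r F" and c = "\<lambda>\<alpha>. c \<alpha> * (2 ^ wdeg r d \<alpha> - 2 ^ j)"])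
    show "indep_family B (pmono r F)" using F_indep B by (simp add: algind_def)
    fix v
    have "f (scale 2 v) = 2 ^ j * f v" by (rule sym_comp_homogeneous[OF f(1)])
    then have "(\<Sum>\<alpha>\<in>B. c \<alpha> * (2 ^ wdeg r d \<alpha> * pmono r F \<alpha> v)) = (\<Sum>\<alpha>\<in>B. 2 ^ j * (c \<alpha> * pmono r F \<alpha> v))"
      by (simp add: B(3) lincomb_def hom sum_distrib_left)
    then show "(\<Sum>\<alpha>\<in>B. c \<alpha> * (2 ^ wdeg r d \<alpha> - 2 ^ j) * pmono r F \<alpha> v) = 0"
      by (simp add: algebra_simps sum_subtractf)
  qed (fact that)
  have zero': "c \<alpha> = 0" if "\<alpha> \<in> B" "\<alpha> \<notin> expos_deg r d j" for \<alpha>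
  proof -
    have "wdeg r d \<alpha> \<noteq> j" using that B(2) by (auto simp: expos_deg_def)
    then have "of_nat (2 ^ wdeg r d \<alpha>) \<noteq> (of_nat (2 ^ j) :: complex)"
      unfolding of_nat_eq_iff by simp
    then have "(2 :: complex) ^ wdeg r d \<alpha> \<noteq> 2 ^ j" by simp
    with zero[OF that(1)] show ?thesis by simp
  qed
  have "f = lincomb (expos_deg r d j) (pmono r F) (\<lambda>\<alpha>. if \<alpha> \<in> B then c \<alpha> else 0)"
  proof
    fix v
    have "f v = (\<Sum>\<alpha>\<in>B \<inter> expos_deg r d j. c \<alpha> * pmono r F \<alpha> v)"
      unfolding B(3) lincomb_def using B(1) zero' by (intro sum.mono_neutral_right) auto
    also have "\<dots> = (\<Sum>\<alpha>\<in>expos_deg r d j. if \<alpha> \<in> B then c \<alpha> * pmono r F \<alpha> v else 0)"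
      using finite_expos_deg[OF d_pos] by (simp add: sum.If_cases Int_commute)
    also have "\<dots> = lincomb (expos_deg r d j) (pmono r F) (\<lambda>\<alpha>. if \<alpha> \<in> B then c \<alpha> else 0) v"
      unfolding lincomb_def by (rule sum.cong) auto
    finally show "f v = lincomb (expos_deg r d j) (pmono r F) (\<lambda>\<alpha>. if \<alpha> \<in> B then c \<alpha> else 0) v" .
  qed
  then show thesis by (rule that)
qed

text \<open>The points whose stabiliser is as small as possible, namely the kernel of the
  action.\<close>

definition good :: "'v \<Rightarrow> bool" where
  "good y \<longleftrightarrow> (\<forall>k\<in>K. A k y = y \<longrightarrow> (\<forall>v. A k v = v))"

lemma X_separates: "x \<noteq> y \<Longrightarrow> \<exists>i<r. X i x \<noteq> X i y"
proof (rule ccontr)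
  assume "x \<noteq> y" "\<not> (\<exists>i<r. X i x \<noteq> X i y)"
  then have "\<forall>i<r. X i (x - y) = 0" using X_linear by (simp add: linf_diff)
  with cobasis_X have "x - y = 0" unfolding cobasis_def by blast
  with \<open>x \<noteq> y\<close> show False by simp
qed

text \<open>Every \<open>k\<close> acting nontrivially moves some coordinate, which gives a nonzero
  functional \<open>X i (A k v) - X i v\<close>. If \<open>f\<close> were not 0, it would have a
  common non-zero with these finitely many functionals, and that point is good.\<close>

lemma good_dense:
  assumes f: "linepoly f" "\<And>y. good y \<Longrightarrow> f y = 0"
  shows "f v = 0"
proof (rule ccontr)
  assume fv: "f v \<noteq> 0"
  define K' where "K' = {k \<in> K. \<exists>v. A k v \<noteq> v}"
  have "\<forall>k\<in>K'. \<exists>i v. i < r \<and> X i (A k v) \<noteq> X i v" unfolding K'_def using X_separates by blast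
  then obtain s where s: "\<forall>k\<in>K'. s k < r \<and> (\<exists>v. X (s k) (A k v) \<noteq> X (s k) v)" by metis
  define h where "h z = (case z of None \<Rightarrow> f | Some k \<Rightarrow> (\<lambda>v. X (s k) (A k v) - X (s k) v))" for z
  have "\<exists>y. \<forall>z\<in>insert None (Some ` K'). h z y \<noteq> 0"
  proof (rule common_nonzero)
    show "finite (insert None (Some ` K'))" using fin by (simp add: K'_def)
    show "linepoly (h z)" if "z \<in> insert None (Some ` K')" for z
    proof (cases z)
      case None
      then show ?thesis using f(1) by (simp add: h_def)
    next
      case (Some k)
      with that have k: "k \<in> K'" by auto
      then have "linf (X (s k))" "linm (A k)" using s X_linear A_linear by (auto simp: K'_def)
      then have "linf (\<lambda>v. X (s k) (A k v) - X (s k) v)" by (auto simp: linf_iff linm_iff algebra_simps)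
      then show ?thesis using Some by (simp add: h_def linepoly_linf)
    qed
    show "\<exists>y. h z y \<noteq> 0" if "z \<in> insert None (Some ` K')" for z
    proof (cases z)
      case None
      then show ?thesis using fv by (auto simp: h_def)
    next
      case (Some k)
      with that have k: "k \<in> K'" by auto
      with s obtain v where "X (s k) (A k v) \<noteq> X (s k) v" by blast
      then show ?thesis using Some by (auto simp: h_def)
    qed
  qed
  then obtain y where y: "\<forall>z\<in>insert None (Some ` K'). h z y \<noteq> 0" ..
  have "good y"
    unfolding good_def
  proof (intro ballI impI allI)
    fix k v assume k: "k \<in> K" "A k y = y"
    show "A k v = v"
    proof (rule ccontr)
      assume "A k v \<noteq> v"
      with k(1) have "k \<in> K'" by (auto simp: K'_def)
      then have "h (Some k) y \<noteq> 0" using y by blast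
      then show False using k(2) by (simp add: h_def)
    qed
  qed
  moreover have "f y \<noteq> 0" using y by (auto simp: h_def)
  ultimately show False using f(2) by blast
qed

text \<open>
  A polynomial with prescribed differential at \<open>y\<close> that vanishes to second order at the other points
  of the orbit of \<open>y\<close> is averaged to an invariant with, up to a factor, the same differential at \<open>y\<close>.
\<close>

lemma good_cobasis:
  assumes y: "good y"
  shows "cobasis (\<lambda>i. dird (F i) y)"
  unfolding cobasis_def
proof (intro conjI allI impI)
  show "linf (dird (F i) y)" if "i < r" for i using dird_linf[OF F_sym[OF that]] .
  fix w assume w: "\<forall>i<r. dird (F i) y w = 0"
  define K1 where "K1 = {k \<in> K. A k y \<noteq> y}"
  have "\<forall>k\<in>K1. \<exists>i. i < r \<and> X i y \<noteq> X i (A k y)"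
    using X_separates[of y] by (auto simp: K1_def)
  from bchoice[OF this] obtain s where s: "\<forall>k\<in>K1. s k < r \<and> X (s k) y \<noteq> X (s k) (A k y)" by blast
  have finK1: "finite K1" using fin by (simp add: K1_def)
  \<comment> \<open>The factor \<open>l v - l y\<close> yields the differential \<open>l\<close> at
    \<open>y\<close>, up to the value \<open>C\<close> of the product. The squares kill first
    derivatives at the points \<open>A k y\<close>, and \<open>C\<close> is nonzero because the
    coordinate \<open>s k\<close> tells \<open>y\<close> and \<open>A k y\<close> apart.\<close>
  define h where "h l v = (l v - l y) * (\<Prod>k\<in>K1. (X (s k) v - X (s k) (A k y)) ^ 2)"
    for l :: "'v \<Rightarrow> complex" and v
  have "X j w = 0" if j: "j < r" for j
  proof -
    let ?l = "X j"
    have poly: "h ?l \<in> polyalg r X"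
    proof -
      have pX: "(\<lambda>v. X i v - c) \<in> polyalg r X" if "i < r" for i c
        using polyalg_add[OF polyalg_gen[OF that] polyalg_const[of "- c"]] by simp
      show ?thesis unfolding h_def[abs_def] using s j
        by (intro polyalg_mult polyalg_prod polyalg_power pX) auto
    qed
    define f where "f v = (\<Sum>k\<in>K. h ?l (A k v))" for v
    have "f \<in> sym_alg scale"
    proof -
      have "(\<lambda>v. h ?l (A k v)) \<in> polyalg r X" if "k \<in> K" for k
        using sym_alg_comp[of "h ?l", OF _ A_linear[OF that]] poly by (simp add: sym_alg_eq_polyalg[OF cobasis_X])
      then show ?thesis unfolding f_def[abs_def] sym_alg_eq_polyalg[OF cobasis_X] by (rule polyalg_sum)
    qed
    moreover have "f (A g v) = f v" if "g \<in> K" for g v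
      using sum_translate[OF that, of "\<lambda>k. h ?l (A k v)"] that by (simp add: f_def A_mult)
    ultimately have fF: "f \<in> polyalg r F" by (rule F_gen)
    \<comment> \<open>All \<open>dF_i\<close> vanish on \<open>w\<close>, hence so does the
      differential of the invariant \<open>f\<close>. The rest of the argument computes the same
      derivative from the sum defining \<open>f\<close>.\<close>
    have D0: "((\<lambda>t. f (y + scale t w)) has_field_derivative 0) (at 0)"
    proof (rule DERIV_zero_polyalg[OF fF])
      fix i assume i: "i < r"
      show "((\<lambda>t. F i (y + scale t w)) has_field_derivative 0) (at 0)"
        using dird_has_derivative[OF linepoly_sym_comp[OF F_sym[OF i]], of y w] w i by simp
    qed
    define C where "C = (\<Prod>k\<in>K1. (X (s k) y - X (s k) (A k y)) ^ 2)"
    have C: "C \<noteq> 0" using s finK1 by (auto simp: C_def)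
    have D: "((\<lambda>t. h ?l (A k (y + scale t w))) has_field_derivative (if k \<in> K1 then 0 else ?l w * C)) (at 0)"
      if k: "k \<in> K" for k
    proof (cases "k \<in> K1")
      case True
      have lin: "linm (A k)" "linf (X (s k))" using k A_linear X_linear s True by auto
      define u where "u v = (?l v - ?l y) * (\<Prod>k\<in>K1 - {k}. (X (s k) v - X (s k) (A k y)) ^ 2)" for v
      have hu: "h ?l v = u v * (X (s k) v - X (s k) (A k y)) ^ 2" for v
        unfolding h_def u_def using prod.remove[OF finK1 True, of "\<lambda>k. (X (s k) v - X (s k) (A k y)) ^ 2"]
        by (simp only: mult_ac)
      have minus: "linepoly (\<lambda>v. X i v - c)" if "i < r" for i c
        using linepoly_add[OF linepoly_linf[OF X_linear[OF that]] linepoly_const[of "- c"]] by simp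
      have "linepoly u" unfolding u_def[abs_def] using s j
        by (intro linepoly_mult linepoly_prod linepoly_power minus) auto
      then obtain p where p: "\<And>t. u (A k y + scale t (A k w)) = poly p t"
        unfolding linepoly_def by blast
      have eq: "h ?l (A k (y + scale t w)) = poly p t * (t * X (s k) (A k w)) ^ 2" for t
        by (simp add: linm_add[OF lin(1)] linm_scale[OF lin(1)] hu p linf_add[OF lin(2)] linf_scale[OF lin(2)])
      have "((\<lambda>t. poly p t * (t * X (s k) (A k w)) ^ 2) has_field_derivative 0) (at 0)"
        by (rule derivative_eq_intros poly_DERIV refl)+ simp
      with True show ?thesis by (simp add: eq)
    next
      case False
      then have id: "A k v = v" for v using y k by (auto simp: K1_def good_def)
      have "linepoly (\<lambda>v. \<Prod>k\<in>K1. (X (s k) v - X (s k) (A k y)) ^ 2)"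
      proof -
        have "linepoly (\<lambda>v. X i v - c)" if "i < r" for i c
          using linepoly_add[OF linepoly_linf[OF X_linear[OF that]] linepoly_const[of "- c"]] by simp
        then show ?thesis using s by (intro linepoly_prod linepoly_power) auto
      qed
      then obtain p where p: "\<And>t. (\<Prod>k\<in>K1. (X (s k) (y + scale t w) - X (s k) (A k y)) ^ 2) = poly p t"
        unfolding linepoly_def by blast
      have eq: "h ?l (A k (y + scale t w)) = (t * ?l w) * poly p t" for t
        unfolding id h_def p by (simp add: linf_add[OF X_linear[OF j]] linf_scale[OF X_linear[OF j]])
      have "poly p 0 = C" using p[of 0] by (simp add: C_def)
      then have "((\<lambda>t. (t * ?l w) * poly p t) has_field_derivative ?l w * C) (at 0)"
        by (auto intro!: derivative_eq_intros poly_DERIV)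
      with False show ?thesis by (simp add: eq)
    qed
    have "((\<lambda>t. f (y + scale t w)) has_field_derivative (\<Sum>k\<in>K. if k \<in> K1 then 0 else ?l w * C)) (at 0)"
      unfolding f_def by (rule DERIV_sum) (rule D)
    from DERIV_unique[OF this D0] have "(\<Sum>k\<in>K. if k \<in> K1 then 0 else ?l w * C) = 0" .
    \<comment> \<open>The elements outside \<open>K1\<close> fix \<open>y\<close> and therefore,
      \<open>y\<close> being good, act trivially; each contributes \<open>?l w * C\<close>, and the
      unit is among them.\<close>
    moreover have "(\<Sum>k\<in>K. if k \<in> K1 then 0 else ?l w * C) = of_nat (card (K - K1)) * (?l w * C)"
      using fin by (simp add: sum.If_cases set_diff_eq Collect_conj_eq Collect_neg_eq Int_commute Diff_eq)
    moreover have "card (K - K1) \<noteq> 0"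
    proof -
      have "\<one> \<in> K - K1" using A_one by (simp add: K1_def)
      then show ?thesis using fin by (metis card_0_eq empty_iff finite_Diff)
    qed
    ultimately show "?l w = 0" using C by simp
  qed
  then show "w = 0" using cobasis_X by (simp add: cobasis_def)
qed

section \<open>Traces on forms and on invariant forms\<close>

definition inv_forms :: "nat \<Rightarrow> nat \<Rightarrow> ('v \<times> (nat \<Rightarrow> 'v) \<Rightarrow> complex) set" where
  "inv_forms j p = {\<phi> \<in> forms j p. \<forall>k\<in>K. \<forall>y w. \<phi> (A k y, \<lambda>b. A k (w b)) = \<phi> (y, w)}"

lemma forms_act:
  assumes "\<phi> \<in> forms j p" "linm g" "linm T"
  shows "(\<lambda>(y, w). \<phi> (g y, \<lambda>b. T (w b))) \<in> forms j p"
proof -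
  have \<phi>: "(\<lambda>y. \<phi> (y, w)) \<in> S j" "alt p (\<lambda>w. \<phi> (y, w))" for y w using assms(1) by (auto simp: forms_def)
  have "alt p (\<lambda>w. \<phi> (y, \<lambda>b. T (w b)))" for y
    unfolding alt_def mlin_def
  proof (intro conjI allI impI)
    fix w w' :: "nat \<Rightarrow> 'v" assume "\<forall>b<p. w b = w' b"
    then show "\<phi> (y, \<lambda>b. T (w b)) = \<phi> (y, \<lambda>b. T (w' b))"
      by (intro mlin_cong[OF alt_mlin[OF \<phi>(2)]]) simp
  next
    fix a and w :: "nat \<Rightarrow> 'v" assume "a < p"
    from linf_comp[OF mlin_linf[OF alt_mlin[OF \<phi>(2)] this] assms(3)]
    have "linf (\<lambda>x. \<phi> (y, (\<lambda>b. T (w b))(a := T x)))" .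
    moreover have "(\<lambda>b. T ((w(a := x)) b)) = (\<lambda>b. T (w b))(a := T x)" for x by auto
    ultimately show "linf (\<lambda>x. \<phi> (y, \<lambda>b. T ((w(a := x)) b)))" by simp
  next
    fix \<sigma> and w :: "nat \<Rightarrow> 'v" assume "\<sigma> permutes {..<p}"
    from alt_permute[OF \<phi>(2) this, of y "\<lambda>b. T (w b)"]
    show "\<phi> (y, \<lambda>b. T ((w \<circ> \<sigma>) b)) = of_int (sign \<sigma>) * \<phi> (y, \<lambda>b. T (w b))" by (simp add: comp_def)
  qed
  moreover have "(\<lambda>y. \<phi> (g y, w)) \<in> S j" for w using sym_comp_comp[OF \<phi>(1) assms(2)] .
  ultimately show ?thesis by (auto simp: forms_def)
qed

text \<open>The matrix \<open>m\<close> refers to an arbitrary frame because the sum over the group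
  needs one frame for all elements, whereas the eigenbasis \<open>Y\<close> belongs to a single
  one.\<close>

lemma eigen_trace:
  assumes Y: "cobasis Y" and g: "linm g" "linm T"
    and Yg: "\<And>i v. i < r \<Longrightarrow> Y i (g v) = lam i * Y i v" "\<And>i v. i < r \<Longrightarrow> Y i (T v) = mu i * Y i v"
    and b: "frame J b (forms j p)"
    and m: "\<And>i. i \<in> J \<Longrightarrow> (\<lambda>(y, w). b i (g y, \<lambda>c. T (w c))) = lincomb J b (\<lambda>l. m l i)"
  shows "(\<Sum>i\<in>J. m i i) = hsum r (\<lambda>_. 1) lam j * esum r p mu"
proof -
  let ?J = "expos_deg r (\<lambda>_. 1) j \<times> subsets_of_card r p"
  let ?L = "\<lambda>\<phi>. (\<lambda>(y, w). \<phi> (g y, \<lambda>b. T (w b)))"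
  let ?\<theta> = "\<lambda>(\<alpha>, I). (\<Prod>i<r. lam i ^ \<alpha> i) * (\<Prod>i\<in>I. mu i)"
  note fr = frame_forms[OF Y, of j p]
  have "(\<Sum>i\<in>J. m i i) = (\<Sum>i\<in>?J. if i = i then ?\<theta> i else 0)"
  proof (rule trace_eq[OF b fr subset_refl, where L = ?L and m = m and ?m0.0 = "\<lambda>i l. if i = l then ?\<theta> l else 0"])
    show "?L (lincomb J b c) = lincomb J (\<lambda>j. ?L (b j)) c" for c
      by (auto simp: lincomb_def fun_eq_iff)
    show "?L (b i) \<in> forms j p" if "i \<in> J" for i using forms_act[OF frame_elem[OF b that] g] .
    show "?L (b i) = lincomb J b (\<lambda>l. m l i)" if "i \<in> J" for i using m[OF that] .
    show "?L (form_basis p Y i) = lincomb ?J (form_basis p Y) (\<lambda>l. if l = i then ?\<theta> i else 0)"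
      if i: "i \<in> ?J" for i
    proof -
      obtain \<alpha> I where \<alpha>: "i = (\<alpha>, I)" by (cases i)
      with i have I: "I \<in> subsets_of_card r p" by blast
      have "?L (form_basis p Y i) z = ?\<theta> i * form_basis p Y i z" for z
        using form_basis_eigen[of Y "g (fst z)" lam "fst z" "\<lambda>b. T (snd z b)" mu "snd z" I p \<alpha>] Yg I
        by (simp add: \<alpha> case_prod_unfold)
      moreover have "lincomb ?J (form_basis p Y) (\<lambda>l. if l = i then ?\<theta> i else 0) z = ?\<theta> i * form_basis p Y i z" for z
      proof -
        have "lincomb ?J (form_basis p Y) (\<lambda>l. if l = i then ?\<theta> i else 0) z =
            (\<Sum>l\<in>?J. if l = i then ?\<theta> i * form_basis p Y i z else 0)"
          unfolding lincomb_def by (rule sum.cong) auto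
        then show ?thesis using i fr by (simp add: frame_def)
      qed
      ultimately show ?thesis by (intro ext) simp
    qed
  qed
  also have "\<dots> = hsum r (\<lambda>_. 1) lam j * esum r p mu"
    unfolding hsum_def esum_def sum_product sum.cartesian_product by (simp add: case_prod_unfold)
  finally show ?thesis .
qed

text \<open>Applying \<open>(g, T)\<close> and then summing over the group maps all forms into the
  invariant ones, so by \<open>trace_eq\<close> its trace can be taken on either space. On all forms
  it is the sum of the traces of the pairs \<open>(g A_k, T A_k)\<close>; on an invariant eigenform
  the sum has \<open>card K\<close> equal terms.\<close>

lemma trace_formula:
  assumes g: "linm g" "linm T"
    and Y: "\<And>k. k \<in> K \<Longrightarrow> cobasis (Y k)"
      "\<And>k i v. k \<in> K \<Longrightarrow> i < r \<Longrightarrow> Y k i (g (A k v)) = lam k i * Y k i v"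
      "\<And>k i v. k \<in> K \<Longrightarrow> i < r \<Longrightarrow> Y k i (T (A k v)) = mu k i * Y k i v"
    and b0: "frame J0 b0 (inv_forms j p)"
    and \<theta>: "\<And>i y w. i \<in> J0 \<Longrightarrow> b0 i (g y, \<lambda>b. T (w b)) = \<theta> i * b0 i (y, w)"
  shows "(\<Sum>k\<in>K. hsum r (\<lambda>_. 1) (lam k) j * esum r p (mu k)) = of_nat (card K) * (\<Sum>i\<in>J0. \<theta> i)"
proof -
  let ?J = "expos_deg r (\<lambda>_. 1) j \<times> subsets_of_card r p"
  let ?b = "form_basis p X"
  note b = frame_forms[OF cobasis_X, of j p]
  let ?Lk = "\<lambda>k \<phi>. (\<lambda>(y, w). \<phi> (g (A k y), \<lambda>b. T (A k (w b))))"
  let ?L = "\<lambda>\<phi> z. \<Sum>k\<in>K. ?Lk k \<phi> z"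
  have lin: "linm (\<lambda>v. g (A k v))" "linm (\<lambda>v. T (A k v))" if "k \<in> K" for k
    using g A_linear[OF that] by (auto simp: linm_iff)
  have "\<forall>k\<in>K. \<exists>m. \<forall>i\<in>?J. ?Lk k (?b i) = lincomb ?J ?b (\<lambda>l. m l i)"
  proof
    fix k assume k: "k \<in> K"
    have "\<forall>i\<in>?J. ?Lk k (?b i) \<in> forms j p"
      using forms_act[OF frame_elem[OF b] lin[OF k]] by blast
    from frame_coeffs[OF b this] show "\<exists>m. \<forall>i\<in>?J. ?Lk k (?b i) = lincomb ?J ?b (\<lambda>l. m l i)" by metis
  qed
  then obtain m where m: "\<forall>k\<in>K. \<forall>i\<in>?J. ?Lk k (?b i) = lincomb ?J ?b (\<lambda>l. m k l i)" by metis
  have tr: "(\<Sum>i\<in>?J. m k i i) = hsum r (\<lambda>_. 1) (lam k) j * esum r p (mu k)" if k: "k \<in> K" for k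
    by (rule eigen_trace[OF Y(1)[OF k] lin[OF k] Y(2)[OF k] Y(3)[OF k] b]) (use m k in auto)
  have inv: "?L \<phi> \<in> inv_forms j p" if \<phi>: "\<phi> \<in> forms j p" for \<phi>
  proof -
    have "lincomb K (\<lambda>k. ?Lk k \<phi>) (\<lambda>_. 1) \<in> forms j p"
      by (rule forms_lincomb) (rule forms_act[OF \<phi> lin])
    then have "?L \<phi> \<in> forms j p" by (simp add: lincomb_def)
    moreover have "?L \<phi> (A h y, \<lambda>b. A h (w b)) = ?L \<phi> (y, w)" if h: "h \<in> K" for h y w
      using sum_translate[OF h, of "\<lambda>k. \<phi> (g (A k y), \<lambda>b. T (A k (w b)))"] h by (simp add: A_mult)
    ultimately show ?thesis by (auto simp: inv_forms_def)
  qed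
  have "(\<Sum>i\<in>?J. \<Sum>k\<in>K. m k i i) = (\<Sum>i\<in>J0. if i = i then of_nat (card K) * \<theta> i else 0)"
  proof (rule trace_eq[OF b b0, where L = ?L and m = "\<lambda>l i. \<Sum>k\<in>K. m k l i"
        and ?m0.0 = "\<lambda>i l. if i = l then of_nat (card K) * \<theta> l else 0"])
    show "inv_forms j p \<subseteq> forms j p" by (auto simp: inv_forms_def)
    show "?L (lincomb ?J ?b c) = lincomb ?J (\<lambda>j. ?L (?b j)) c" for c
    proof
      fix z :: "'v \<times> (nat \<Rightarrow> 'v)"
      have "?L (lincomb ?J ?b c) z = (\<Sum>k\<in>K. \<Sum>i\<in>?J. c i * ?Lk k (?b i) z)"
        by (simp add: lincomb_def case_prod_unfold)
      also have "\<dots> = (\<Sum>i\<in>?J. \<Sum>k\<in>K. c i * ?Lk k (?b i) z)" by (rule sum.swap)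
      finally show "?L (lincomb ?J ?b c) z = lincomb ?J (\<lambda>j. ?L (?b j)) c z"
        by (simp add: lincomb_def sum_distrib_left)
    qed
    show "?L (?b i) \<in> inv_forms j p" if "i \<in> ?J" for i using inv[OF frame_elem[OF b that]] .
    show "?L (?b i) = lincomb ?J ?b (\<lambda>l. \<Sum>k\<in>K. m k l i)" if i: "i \<in> ?J" for i
    proof
      fix z :: "'v \<times> (nat \<Rightarrow> 'v)"
      have "?L (?b i) z = (\<Sum>k\<in>K. lincomb ?J ?b (\<lambda>l. m k l i) z)"
        using m i by (intro sum.cong) (auto simp del: split_paired_All)
      also have "\<dots> = (\<Sum>l\<in>?J. \<Sum>k\<in>K. m k l i * ?b l z)"
        unfolding lincomb_def by (rule sum.swap)
      finally show "?L (?b i) z = lincomb ?J ?b (\<lambda>l. \<Sum>k\<in>K. m k l i) z"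
        by (simp add: lincomb_def sum_distrib_right)
    qed
    show "?L (b0 i) = lincomb J0 b0 (\<lambda>l. if l = i then of_nat (card K) * \<theta> i else 0)" if i: "i \<in> J0" for i
    proof
      fix z :: "'v \<times> (nat \<Rightarrow> 'v)"
      obtain y w where z: "z = (y, w)" by (cases z)
      have b0inv: "b0 i (A k y, \<lambda>b. A k (w b)) = b0 i (y, w)" if "k \<in> K" for k
        using frame_elem[OF b0 i] that by (auto simp: inv_forms_def)
      have "?L (b0 i) z = (\<Sum>k\<in>K. \<theta> i * b0 i (y, w))"
        unfolding z by (rule sum.cong) (use \<theta>[OF i] b0inv in auto)
      also have "\<dots> = of_nat (card K) * \<theta> i * b0 i z" by (simp add: z)
      also have "\<dots> = (\<Sum>l\<in>J0. if l = i then of_nat (card K) * \<theta> i * b0 i z else 0)"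
        using i b0 by (simp add: frame_def)
      also have "\<dots> = lincomb J0 b0 (\<lambda>l. if l = i then of_nat (card K) * \<theta> i else 0) z"
        unfolding lincomb_def by (rule sum.cong) auto
      finally show "?L (b0 i) z = lincomb J0 b0 (\<lambda>l. if l = i then of_nat (card K) * \<theta> i else 0) z" .
    qed
  qed
  also have "(\<Sum>i\<in>?J. \<Sum>k\<in>K. m k i i) = (\<Sum>k\<in>K. \<Sum>i\<in>?J. m k i i)" by (rule sum.swap)
  also have "\<dots> = (\<Sum>k\<in>K. hsum r (\<lambda>_. 1) (lam k) j * esum r p (mu k))" using tr by (rule sum.cong[OF refl])
  finally show ?thesis by (simp add: sum_distrib_left)
qed

end

lemma subsets_of_card_full: "subsets_of_card r r = {{..<r}}"
proof -
  have "I = {..<r}" if "I \<subseteq> {..<r}" "card I = r" for I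
    using card_subset_eq[OF finite_lessThan that(1)] that(2) by simp
  then show ?thesis by (auto simp: subsets_of_card_def)
qed

lemma subsets_of_card_0: "subsets_of_card r 0 = {{}}"
  using finite_subset[of _ "{..<r}"] by (auto simp: subsets_of_card_def)

lemma esum_0: "esum r 0 c = 1"
  by (simp add: esum_def subsets_of_card_0)

lemma esum_full: "esum r r c = (\<Prod>i<r. c i)"
  by (simp add: esum_def subsets_of_card_full)

lemma sum_subsets_of_card:
  "(\<Sum>p\<le>r. \<Sum>I\<in>subsets_of_card r p. h I) = (\<Sum>I\<in>Pow {..<r}. h I)"
proof -
  have "(\<Sum>p\<le>r. \<Sum>I\<in>{I \<in> Pow {..<r}. card I = p}. h I) = (\<Sum>I\<in>Pow {..<r}. h I)"
    by (rule sum.group) (use card_mono[of "{..<r}"] in auto)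
  moreover have "{I \<in> Pow {..<r}. card I = p} = subsets_of_card r p" for p
    by (auto simp: subsets_of_card_def)
  ultimately show ?thesis by simp
qed

lemma prod_one_plus: "finite A \<Longrightarrow> (\<Sum>I\<in>Pow A. \<Prod>i\<in>I. c i) = (\<Prod>i\<in>A. 1 + c i :: 'b :: comm_semiring_1)"
  using prod_add[of A c "\<lambda>_. 1"] by (simp add: add.commute)

text \<open>The remaining slots of \<open>\<tau>\<close> list the complement of \<open>I\<close>,
  whose differentials are to be wedged on.\<close>

lemma extend_enum_set:
  assumes I: "I \<in> subsets_of_card r p"
  obtains \<tau> where "\<tau> permutes {..<r}" "\<And>b. b < p \<Longrightarrow> \<tau> b = enum_set I b"
proof -
  note I' = subsets_of_cardD[OF I]
  have p: "p \<le> r" using card_mono[of "{..<r}" I] I' by simp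
  have "card {p..<r} = card ({..<r} - I)" using I'(1,2,3) by (simp add: card_Diff_subset)
  then obtain h where h: "bij_betw h {p..<r} ({..<r} - I)"
    by (metis finite_same_card_bij finite_Diff finite_atLeastLessThan finite_lessThan)
  define \<tau> where "\<tau> b = (if b < p then enum_set I b else if b < r then h b else b)" for b
  have 1: "bij_betw \<tau> {..<p} I" using I'(4) by (rule bij_betw_cong[THEN iffD1, rotated]) (simp add: \<tau>_def)
  have 2: "bij_betw \<tau> {p..<r} ({..<r} - I)" using h by (rule bij_betw_cong[THEN iffD1, rotated]) (simp add: \<tau>_def)
  have "bij_betw \<tau> ({..<p} \<union> {p..<r}) (I \<union> ({..<r} - I))"
    by (rule bij_betw_combine[OF 1 2]) auto
  moreover have "{..<p} \<union> {p..<r} = {..<r}" "I \<union> ({..<r} - I) = {..<r}" using p I'(3) by auto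
  ultimately have "bij_betw \<tau> {..<r} {..<r}" by simp
  then have "\<tau> permutes {..<r}" by (rule bij_imp_permutes) (use p in \<open>simp add: \<tau>_def\<close>)
  then show thesis using that by (simp add: \<tau>_def)
qed

section \<open>Solomon's theorem: the invariant forms are free on products of the
  differentials\<close>

context invariant_ring
begin

definition inv_basis :: "nat \<Rightarrow> (nat \<Rightarrow> nat) \<times> nat set \<Rightarrow> 'v \<times> (nat \<Rightarrow> 'v) \<Rightarrow> complex" where
  "inv_basis p = (\<lambda>(\<alpha>, I) (y, w). pmono r F \<alpha> y * dform p (\<lambda>b. dird (F (enum_set I b)) y) w)"

text \<open>The summand \<open>d i - 1\<close> is the degree of the coefficients of
  \<open>dF_i\<close>; the subtraction is exact since all \<open>d i\<close> are positive.\<close>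

definition inv_index :: "nat \<Rightarrow> nat \<Rightarrow> ((nat \<Rightarrow> nat) \<times> nat set) set" where
  "inv_index j p = {(\<alpha>, I). \<alpha> \<in> expos r \<and> I \<in> subsets_of_card r p \<and> wdeg r d \<alpha> + (\<Sum>i\<in>I. d i - 1) = j}"

lemma inv_index_iff: "(\<alpha>, I) \<in> inv_index j p \<longleftrightarrow>
    \<alpha> \<in> expos r \<and> I \<in> subsets_of_card r p \<and> wdeg r d \<alpha> + (\<Sum>i\<in>I. d i - 1) = j"
  by (simp add: inv_index_def)

lemma finite_inv_index: "finite (inv_index j p)"
proof (rule finite_subset)
  show "inv_index j p \<subseteq> (\<Union>n\<le>j. expos_deg r d n) \<times> subsets_of_card r p"
    by (auto simp: inv_index_def expos_deg_def)
  show "finite ((\<Union>n\<le>j. expos_deg r d n) \<times> subsets_of_card r p)"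
    using finite_expos_deg[of r d, OF d_pos] finite_subsets_of_card by blast
qed

lemma inv_index_fibre:
  "I \<in> subsets_of_card r p \<Longrightarrow> {\<alpha>. (\<alpha>, I) \<in> inv_index j p} =
    (if j < (\<Sum>i\<in>I. d i - 1) then {} else expos_deg r d (j - (\<Sum>i\<in>I. d i - 1)))"
  by (auto simp: inv_index_iff expos_deg_def)

lemma sum_inv_index:
  "(\<Sum>z\<in>inv_index j p. h z) = (\<Sum>I\<in>subsets_of_card r p. \<Sum>\<alpha> | (\<alpha>, I) \<in> inv_index j p. h (\<alpha>, I))"
proof -
  have "finite {\<alpha>. (\<alpha>, I) \<in> inv_index j p}" for I
    using finite_inv_index[of j p] by (rule finite_surj[of _ _ fst]) force
  then have "(\<Sum>I\<in>subsets_of_card r p. \<Sum>\<alpha> | (\<alpha>, I) \<in> inv_index j p. h (\<alpha>, I)) =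
      (\<Sum>(I, \<alpha>)\<in>(SIGMA I:subsets_of_card r p. {\<alpha>. (\<alpha>, I) \<in> inv_index j p}). h (\<alpha>, I))"
    by (intro sum.Sigma finite_subsets_of_card) auto
  also have "\<dots> = (\<Sum>z\<in>inv_index j p. h z)"
    by (rule sum.reindex_bij_witness[where i = "\<lambda>z. (snd z, fst z)" and j = "\<lambda>z. (snd z, fst z)"])
      (auto simp: inv_index_def)
  finally show ?thesis by simp
qed

lemma dird_form_sym_comp:
  assumes I: "I \<in> subsets_of_card r p"
  shows "(\<lambda>y. dform p (\<lambda>b. dird (F (enum_set I b)) y) w) \<in> S (\<Sum>i\<in>I. d i - 1)"
  unfolding dform_eq
proof (intro sym_comp_sum sym_comp_scale)
  fix \<sigma> assume "\<sigma> \<in> {\<sigma>. \<sigma> permutes {..<p}}"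
  then have \<sigma>: "\<sigma> permutes {..<p}" by simp
  have "(\<lambda>y. \<Prod>b<p. dird (F (enum_set I (\<sigma> b))) y (w b)) \<in> S (\<Sum>b<p. d (enum_set I (\<sigma> b)) - 1)"
  proof (rule sym_comp_prod)
    fix b assume "b \<in> {..<p}"
    then have "enum_set I (\<sigma> b) < r" using subsets_of_cardD(5)[OF I] permutes_lessThan[OF \<sigma>] by simp
    then show "(\<lambda>y. dird (F (enum_set I (\<sigma> b))) y (w b)) \<in> S (d (enum_set I (\<sigma> b)) - 1)"
      using dird_sym_comp F_sym d_pos by blast
  qed
  also have "(\<Sum>b<p. d (enum_set I (\<sigma> b)) - 1) = (\<Sum>b<p. d (enum_set I b) - 1)"
    by (rule sum.reindex_bij_betw[OF permutes_imp_bij[OF \<sigma>]])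
  also have "\<dots> = (\<Sum>i\<in>I. d i - 1)" by (rule sum_enum_set[OF I])
  finally show "(\<lambda>y. \<Prod>b<p. dird (F (enum_set I (\<sigma> b))) y (w b)) \<in> S (\<Sum>i\<in>I. d i - 1)" .
qed

lemma inv_basis_eigen:
  assumes "\<And>i v. i < r \<Longrightarrow> F i (g v) = eps i * F i v"
    and "\<And>i y w. i < r \<Longrightarrow> dird (F i) (g y) (T w) = c i * dird (F i) y w"
    and I: "I \<in> subsets_of_card r p"
  shows "inv_basis p (\<alpha>, I) (g y, \<lambda>b. T (w b)) =
    (\<Prod>i<r. eps i ^ \<alpha> i) * (\<Prod>i\<in>I. c i) * inv_basis p (\<alpha>, I) (y, w)"
proof -
  have "dform p (\<lambda>b. dird (F (enum_set I b)) (g y)) (\<lambda>b. T (w b)) =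
      (\<Prod>b<p. c (enum_set I b)) * dform p (\<lambda>b. dird (F (enum_set I b)) y) w"
    using subsets_of_cardD(5)[OF I] assms(2) by (intro dform_eigen) auto
  moreover have "pmono r F \<alpha> (g y) = (\<Prod>i<r. eps i ^ \<alpha> i) * pmono r F \<alpha> y"
    using assms(1) by (simp add: pmono_def power_mult_distrib prod.distrib)
  ultimately show ?thesis by (simp add: inv_basis_def prod_enum_set[OF I])
qed

lemma dird_F_inv: "i < r \<Longrightarrow> k \<in> K \<Longrightarrow> dird (F i) (A k y) (A k w) = dird (F i) y w"
  using dird_comp[OF A_linear, of k "F i"] F_inv by simp

lemma inv_basis_mem:
  assumes "z \<in> inv_index j p"
  shows "inv_basis p z \<in> inv_forms j p"
proof -
  obtain \<alpha> I where z: "z = (\<alpha>, I)" by (cases z)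
  with assms have I: "I \<in> subsets_of_card r p" and j: "wdeg r d \<alpha> + (\<Sum>i\<in>I. d i - 1) = j"
    by (auto simp: inv_index_iff)
  have "(\<lambda>y. inv_basis p z (y, w)) \<in> S j" for w
    using sym_comp_mult[OF sym_comp_pmono[of r F d \<alpha>] dird_form_sym_comp[OF I, of w]] F_sym j
    by (simp add: z inv_basis_def)
  moreover have "alt p (\<lambda>w. inv_basis p z (y, w))" for y
    unfolding z inv_basis_def prod.case
    using subsets_of_cardD(5)[OF I] dird_linf[OF F_sym] by (intro alt_scale alt_dform) auto
  moreover have "inv_basis p z (A k y, \<lambda>b. A k (w b)) = inv_basis p z (y, w)" if k: "k \<in> K" for k y w
    using inv_basis_eigen[of "A k" "\<lambda>_. 1" "A k" "\<lambda>_. 1", OF _ _ I, of \<alpha> y w] F_inv dird_F_inv k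
    by (simp add: z)
  ultimately show ?thesis by (auto simp: inv_forms_def forms_def)
qed

lemma inv_forms_lincomb:
  assumes "\<And>i. i \<in> I \<Longrightarrow> \<phi> i \<in> inv_forms j p"
  shows "lincomb I \<phi> c \<in> inv_forms j p"
proof -
  have "lincomb I \<phi> c \<in> forms j p" by (rule forms_lincomb) (use assms in \<open>auto simp: inv_forms_def\<close>)
  moreover have "lincomb I \<phi> c (A k y, \<lambda>b. A k (w b)) = lincomb I \<phi> c (y, w)" if "k \<in> K" for k y w
    unfolding lincomb_def using assms that by (intro sum.cong) (auto simp: inv_forms_def)
  ultimately show ?thesis by (auto simp: inv_forms_def)
qed

lemma inv_basis_dual:
  assumes "dual_basis (\<lambda>i. dird (F i) y) f" "I \<in> subsets_of_card r p" "J \<in> subsets_of_card r p"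
  shows "inv_basis p (\<alpha>, I) (y, \<lambda>b. f (enum_set J b)) = (if I = J then pmono r F \<alpha> y else 0)"
  using dform_dual[OF assms] by (simp add: inv_basis_def)

lemma forms_linepoly: "\<phi> \<in> forms j p \<Longrightarrow> linepoly (\<lambda>y. \<phi> (y, w))"
  by (auto simp: forms_def intro: linepoly_sym_comp)

text \<open>The vectors \<open>f\<close> are dual to the differentials at the point \<open>y\<close>
  and so vary with \<open>y\<close>; evaluating a form on them reads off the coefficient of the
  product indexed by \<open>J\<close>.\<close>

lemma lincomb_inv_basis_dual:
  assumes f: "dual_basis (\<lambda>i. dird (F i) y) f" and J: "J \<in> subsets_of_card r p"
  shows "lincomb (inv_index j p) (inv_basis p) c (y, \<lambda>b. f (enum_set J b)) =
    (\<Sum>\<alpha> | (\<alpha>, J) \<in> inv_index j p. c (\<alpha>, J) * pmono r F \<alpha> y)"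
proof -
  have "lincomb (inv_index j p) (inv_basis p) c (y, \<lambda>b. f (enum_set J b)) =
      (\<Sum>I\<in>subsets_of_card r p. \<Sum>\<alpha> | (\<alpha>, I) \<in> inv_index j p.
        c (\<alpha>, I) * inv_basis p (\<alpha>, I) (y, \<lambda>b. f (enum_set J b)))"
    unfolding lincomb_def by (rule sum_inv_index)
  also have "\<dots> = (\<Sum>I\<in>subsets_of_card r p. if I = J then
      (\<Sum>\<alpha> | (\<alpha>, J) \<in> inv_index j p. c (\<alpha>, J) * pmono r F \<alpha> y) else 0)"
    by (rule sum.cong) (auto simp: inv_basis_dual[OF f _ J])
  finally show ?thesis using J by (simp add: finite_subsets_of_card)
qed

text \<open>At good points the differentials are independent, so each coefficient, a polynomial in
  \<open>F\<close>, vanishes there. By density it vanishes everywhere, and algebraic independence of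
  \<open>F\<close> finishes.\<close>

lemma indep_inv_basis: "indep_family (inv_index j p) (inv_basis p)"
  unfolding indep_family_def
proof (intro allI impI)
  fix c assume c: "lincomb (inv_index j p) (inv_basis p) c = 0"
  show "\<forall>z\<in>inv_index j p. c z = 0"
  proof
    fix z assume zz: "z \<in> inv_index j p"
    obtain \<beta> J where z: "z = (\<beta>, J)" by (cases z)
    with zz have J: "J \<in> subsets_of_card r p" by (simp add: inv_index_iff)
    let ?B = "{\<alpha>. (\<alpha>, J) \<in> inv_index j p}"
    let ?f = "\<lambda>y. \<Sum>\<alpha>\<in>?B. c (\<alpha>, J) * pmono r F \<alpha> y"
    have lp: "linepoly ?f"
      unfolding pmono_def using linepoly_sym_comp[OF F_sym]
      by (intro linepoly_sum linepoly_mult linepoly_const linepoly_prod linepoly_power) auto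
    have 0: "?f y = 0" for y
    proof (rule good_dense[of ?f, OF lp])
      fix y assume "good y"
      then obtain f where f: "dual_basis (\<lambda>i. dird (F i) y) f" using cobasis_dual[OF good_cobasis] by blast
      show "?f y = 0" using lincomb_inv_basis_dual[OF f J, of j c] c by simp
    qed
    have fin: "finite ?B" using inv_index_fibre[OF J, of j] finite_expos_deg[of r d, OF d_pos] by simp
    have sub: "?B \<subseteq> expos r" by (auto simp: inv_index_iff)
    have "indep_family ?B (pmono r F)" using F_indep fin sub unfolding algind_def by blast
    then have "c (\<beta>, J) = 0"
      by (rule indep_familyD[where c = "\<lambda>\<alpha>. c (\<alpha>, J)"]) (use 0 zz z in auto)
    then show "c z = 0" by (simp add: z)
  qed
qed

text \<open>It suffices to know the coefficients at good points, provided that the numbers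
  \<open>c I \<alpha>\<close> depend neither on the point nor on the dual basis: for fixed
  \<open>w\<close> the difference of the two sides is polynomial in \<open>y\<close>.\<close>

lemma inv_forms_span:
  assumes \<phi>: "\<phi> \<in> inv_forms j p"
    and c: "\<And>I y f. I \<in> subsets_of_card r p \<Longrightarrow> good y \<Longrightarrow> dual_basis (\<lambda>i. dird (F i) y) f \<Longrightarrow>
      \<phi> (y, \<lambda>b. f (enum_set I b)) = (\<Sum>\<alpha> | (\<alpha>, I) \<in> inv_index j p. c I \<alpha> * pmono r F \<alpha> y)"
  shows "\<phi> = lincomb (inv_index j p) (inv_basis p) (\<lambda>(\<alpha>, I). c I \<alpha>)" (is "\<phi> = ?\<omega>")
proof -
  have \<phi>': "\<phi> \<in> forms j p" using \<phi> by (simp add: inv_forms_def)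
  have \<omega>': "?\<omega> \<in> forms j p"
    by (rule forms_lincomb) (use inv_basis_mem in \<open>auto simp: inv_forms_def\<close>)
  have "\<phi> (y, w) + (- 1) * ?\<omega> (y, w) = 0" for y w
  proof (rule good_dense[where f = "\<lambda>y. \<phi> (y, w) + (- 1) * ?\<omega> (y, w)"])
    show "linepoly (\<lambda>y. \<phi> (y, w) + (- 1) * ?\<omega> (y, w))"
      by (intro linepoly_add linepoly_mult linepoly_const forms_linepoly[OF \<phi>'] forms_linepoly[OF \<omega>'])
    fix y assume y: "good y"
    then obtain f where f: "dual_basis (\<lambda>i. dird (F i) y) f" using cobasis_dual[OF good_cobasis] by blast
    have "\<phi> (y, w) = (\<Sum>I\<in>subsets_of_card r p. \<phi> (y, \<lambda>b. f (enum_set I b)) *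
        dform p (\<lambda>b. dird (F (enum_set I b)) y) w)"
      using \<phi>' by (intro alt_expand[OF f]) (auto simp: forms_def)
    also have "\<dots> = (\<Sum>I\<in>subsets_of_card r p. ?\<omega> (y, \<lambda>b. f (enum_set I b)) *
        dform p (\<lambda>b. dird (F (enum_set I b)) y) w)"
      by (rule sum.cong) (simp_all add: c[OF _ y f] lincomb_inv_basis_dual[OF f])
    also have "\<dots> = ?\<omega> (y, w)"
      using \<omega>' by (intro alt_expand[OF f, symmetric]) (auto simp: forms_def)
    finally show "\<phi> (y, w) + (- 1) * ?\<omega> (y, w) = 0" by simp
  qed
  then show ?thesis by (intro ext) (simp add: split_paired_all)
qed

lemma eigen_cobases:
  obtains Y lam where "\<And>k. k \<in> K \<Longrightarrow> cobasis (Y k)"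
    "\<And>k i v. k \<in> K \<Longrightarrow> i < r \<Longrightarrow> Y k i (A k v) = lam k i * Y k i v"
    "\<And>k i. k \<in> K \<Longrightarrow> i < r \<Longrightarrow> lam k i \<noteq> 0"
proof -
  have "\<forall>k\<in>K. \<exists>Y c. cobasis Y \<and> (\<forall>i v. i < r \<longrightarrow> Y i (A k v) = c i * Y i v) \<and> (\<forall>i<r. c i \<noteq> 0)"
  proof
    fix k assume k: "k \<in> K"
    have pow: "(A k ^^ n) v = A (k [^] n) v" for n v
      by (induction n arbitrary: v) (use k A_one A_mult in \<open>simp_all add: funpow_Suc_right del: funpow.simps(2)\<close>)
    have "k [^] order \<Gamma> = \<one>" using k by (rule pow_order_eq_1)
    then have "A k ^^ order \<Gamma> = id" using pow[of "order \<Gamma>"] A_one by auto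
    moreover have pos: "order \<Gamma> > 0" using card_K by (simp add: order_def)
    ultimately obtain Y c where Y: "cobasis Y" "\<And>i v. i < r \<Longrightarrow> Y i (A k v) = c i * Y i v"
      "\<And>i. i < r \<Longrightarrow> c i ^ order \<Gamma> = 1" using eigen_cobasis[OF _ _ A_linear[OF k]] by metis
    have "c i \<noteq> 0" if "i < r" for i using Y(3)[OF that] pos by (auto simp: power_0_left)
    with Y show "\<exists>Y c. cobasis Y \<and> (\<forall>i v. i < r \<longrightarrow> Y i (A k v) = c i * Y i v) \<and> (\<forall>i<r. c i \<noteq> 0)" by blast
  qed
  then obtain Y c where "\<forall>k\<in>K. cobasis (Y k) \<and> (\<forall>i v. i < r \<longrightarrow> Y k i (A k v) = c k i * Y k i v) \<and> (\<forall>i<r. c k i \<noteq> 0)"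
    by metis
  then show thesis by (intro that[of Y c]) auto
qed

text \<open>The generation of the invariant ring by \<open>F\<close>, restated for forms of degree
  0; the trace formula for this frame is Molien's formula.\<close>

lemma frame_inv_forms_0: "frame (inv_index j 0) (inv_basis 0) (inv_forms j 0)"
  unfolding frame_def
proof (intro conjI finite_inv_index indep_inv_basis subset_antisym subsetI)
  fix \<phi> assume \<phi>: "\<phi> \<in> inv_forms j 0"
  have const: "\<phi> (y, w) = \<phi> (y, \<lambda>_. 0)" for y w
    using \<phi> by (intro mlin_cong[of 0 "\<lambda>w. \<phi> (y, w)"] alt_mlin) (auto simp: inv_forms_def forms_def)
  have "(\<lambda>y. \<phi> (y, \<lambda>_. 0)) \<in> S j" using \<phi> by (auto simp: inv_forms_def forms_def)
  moreover have "\<phi> (A g v, \<lambda>_. 0) = \<phi> (v, \<lambda>_. 0)" if "g \<in> K" for g v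
    using \<phi> that const[of "A g v" "\<lambda>b. A g 0"] by (auto simp: inv_forms_def)
  ultimately obtain c where c: "(\<lambda>y. \<phi> (y, \<lambda>_. 0)) = lincomb (expos_deg r d j) (pmono r F) c"
    using invariant_polynomial[of "\<lambda>y. \<phi> (y, \<lambda>_. 0)" j] by blast
  have "\<phi> = lincomb (inv_index j 0) (inv_basis 0) (\<lambda>(\<alpha>, I). c \<alpha>)"
  proof (rule inv_forms_span[OF \<phi>])
    fix I y f assume I: "I \<in> subsets_of_card r 0"
    then have "{\<alpha>. (\<alpha>, I) \<in> inv_index j 0} = expos_deg r d j"
      using inv_index_fibre[OF I, of j] by (simp add: subsets_of_card_0)
    then show "\<phi> (y, \<lambda>b. f (enum_set I b)) = (\<Sum>\<alpha> | (\<alpha>, I) \<in> inv_index j 0. c \<alpha> * pmono r F \<alpha> y)"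
      using const[of y] fun_cong[OF c, of y] by (simp add: lincomb_def)
  qed
  then show "\<phi> \<in> range (lincomb (inv_index j 0) (inv_basis 0))"
    by (rule image_eqI[where x = "\<lambda>(\<alpha>, I). c \<alpha>"]) simp
next
  fix \<phi> assume "\<phi> \<in> range (lincomb (inv_index j 0) (inv_basis 0))"
  then show "\<phi> \<in> inv_forms j 0" using inv_forms_lincomb[of "inv_index j 0" "inv_basis 0" j 0] inv_basis_mem by auto
qed

lemma hsum_one: "hsum r d (\<lambda>_. 1) j = of_nat (card (expos_deg r d j))"
  by (simp add: hsum_def)

lemma trace_formula_id:
  assumes "\<And>k. k \<in> K \<Longrightarrow> cobasis (Y k)"
    "\<And>k i v. k \<in> K \<Longrightarrow> i < r \<Longrightarrow> Y k i (A k v) = lam k i * Y k i v"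
    "frame J0 b0 (inv_forms j p)"
  shows "(\<Sum>k\<in>K. hsum r (\<lambda>_. 1) (lam k) j * esum r p (lam k)) = of_nat (card K) * of_nat (card J0)"
proof -
  have "linm (\<lambda>v. v)" by (simp add: linm_iff)
  from trace_formula[OF this this assms(1,2,2,3), of "\<lambda>_. 1"] show ?thesis by simp
qed

lemma molien:
  assumes "\<And>k. k \<in> K \<Longrightarrow> cobasis (Y k)"
    "\<And>k i v. k \<in> K \<Longrightarrow> i < r \<Longrightarrow> Y k i (A k v) = lam k i * Y k i v"
  shows "(\<Sum>k\<in>K. hsum r (\<lambda>_. 1) (lam k) j) = of_nat (card K) * hsum r d (\<lambda>_. 1) j"
proof -
  have "card (inv_index j 0) = card (expos_deg r d j)"
  proof -
    have "inv_index j 0 = (\<lambda>\<alpha>. (\<alpha>, {})) ` expos_deg r d j"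
      by (auto simp: inv_index_def subsets_of_card_0 expos_deg_def)
    then show ?thesis by (simp add: card_image inj_on_def)
  qed
  with trace_formula_id[OF assms frame_inv_forms_0, of j] show ?thesis
    by (simp add: esum_0 hsum_one)
qed

text \<open>The independent family is extended to a basis \<open>B\<close>, and counting shows that
  nothing was added. For \<open>p = r\<close> the trace formula expresses \<open>card B\<close> by
  determinants times complete symmetric sums, and \<open>molien_reciprocity\<close> evaluates these
  as the number of monomials in \<open>F\<close> of degree \<open>j - ?m\<close>.\<close>

lemma solomon_top: "frame (inv_index j r) (inv_basis r) (inv_forms j r)"
proof -
  obtain Y lam where Y: "\<And>k. k \<in> K \<Longrightarrow> cobasis (Y k)"
    "\<And>k i v. k \<in> K \<Longrightarrow> i < r \<Longrightarrow> Y k i (A k v) = lam k i * Y k i v"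
    "\<And>k i. k \<in> K \<Longrightarrow> i < r \<Longrightarrow> lam k i \<noteq> 0" using eigen_cobases by metis
  let ?m = "\<Sum>i<r. d i - 1"
  have inv: "(\<Sum>k\<in>K. f (inv k)) = (\<Sum>k\<in>K. f k)" for f :: "'k \<Rightarrow> complex"
    by (rule sum.reindex_bij_witness[where i = "\<lambda>k. inv k" and j = "\<lambda>k. inv k"]) auto
  \<comment> \<open>Inversion permutes the group and inverts eigenvalues, which brings Molien's
    formula into the form that the substitution \<open>1/z\<close> requires.\<close>
  have molien_inv: "(\<Sum>k\<in>K. hsum r (\<lambda>_. 1) (\<lambda>i. inverse (lam k i)) n) = of_nat (card K) * hsum r d (\<lambda>_. 1) n" for n
  proof -
    have "Y (inv k) i (A k v) = inverse (lam (inv k) i) * Y (inv k) i v" if k: "k \<in> K" and i: "i < r" for k i v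
    proof -
      have "Y (inv k) i v = Y (inv k) i (A (inv k) (A k v))"
        using k A_mult[of "inv k" k v] A_one by simp
      also have "\<dots> = lam (inv k) i * Y (inv k) i (A k v)" using Y(2)[of "inv k"] k i by simp
      finally show ?thesis using Y(3)[of "inv k" i] k i by simp
    qed
    then have "(\<Sum>k\<in>K. hsum r (\<lambda>_. 1) (\<lambda>i. inverse (lam (inv k) i)) n) = of_nat (card K) * hsum r d (\<lambda>_. 1) n"
      using Y(1) by (intro molien[of "\<lambda>k. Y (inv k)"]) auto
    then show ?thesis using inv[of "\<lambda>k. hsum r (\<lambda>_. 1) (\<lambda>i. inverse (lam k i)) n"] by simp
  qed
  have "fs.subspace (inv_forms j r)"
  proof (rule fs.subspaceI)
    show "0 \<in> inv_forms j r"
      using inv_forms_lincomb[of "{}" undefined j r undefined] by (simp add: lincomb_def zero_fun_def)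
    show "\<phi> + \<psi> \<in> inv_forms j r" if "\<phi> \<in> inv_forms j r" "\<psi> \<in> inv_forms j r" for \<phi> \<psi>
      using inv_forms_lincomb[of "{True, False}" "\<lambda>b. if b then \<phi> else \<psi>" j r "\<lambda>_. 1"] that
      by (simp add: lincomb_def plus_fun_def)
    show "fscale c \<phi> \<in> inv_forms j r" if "\<phi> \<in> inv_forms j r" for c \<phi>
      using inv_forms_lincomb[of "{()}" "\<lambda>_. \<phi>" j r "\<lambda>_. c"] that by (simp add: lincomb_def fscale_def)
  qed
  moreover have "inv_forms j r \<subseteq> forms j r" by (auto simp: inv_forms_def)
  ultimately obtain B where B: "frame B (\<lambda>f. f) (inv_forms j r)" "inv_basis r ` inv_index j r \<subseteq> B"
    using frame_extend[OF frame_forms[OF cobasis_X], of "inv_forms j r" j r "inv_index j r" "inv_basis r"]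
      finite_inv_index indep_inv_basis inv_basis_mem by metis
  have "of_nat (card K) * of_nat (card B) = (\<Sum>k\<in>K. (\<Prod>i<r. lam k i) * hsum r (\<lambda>_. 1) (lam k) j)"
    using trace_formula_id[OF Y(1,2) B(1)] by (simp add: esum_full mult.commute)
  also have "\<dots> = (if j < ?m then 0 else of_nat (card K) * hsum r d (\<lambda>_. 1) (j - ?m))"
    by (rule molien_reciprocity[OF fin Y(3) d_pos molien_inv])
  also have "\<dots> = of_nat (card K) * (of_nat (if j < ?m then 0 else card (expos_deg r d (j - ?m))) :: complex)"
    by (simp add: hsum_one)
  finally have "(of_nat (card B) :: complex) = of_nat (if j < ?m then 0 else card (expos_deg r d (j - ?m)))"
    using card_K by simp
  then have cardB: "card B = (if j < ?m then 0 else card (expos_deg r d (j - ?m)))"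
    unfolding of_nat_eq_iff .
  have U: "{..<r} \<in> subsets_of_card r r" by (simp add: subsets_of_card_full)
  have "inv_index j r = (\<lambda>\<alpha>. (\<alpha>, {..<r})) ` {\<alpha>. (\<alpha>, {..<r}) \<in> inv_index j r}"
    by (auto simp: inv_index_def subsets_of_card_full)
  then have "card (inv_index j r) = card {\<alpha>. (\<alpha>, {..<r}) \<in> inv_index j r}"
    by (metis (no_types, lifting) card_image inj_on_def prod.inject)
  also have "\<dots> = card B" by (simp add: inv_index_fibre[OF U] cardB)
  finally have card_eq: "card (inv_index j r) = card B" .
  have inj: "inj_on (inv_basis r) (inv_index j r)"
    by (rule indep_family_imp_independent[OF finite_inv_index indep_inv_basis])
  have "inv_basis r ` inv_index j r = B"
    using B(1) inj card_eq by (intro card_subset_eq[OF _ B(2)]) (auto simp: frame_def card_image)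
  moreover have "inv_forms j r = fs.span B"
    using B(1) range_lincomb_eq_span[of B "\<lambda>f. f"] by (simp add: frame_def)
  ultimately show ?thesis
    using frame_span[OF finite_inv_index indep_inv_basis, of j r] by simp
qed

lemma permutes_fixing:
  "{\<sigma>. \<sigma> permutes {..<r} \<and> (\<forall>b\<in>{p..<r}. \<sigma> b = b)} = {\<sigma>. \<sigma> permutes {..<p}}" if "p \<le> r"
proof (intro subset_antisym subsetI)
  fix \<sigma> assume "\<sigma> \<in> {\<sigma>. \<sigma> permutes {..<r} \<and> (\<forall>b\<in>{p..<r}. \<sigma> b = b)}"
  then have "\<sigma> permutes {..<r}" "\<forall>b\<in>{..<r} - {..<p}. \<sigma> b = b" by auto
  then show "\<sigma> \<in> {\<sigma>. \<sigma> permutes {..<p}}" using permutes_superset by blast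
next
  fix \<sigma> assume "\<sigma> \<in> {\<sigma>. \<sigma> permutes {..<p}}"
  then show "\<sigma> \<in> {\<sigma>. \<sigma> permutes {..<r} \<and> (\<forall>b\<in>{p..<r}. \<sigma> b = b)}"
    using that permutes_subset[of \<sigma> "{..<p}" "{..<r}"] permutes_not_in[of \<sigma> "{..<p}"] by auto
qed

text \<open>
  The coefficients of an invariant \<open>p\<close>-form in the frame \<open>dF\<^sub>i\<close> are recovered by wedging with the
  complementary differentials, which yields an invariant \<open>r\<close>-form.
\<close>

lemma inv_form_coefficient:
  assumes \<phi>: "\<phi> \<in> inv_forms j p" and I: "I \<in> subsets_of_card r p"
  obtains c where "\<And>y f. good y \<Longrightarrow> dual_basis (\<lambda>i. dird (F i) y) f \<Longrightarrow>
      \<phi> (y, \<lambda>b. f (enum_set I b)) = (\<Sum>\<alpha> | (\<alpha>, I) \<in> inv_index j p. c \<alpha> * pmono r F \<alpha> y)"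
proof -
  note I' = subsets_of_cardD[OF I]
  have pr: "p \<le> r" using card_mono[of "{..<r}" I] I' by simp
  obtain \<tau> where \<tau>: "\<tau> permutes {..<r}" "\<And>b. b < p \<Longrightarrow> \<tau> b = enum_set I b"
    by (rule extend_enum_set[OF I]) blast
  have \<tau>r: "\<tau> b < r" if "b < r" for b using permutes_lessThan[OF \<tau>(1)] that by simp
  have \<phi>1: "(\<lambda>y. \<phi> (y, w)) \<in> S j" "alt p (\<lambda>w. \<phi> (y, w))" for y w
    using \<phi> by (auto simp: inv_forms_def forms_def)
  have \<phi>2: "\<phi> (A k y, \<lambda>b. A k (w b)) = \<phi> (y, w)" if "k \<in> K" for k y w
    using \<phi> that by (auto simp: inv_forms_def)
  \<comment> \<open>\<open>\<eta>\<close> is, up to normalisation, the wedge product of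
    \<open>\<phi>\<close> with the differentials of the complement of \<open>I\<close>, in the order
    in which \<open>\<tau>\<close> lists them.\<close>
  define \<psi> where "\<psi> y w = \<phi> (y, w) * (\<Prod>b\<in>{p..<r}. dird (F (\<tau> b)) y (w b))" for y w
  define \<eta> where "\<eta> = (\<lambda>(y, w). altz r (\<psi> y) w)"
  define n where "n = (\<Sum>b\<in>{p..<r}. d (\<tau> b) - 1)"
  have "\<eta> \<in> inv_forms (j + n) r"
  proof -
    have 1: "(\<lambda>y. \<eta> (y, w)) \<in> S (j + n)" for w
    proof -
      have "(\<lambda>y. \<psi> y w') \<in> S (j + n)" for w'
        unfolding \<psi>_def n_def
        by (intro sym_comp_mult \<phi>1(1) sym_comp_prod dird_sym_comp F_sym d_pos) (use \<tau>r in auto)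
      then show ?thesis unfolding \<eta>_def prod.case altz_def by (intro sym_comp_sum sym_comp_scale)
    qed
    have 2: "alt r (\<lambda>w. \<eta> (y, w))" for y
    proof -
      have "mlin r (\<psi> y)"
        unfolding \<psi>_def[abs_def]
        by (rule mlin_mult_prod[OF alt_mlin[OF \<phi>1(2)] pr]) (use dird_linf[OF F_sym] \<tau>r in auto)
      from alt_altz[OF this] show ?thesis by (simp add: \<eta>_def)
    qed
    have 3: "\<eta> (A k y, \<lambda>b. A k (w b)) = \<eta> (y, w)" if k: "k \<in> K" for k y w
    proof -
      have "\<psi> (A k y) ((\<lambda>b. A k (w b)) \<circ> \<sigma>) = \<psi> y (w \<circ> \<sigma>)" for \<sigma>
        using \<phi>2[OF k, of y "w \<circ> \<sigma>"] dird_F_inv[OF \<tau>r k] by (simp add: \<psi>_def comp_def)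
      then show ?thesis by (simp add: \<eta>_def altz_def)
    qed
    show ?thesis using 1 2 3 by (auto simp: inv_forms_def forms_def)
  qed
  then have "\<eta> \<in> range (lincomb (inv_index (j + n) r) (inv_basis r))"
    using solomon_top[of "j + n"] by (simp add: frame_def)
  then obtain c where c: "\<eta> = lincomb (inv_index (j + n) r) (inv_basis r) c" by blast
  define U where "U = {..<r}"
  have U: "U \<in> subsets_of_card r r" by (simp add: subsets_of_card_full U_def)
  have Ubij: "bij_betw (enum_set U) {..<r} {..<r}" using subsets_of_cardD(4)[OF U] by (simp add: U_def)
  \<comment> \<open>\<open>\<rho>\<close> compares the order of \<open>\<tau>\<close> with the fixed
    enumeration of the full index set, in which \<open>inv_basis r\<close> is written.\<close>
  define \<rho> where "\<rho> b = (if b < r then inv_into {..<r} (enum_set U) (\<tau> b) else b)" for b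
  have \<rho>: "\<rho> permutes {..<r}"
  proof (rule bij_imp_permutes)
    show "bij_betw \<rho> {..<r} {..<r}"
      using bij_betw_trans[OF permutes_imp_bij[OF \<tau>(1)] bij_betw_inv_into[OF Ubij]]
      by (rule bij_betw_cong[THEN iffD1, rotated]) (simp add: \<rho>_def)
  qed (simp add: \<rho>_def)
  have enum\<rho>: "enum_set U (\<rho> b) = \<tau> b" if "b < r" for b
    using bij_betw_inv_into_right[OF Ubij, of "\<tau> b"] that \<tau>r by (simp add: \<rho>_def)
  have index: "{\<alpha>. (\<alpha>, U) \<in> inv_index (j + n) r} = {\<alpha>. (\<alpha>, I) \<in> inv_index j p}"
  proof -
    have "(\<Sum>i\<in>U. d i - 1) = (\<Sum>b<r. d (\<tau> b) - 1)"
      unfolding U_def by (rule sum.reindex_bij_betw[OF permutes_imp_bij[OF \<tau>(1)], symmetric])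
    also have "\<dots> = (\<Sum>b<p. d (\<tau> b) - 1) + n"
      unfolding n_def using pr sum.atLeastLessThan_concat[of 0 p r "\<lambda>b. d (\<tau> b) - 1"]
      by (simp add: atLeast0LessThan)
    also have "(\<Sum>b<p. d (\<tau> b) - 1) = (\<Sum>i\<in>I. d i - 1)"
      using sum_enum_set[OF I, of "\<lambda>i. d i - 1"] \<tau>(2) by simp
    finally show ?thesis using U I by (auto simp: inv_index_iff)
  qed
  show thesis
  \<comment> \<open>The sign reorders the differentials from \<open>\<tau>\<close> to
    \<open>enum_set U\<close>. The factorial appears because \<open>altz\<close> is not normalised:
    the \<open>p!\<close> permutations of the slots of \<open>\<phi>\<close> all give the same
    term.\<close>
  proof (rule that[of "\<lambda>\<alpha>. of_int (sign \<rho>) * c (\<alpha>, U) / of_nat (fact p)"])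
    fix y f assume y: "good y" and f: "dual_basis (\<lambda>i. dird (F i) y) f"
    let ?w = "\<lambda>b. f (\<tau> b)"
    let ?P = "\<lambda>\<sigma>. (\<Prod>b\<in>{p..<r}. dird (F (\<tau> b)) y (?w (\<sigma> b)))"
    have wI: "\<phi> (y, ?w) = \<phi> (y, \<lambda>b. f (enum_set I b))"
      using \<tau>(2) by (intro mlin_cong[OF alt_mlin[OF \<phi>1(2)]]) auto
    \<comment> \<open>By duality a differential is nonzero only on its own vector, so precisely the
      permutations fixing every complementary slot survive.\<close>
    have P: "?P \<sigma> = (if \<forall>b\<in>{p..<r}. \<sigma> b = b then 1 else 0)" if \<sigma>: "\<sigma> permutes {..<r}" for \<sigma>
    proof -
      have e: "dird (F (\<tau> b)) y (?w (\<sigma> b)) = (if \<sigma> b = b then 1 else 0)" if "b < r" for b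
      proof -
        have "\<tau> b = \<tau> (\<sigma> b) \<longleftrightarrow> \<sigma> b = b"
          unfolding inj_eq[OF permutes_inj[OF \<tau>(1)]] by (rule eq_commute)
        then show ?thesis
          using f \<tau>r[OF that] \<tau>r[of "\<sigma> b"] permutes_lessThan[OF \<sigma>] that by (simp add: dual_basis_def)
      qed
      show ?thesis
      proof (cases "\<forall>b\<in>{p..<r}. \<sigma> b = b")
        case True
        have "?P \<sigma> = (\<Prod>b\<in>{p..<r}. 1)"
        proof (rule prod.cong)
          fix b assume "b \<in> {p..<r}"
          then show "dird (F (\<tau> b)) y (?w (\<sigma> b)) = 1" using e[of b] True by simp
        qed simp
        with True show ?thesis by simp
      next
        case False
        then obtain b where b: "b \<in> {p..<r}" "\<sigma> b \<noteq> b" by blast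
        have "?P \<sigma> = 0"
          by (rule prod_zero) (use b e[of b] in \<open>auto intro!: bexI[of _ b]\<close>)
        then show ?thesis using False by (simp only: if_False)
      qed
    qed
    have mult_if: "a * (b * (if Q then 1 else 0)) = (if Q then a * b else 0)" for a b :: complex and Q
      by simp
    have "\<eta> (y, ?w) = (\<Sum>\<sigma> | \<sigma> permutes {..<r}. of_int (sign \<sigma>) * (\<phi> (y, ?w \<circ> \<sigma>) * ?P \<sigma>))"
      by (simp add: \<eta>_def altz_def \<psi>_def)
    also have "\<dots> = (\<Sum>\<sigma> | \<sigma> permutes {..<r}. if \<forall>b\<in>{p..<r}. \<sigma> b = b then of_int (sign \<sigma>) * \<phi> (y, ?w \<circ> \<sigma>) else 0)"
    proof (rule sum.cong)
      fix \<sigma> assume "\<sigma> \<in> {\<sigma>. \<sigma> permutes {..<r}}"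
      then have "\<sigma> permutes {..<r}" by simp
      from P[OF this] show "of_int (sign \<sigma>) * (\<phi> (y, ?w \<circ> \<sigma>) * ?P \<sigma>) =
          (if \<forall>b\<in>{p..<r}. \<sigma> b = b then of_int (sign \<sigma>) * \<phi> (y, ?w \<circ> \<sigma>) else 0)"
        by (simp only: mult_if)
    qed simp
    also have "\<dots> = (\<Sum>\<sigma> | \<sigma> permutes {..<r} \<and> (\<forall>b\<in>{p..<r}. \<sigma> b = b). of_int (sign \<sigma>) * \<phi> (y, ?w \<circ> \<sigma>))"
      by (subst sum.inter_filter[symmetric]) (simp_all only: finite_permutations finite_lessThan mem_Collect_eq)
    also have "\<dots> = (\<Sum>\<sigma> | \<sigma> permutes {..<p}. of_int (sign \<sigma>) * \<phi> (y, ?w \<circ> \<sigma>))"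
      unfolding permutes_fixing[OF pr] ..
    also have "\<dots> = (\<Sum>\<sigma> | \<sigma> permutes {..<p}. \<phi> (y, ?w))"
    proof (rule sum.cong)
      fix \<sigma> assume "\<sigma> \<in> {\<sigma>. \<sigma> permutes {..<p}}"
      then show "of_int (sign \<sigma>) * \<phi> (y, ?w \<circ> \<sigma>) = \<phi> (y, ?w)"
        using alt_permute[OF \<phi>1(2), of \<sigma> y ?w] sign_mult_self[of \<sigma>] by (simp add: mult.assoc[symmetric])
    qed simp
    also have "\<dots> = of_nat (fact p) * \<phi> (y, ?w)" by (simp add: card_permutations)
    finally have \<eta>1: "\<eta> (y, ?w) = of_nat (fact p) * \<phi> (y, \<lambda>b. f (enum_set I b))" by (simp add: wI)
    have \<eta>alt: "alt r (\<lambda>w. \<eta> (y, w))"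
      using \<open>\<eta> \<in> inv_forms (j + n) r\<close> by (auto simp: inv_forms_def forms_def)
    have "\<eta> (y, ?w) = \<eta> (y, (\<lambda>b. f (enum_set U b)) \<circ> \<rho>)"
      using enum\<rho> by (intro mlin_cong[OF alt_mlin[OF \<eta>alt]]) simp
    also have "\<dots> = of_int (sign \<rho>) * \<eta> (y, \<lambda>b. f (enum_set U b))" by (rule alt_permute[OF \<eta>alt \<rho>])
    also have "\<eta> (y, \<lambda>b. f (enum_set U b)) = (\<Sum>\<alpha> | (\<alpha>, U) \<in> inv_index (j + n) r. c (\<alpha>, U) * pmono r F \<alpha> y)"
      unfolding c by (rule lincomb_inv_basis_dual[OF f U])
    finally have "of_nat (fact p) * \<phi> (y, \<lambda>b. f (enum_set I b)) =
        of_int (sign \<rho>) * (\<Sum>\<alpha> | (\<alpha>, I) \<in> inv_index j p. c (\<alpha>, U) * pmono r F \<alpha> y)"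
      by (simp only: \<eta>1 index)
    then have "\<phi> (y, \<lambda>b. f (enum_set I b)) =
        (of_int (sign \<rho>) * (\<Sum>\<alpha> | (\<alpha>, I) \<in> inv_index j p. c (\<alpha>, U) * pmono r F \<alpha> y)) / of_nat (fact p)"
      by (simp add: field_simps)
    then show "\<phi> (y, \<lambda>b. f (enum_set I b)) =
        (\<Sum>\<alpha> | (\<alpha>, I) \<in> inv_index j p. of_int (sign \<rho>) * c (\<alpha>, U) / of_nat (fact p) * pmono r F \<alpha> y)"
      by (simp add: sum_distrib_left sum_divide_distrib mult.assoc)
  qed
qed

theorem solomon: "frame (inv_index j p) (inv_basis p) (inv_forms j p)"
  unfolding frame_def
proof (intro conjI finite_inv_index indep_inv_basis subset_antisym subsetI)
  fix \<phi> assume \<phi>: "\<phi> \<in> inv_forms j p"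
  have "\<forall>I\<in>subsets_of_card r p. \<exists>c. \<forall>y f. good y \<longrightarrow> dual_basis (\<lambda>i. dird (F i) y) f \<longrightarrow>
      \<phi> (y, \<lambda>b. f (enum_set I b)) = (\<Sum>\<alpha> | (\<alpha>, I) \<in> inv_index j p. c \<alpha> * pmono r F \<alpha> y)"
    (is "\<forall>I\<in>_. ?C I")
  proof
    fix I assume I: "I \<in> subsets_of_card r p"
    show "?C I"
    proof (rule inv_form_coefficient[OF \<phi> I])
      fix c assume "\<And>y f. good y \<Longrightarrow> dual_basis (\<lambda>i. dird (F i) y) f \<Longrightarrow>
        \<phi> (y, \<lambda>b. f (enum_set I b)) = (\<Sum>\<alpha> | (\<alpha>, I) \<in> inv_index j p. c \<alpha> * pmono r F \<alpha> y)"
      then show "?C I" by (intro exI[of _ c] allI impI)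
    qed
  qed
  from bchoice[OF this] obtain c where "\<forall>I\<in>subsets_of_card r p. \<forall>y f. good y \<longrightarrow> dual_basis (\<lambda>i. dird (F i) y) f \<longrightarrow>
      \<phi> (y, \<lambda>b. f (enum_set I b)) = (\<Sum>\<alpha> | (\<alpha>, I) \<in> inv_index j p. c I \<alpha> * pmono r F \<alpha> y)" ..
  then have "\<phi> = lincomb (inv_index j p) (inv_basis p) (\<lambda>(\<alpha>, I). c I \<alpha>)"
    by (intro inv_forms_span[OF \<phi>]) simp
  then show "\<phi> \<in> range (lincomb (inv_index j p) (inv_basis p))"
    by (rule image_eqI[where x = "\<lambda>(\<alpha>, I). c I \<alpha>"]) simp
next
  fix \<phi> assume "\<phi> \<in> range (lincomb (inv_index j p) (inv_basis p))"
  then show "\<phi> \<in> inv_forms j p" using inv_forms_lincomb[of "inv_index j p" "inv_basis p" j p] inv_basis_mem by auto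
qed

text \<open>Summing over all \<open>p\<close> turns elementary symmetric sums into products of
  \<open>1 + mu k i\<close>, and summing over \<open>j\<close> against \<open>z ^ j\<close> gives
  the denominators. No variable marks \<open>p\<close>, because scaling \<open>T\<close> scales all
  \<open>mu\<close> and \<open>c\<close> alike. The identity holds for power series and is then
  evaluated wherever no denominator vanishes.\<close>

theorem trace_identity:
  assumes g: "linm g" "linm T"
    and Y: "\<And>k. k \<in> K \<Longrightarrow> cobasis (Y k)"
      "\<And>k i v. k \<in> K \<Longrightarrow> i < r \<Longrightarrow> Y k i (g (A k v)) = lam k i * Y k i v"
      "\<And>k i v. k \<in> K \<Longrightarrow> i < r \<Longrightarrow> Y k i (T (A k v)) = mu k i * Y k i v"
    and F: "\<And>i v. i < r \<Longrightarrow> F i (g v) = eps i * F i v"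
      "\<And>i y w. i < r \<Longrightarrow> dird (F i) (g y) (T w) = c i * dird (F i) y w"
    and z: "\<And>k i. k \<in> K \<Longrightarrow> i < r \<Longrightarrow> lam k i * z \<noteq> 1" "\<And>i. i < r \<Longrightarrow> eps i * z ^ d i \<noteq> 1"
  shows "(\<Sum>k\<in>K. \<Prod>i<r. (1 + mu k i) / (1 - lam k i * z)) =
    of_nat (card K) * (\<Prod>i<r. (1 + c i * z ^ (d i - 1)) / (1 - eps i * z ^ d i))"
proof -
  let ?s = "\<lambda>I. \<Sum>i\<in>I. d i - 1"
  have tr: "(\<Sum>k\<in>K. hsum r (\<lambda>_. 1) (lam k) j * esum r p (mu k)) = of_nat (card K) *
      (\<Sum>I\<in>subsets_of_card r p. (\<Prod>i\<in>I. c i) * (if j < ?s I then 0 else hsum r d eps (j - ?s I)))" for j p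
  proof -
    have "(\<Sum>k\<in>K. hsum r (\<lambda>_. 1) (lam k) j * esum r p (mu k)) = of_nat (card K) *
        (\<Sum>x\<in>inv_index j p. (\<Prod>i<r. eps i ^ fst x i) * (\<Prod>i\<in>snd x. c i))"
    proof (rule trace_formula[OF g Y solomon])
      fix x y w assume "x \<in> inv_index j p"
      then show "inv_basis p x (g y, \<lambda>b. T (w b)) =
          (\<Prod>i<r. eps i ^ fst x i) * (\<Prod>i\<in>snd x. c i) * inv_basis p x (y, w)"
        using inv_basis_eigen[of g eps T c, OF F, of "snd x" p "fst x" y w]
        by (cases x) (auto simp: inv_index_iff)
    qed auto
    also have "(\<Sum>x\<in>inv_index j p. (\<Prod>i<r. eps i ^ fst x i) * (\<Prod>i\<in>snd x. c i)) =
        (\<Sum>I\<in>subsets_of_card r p. \<Sum>\<alpha> | (\<alpha>, I) \<in> inv_index j p. (\<Prod>i<r. eps i ^ \<alpha> i) * (\<Prod>i\<in>I. c i))"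
      by (subst sum_inv_index) simp
    also have "\<dots> = (\<Sum>I\<in>subsets_of_card r p. (\<Prod>i\<in>I. c i) * (if j < ?s I then 0 else hsum r d eps (j - ?s I)))"
    proof (rule sum.cong)
      fix I assume I: "I \<in> subsets_of_card r p"
      have "(\<Sum>\<alpha> | (\<alpha>, I) \<in> inv_index j p. (\<Prod>i<r. eps i ^ \<alpha> i) * (\<Prod>i\<in>I. c i)) =
          (\<Prod>i\<in>I. c i) * (\<Sum>\<alpha> | (\<alpha>, I) \<in> inv_index j p. \<Prod>i<r. eps i ^ \<alpha> i)"
        by (simp add: sum_distrib_left mult.commute)
      then show "(\<Sum>\<alpha> | (\<alpha>, I) \<in> inv_index j p. (\<Prod>i<r. eps i ^ \<alpha> i) * (\<Prod>i\<in>I. c i)) =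
          (\<Prod>i\<in>I. c i) * (if j < ?s I then 0 else hsum r d eps (j - ?s I))"
        unfolding inv_index_fibre[OF I] by (simp add: hsum_def)
    qed simp
    finally show ?thesis .
  qed
  define q where "q k = (\<Prod>i<r. fac (lam k) (\<lambda>_. 1) i)" for k
  define Q where "Q = (\<Prod>i<r. fac eps d i)"
  define L where "L k = [:\<Prod>i<r. 1 + mu k i:]" for k
  define M where "M = [:of_nat (card K):] * (\<Prod>i<r. 1 + Polynomial.monom (c i) (d i - 1))"
  have hq: "Abs_fps (hsum r (\<lambda>_. 1) (lam k)) = inverse (fps_of_poly (q k))" for k
    unfolding q_def by (rule hsum_fps) simp
  have hQ: "Abs_fps (hsum r d eps) = inverse (fps_of_poly Q)"
    unfolding Q_def by (rule hsum_fps[OF d_pos])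
  have esum: "(\<Sum>p\<le>r. esum r p (mu k)) = (\<Prod>i<r. 1 + mu k i)" for k
    unfolding esum_def sum_subsets_of_card by (rule prod_one_plus) simp
  have M: "fps_of_poly M = fps_const (of_nat (card K)) *
      (\<Sum>I\<in>Pow {..<r}. fps_const (\<Prod>i\<in>I. c i) * fps_X ^ ?s I)"
  proof -
    have "fps_of_poly M = fps_const (of_nat (card K)) * (\<Prod>i<r. 1 + fps_const (c i) * fps_X ^ (d i - 1))"
      by (simp only: M_def fps_of_poly_mult fps_of_poly_const fps_of_poly_prod fps_of_poly_add
          fps_of_poly_1 fps_of_poly_monom)
    also have "(\<Prod>i<r. 1 + fps_const (c i) * fps_X ^ (d i - 1)) =
        (\<Sum>I\<in>Pow {..<r}. \<Prod>i\<in>I. fps_const (c i) * fps_X ^ (d i - 1))"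
      by (rule prod_one_plus[symmetric]) simp
    also have "\<dots> = (\<Sum>I\<in>Pow {..<r}. fps_const (\<Prod>i\<in>I. c i) * fps_X ^ ?s I)"
    proof (rule sum.cong)
      fix I
      have "(\<Prod>i\<in>I. fps_const (c i)) = fps_const (\<Prod>i\<in>I. c i)"
        by (induction I rule: infinite_finite_induct) (auto simp: fps_const_mult[symmetric] simp del: fps_const_mult)
      then show "(\<Prod>i\<in>I. fps_const (c i) * fps_X ^ (d i - 1)) = fps_const (\<Prod>i\<in>I. c i) * fps_X ^ ?s I"
        by (simp add: prod.distrib power_sum)
    qed simp
    finally show ?thesis .
  qed
  have "(\<Sum>k\<in>K. fps_of_poly (L k) * inverse (fps_of_poly (q k))) = fps_of_poly M * inverse (fps_of_poly Q)"
  proof (rule fps_ext)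
    fix j
    have "fps_nth (\<Sum>k\<in>K. fps_of_poly (L k) * inverse (fps_of_poly (q k))) j =
        (\<Sum>k\<in>K. (\<Sum>p\<le>r. esum r p (mu k)) * hsum r (\<lambda>_. 1) (lam k) j)"
      unfolding hq[symmetric] fps_sum_nth L_def fps_of_poly_const esum by simp
    also have "\<dots> = (\<Sum>p\<le>r. \<Sum>k\<in>K. hsum r (\<lambda>_. 1) (lam k) j * esum r p (mu k))"
      by (subst sum.swap) (simp add: sum_distrib_left sum_distrib_right mult.commute)
    also have "\<dots> = of_nat (card K) * (\<Sum>I\<in>Pow {..<r}. (\<Prod>i\<in>I. c i) *
        (if j < ?s I then 0 else hsum r d eps (j - ?s I)))"
      unfolding tr sum_distrib_left[symmetric] sum_subsets_of_card ..
    also have "\<dots> = fps_nth (fps_of_poly M * inverse (fps_of_poly Q)) j"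
      unfolding M hQ[symmetric]
      by (simp only: mult.assoc sum_distrib_right fps_mult_left_const_nth fps_sum_nth fps_X_power_mult_nth fps_nth_Abs_fps)
    finally show "fps_nth (\<Sum>k\<in>K. fps_of_poly (L k) * inverse (fps_of_poly (q k))) j =
        fps_nth (fps_of_poly M * inverse (fps_of_poly Q)) j" .
  qed
  moreover have q0: "poly (q k) 0 \<noteq> 0" for k
    by (auto simp: q_def poly_prod poly_fac)
  moreover have Q0: "poly Q 0 \<noteq> 0"
    using d_pos by (fastforce simp: Q_def poly_prod poly_fac power_0_left)
  ultimately have E: "(\<Sum>k\<in>K. L k * (\<Prod>l\<in>K - {k}. q l)) * Q = M * (\<Prod>k\<in>K. q k)"
    using rational_identity_fps[where q = q and n = L and m = M, OF fin q0 Q0] by blast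
  have qz: "poly (q k) z \<noteq> 0" if "k \<in> K" for k
    using z(1)[OF that] by (auto simp: q_def poly_prod poly_fac)
  have Qz: "poly Q z \<noteq> 0"
    using z(2) by (auto simp: Q_def poly_prod poly_fac)
  have "(\<Sum>k\<in>K. poly (L k) z / poly (q k) z) = poly M z / poly Q z"
    using rational_identity_eval[where q = q and n = L and m = M, OF fin qz Qz] arg_cong[OF E, of "\<lambda>p. poly p z"]
    by blast
  then show ?thesis
    by (simp add: L_def q_def M_def Q_def poly_prod poly_fac poly_monom prod_dividef)
qed

end

subsection \<open>Fixed spaces\<close>

lemma frame_dim: "frame J b W \<Longrightarrow> fs.dim W = card J"
  unfolding frame_def
  using indep_family_imp_independent[of J b] range_lincomb_eq_span[of J b]
  by (simp add: fs.dim_eq_card_independent card_image)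

lemma prod_if_eq_power: "finite A \<Longrightarrow> (\<Prod>i\<in>A. if P i then c else 1) = c ^ card {i \<in> A. P i}"
  by (simp add: prod.inter_filter[symmetric])

lemma coordinates_exist:
  fixes scale :: "complex \<Rightarrow> 'v::ab_group_add \<Rightarrow> 'v"
  assumes "finite_dimensional_vector_space scale Basis"
    and "Vector_Spaces.vector_space.dim scale (UNIV :: 'v set) = r"
  obtains X e where "coordinate_space scale Basis r X e"
proof -
  interpret V: finite_dimensional_vector_space scale Basis by fact
  have "card Basis = r" using assms(2) by simp
  then obtain e where e: "bij_betw e {..<r} Basis"
    using ex_bij_betw_nat_finite[OF V.finite_Basis] by (auto simp: atLeast0LessThan)
  then have eB: "e i \<in> Basis" if "i < r" for i using bij_betwE that by blast
  have inj: "inj_on e {..<r}" and img: "e ` {..<r} = Basis" using e by (auto simp: bij_betw_def)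
  have span: "v \<in> V.span Basis" for v using V.span_Basis by simp
  have vs: "Vector_Spaces.vector_space ((*) :: complex \<Rightarrow> complex \<Rightarrow> complex)"
    by unfold_locales (auto simp: algebra_simps)
  show thesis
  proof (rule that[of "\<lambda>i v. V.representation Basis v (e i)" e],
      rule coordinate_space.intro[OF assms(1)], rule coordinate_space_axioms.intro)
    show "Vector_Spaces.linear scale (*) (\<lambda>v. V.representation Basis v (e i))" for i
      using V.representation_add[OF V.independent_Basis span span]
        V.representation_scale[OF V.independent_Basis span]
      by (auto simp: Vector_Spaces.linear_iff V.vector_space_axioms vs)
    show "V.representation Basis (e j) (e i) = (if i = j then 1 else 0)" if "i < r" "j < r" for i j
      using V.representation_basis[OF V.independent_Basis eB[OF that(2)]] inj that by (auto dest: inj_onD)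
    show "v = (\<Sum>i<r. scale (V.representation Basis v (e i)) (e i))" for v
      using V.sum_representation_eq[OF V.independent_Basis span V.finite_Basis subset_refl, of v]
      by (simp add: img[symmetric] sum.reindex[OF inj])
  qed
qed

lemma (in coordinate_space) fix_dim_eigen:
  assumes Y: "cobasis Y" "\<And>i v. i < r \<Longrightarrow> Y i (x v) = c i * Y i v"
  shows "fix_dim scale UNIV x = card {i \<in> {..<r}. c i = 1}"
proof -
  obtain f where f: "dual_basis Y f" using cobasis_dual[OF Y(1)] .
  let ?J = "{i \<in> {..<r}. c i = 1}"
  have Yf: "Y i (f j) = (if i = j then 1 else 0)" if "i < r" "j < r" for i j
    using f that by (simp add: dual_basis_def)
  have fixed: "v - x v = 0 \<longleftrightarrow> (\<forall>i<r. c i \<noteq> 1 \<longrightarrow> Y i v = 0)" for v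
  proof -
    have eq: "Y i (v - x v) = (1 - c i) * Y i v" if "i < r" for i
      using cobasis_linf[OF Y(1) that] Y(2)[OF that] by (simp add: linf_diff algebra_simps)
    have "v - x v = 0 \<longleftrightarrow> (\<forall>i<r. Y i (v - x v) = 0)"
    proof
      assume 0: "v - x v = 0"
      show "\<forall>i<r. Y i (v - x v) = 0"
        unfolding 0 using cobasis_linf[OF Y(1)] linf_zero by blast
    next
      assume "\<forall>i<r. Y i (v - x v) = 0"
      then show "v - x v = 0" using Y(1) unfolding cobasis_def by blast
    qed
    then show ?thesis by (auto simp: eq)
  qed
  have inj: "inj_on f ?J"
  proof (rule inj_onI)
    fix i j assume ij: "i \<in> ?J" "j \<in> ?J" "f i = f j"
    then show "i = j" using Yf[of i i] Yf[of i j] by (auto split: if_splits)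
  qed
  have ind: "independent (f ` ?J)"
  proof
    assume "dependent (f ` ?J)"
    then obtain u where u: "\<exists>v\<in>f ` ?J. u v \<noteq> 0" "(\<Sum>v\<in>f ` ?J. scale (u v) v) = 0"
      by (auto simp: dependent_finite)
    then obtain j where j: "j \<in> ?J" "u (f j) \<noteq> 0" by blast
    have "(\<Sum>i\<in>?J. scale (u (f i)) (f i)) = 0"
      using u(2) sum.reindex[OF inj, of "\<lambda>v. scale (u v) v"] by (simp only: comp_def)
    then have "0 = Y j (\<Sum>i\<in>?J. scale (u (f i)) (f i))"
      using j cobasis_linf[OF Y(1), of j] by (simp only: linf_zero) (simp add: linf_zero)
    also have "\<dots> = (\<Sum>i\<in>?J. u (f i) * Y j (f i))"
      using j cobasis_linf[OF Y(1), of j] by (simp add: linf_sum linf_scale)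
    also have "\<dots> = (\<Sum>i\<in>?J. if i = j then u (f i) else 0)"
      using j by (intro sum.cong) (auto simp: Yf)
    also have "\<dots> = u (f j)" using j by simp
    finally show False using j by simp
  qed
  have "{v \<in> UNIV. v - x v = 0} = span (f ` ?J)"
  proof (intro subset_antisym subsetI)
    fix v assume "v \<in> {v \<in> UNIV. v - x v = 0}"
    then have v: "\<forall>i<r. c i \<noteq> 1 \<longrightarrow> Y i v = 0" using fixed by blast
    have "(\<Sum>i<r. scale (Y i v) (f i)) \<in> span (f ` ?J)"
    proof (rule span_sum)
      fix i assume i: "i \<in> {..<r}"
      show "scale (Y i v) (f i) \<in> span (f ` ?J)"
      proof (cases "c i = 1")
        case True
        then show ?thesis using i by (intro span_scale span_base imageI) simp
      next
        case False
        then show ?thesis using v i span_zero by simp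
      qed
    qed
    moreover have "v = (\<Sum>i<r. scale (Y i v) (f i))" using f unfolding dual_basis_def by blast
    ultimately show "v \<in> span (f ` ?J)" by (rule ssubst[rotated])
  next
    fix v assume "v \<in> span (f ` ?J)"
    then have "\<forall>i<r. c i \<noteq> 1 \<longrightarrow> Y i v = 0"
    proof (induction rule: span_induct_alt)
      case base
      then show ?case using cobasis_linf[OF Y(1)] by (simp add: linf_zero)
    next
      case (step a y z)
      then obtain j where j: "j < r" "c j = 1" "y = f j" by blast
      show ?case
      proof (intro allI impI)
        fix i assume i: "i < r" "c i \<noteq> 1"
        with j have "i \<noteq> j" by blast
        with step i j show "Y i (scale a y + z) = 0"
          using cobasis_linf[OF Y(1), of i] by (simp add: linf_add linf_scale Yf)
      qed
    qed
    then show "v \<in> {v \<in> UNIV. v - x v = 0}" using fixed by blast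
  qed
  then have "fix_dim scale UNIV x = dim (span (f ` ?J))" by (simp add: fix_dim_def)
  also have "\<dots> = card ?J" using ind inj by (simp add: dim_eq_card_independent card_image)
  finally show ?thesis .
qed

text \<open>The inverses in \<open>dual_act\<close> and \<open>fun_act\<close> cancel, so a
  functional is composed with \<open>f \<mapsto> f \<circ> x\<close> and the basis dual to
  \<open>F'\<close> has the same eigenvalues. Stability is an equivalence because functionals vanish
  off \<open>E\<close>: composition with \<open>x\<close> must not bring an outside function into
  \<open>E\<close>.\<close>

lemma fix_dim_dual_eigen:
  fixes F' :: "nat \<Rightarrow> 'v \<Rightarrow> complex" and x :: "'v \<Rightarrow> 'v"
  assumes F': "frame {..<r} F' E" and x: "bij x"
    and stable: "\<And>f. f \<in> E \<longleftrightarrow> (\<lambda>v. f (x v)) \<in> E"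
    and eig: "\<And>i. i < r \<Longrightarrow> (\<lambda>v. F' i (x v)) = (\<lambda>v. c i * F' i v)"
  shows "fix_dim fscale (fun_dual E) (dual_act x) = card {i \<in> {..<r}. c i = 1}"
proof -
  let ?J = "{i \<in> {..<r}. c i = 1}"
  have act: "dual_act x \<phi> f = \<phi> (\<lambda>v. f (x v))" for \<phi> :: "('v \<Rightarrow> complex) \<Rightarrow> complex" and f
    using x by (simp add: dual_act_def fun_act_def inv_inv_eq)
  have ind: "indep_family {..<r} F'" and E: "E = range (lincomb {..<r} F')"
    using F' by (auto simp: frame_def)
  have linE: "\<phi> (lincomb {..<r} F' a) = (\<Sum>i<r. a i * \<phi> (F' i))" if \<phi>: "\<phi> \<in> fun_dual E" for \<phi> a
  proof -
    have Ei: "fscale (a i) (F' i) \<in> E" if "i < r" for i a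
    proof -
      have "fscale (a i) (F' i) = lincomb {..<r} F' (\<lambda>j. if j = i then a i else 0)"
        using that by (auto simp: lincomb_def fscale_def fun_eq_iff if_distrib[where f = "\<lambda>x. x * _"] cong: if_cong)
      then show ?thesis by (simp add: E)
    qed
    have sub: "fs.subspace E" unfolding E range_lincomb_eq_span[OF finite_lessThan] by (rule fs.subspace_span)
    have "\<phi> (\<Sum>i<n. fscale (a i) (F' i)) = (\<Sum>i<n. a i * \<phi> (F' i))" if "n \<le> r" for n
      using that
    proof (induction n)
      case 0
      have "0 \<in> E" using sub by (rule fs.subspace_0)
      then have "\<phi> (fscale 0 0) = 0 * \<phi> 0" using \<phi> unfolding fun_dual_def by blast
      then show ?case by (simp add: fscale_def zero_fun_def)
    next
      case (Suc n)
      have 1: "(\<Sum>i<n. fscale (a i) (F' i)) \<in> E"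
        using Suc.prems Ei by (intro fs.subspace_sum[OF sub]) simp
      have 2: "fscale (a n) (F' n) \<in> E" using Ei Suc.prems by simp
      have 3: "\<phi> ((\<Sum>i<n. fscale (a i) (F' i)) + fscale (a n) (F' n)) =
          \<phi> (\<Sum>i<n. fscale (a i) (F' i)) + \<phi> (fscale (a n) (F' n))"
        using \<phi> 1 2 unfolding fun_dual_def by blast
      have 4: "\<phi> (fscale (a n) (F' n)) = a n * \<phi> (F' n)"
        using \<phi> frame_elem[OF F', of n] Suc.prems unfolding fun_dual_def by simp
      have 5: "\<phi> (\<Sum>i<n. fscale (a i) (F' i)) = (\<Sum>i<n. a i * \<phi> (F' i))" using Suc by simp
      show ?case unfolding sum.lessThan_Suc 3 4 5 ..
    qed
    from this[of r] show ?thesis by (simp add: lincomb_eq_sum)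
  qed
  define co where "co f = (SOME a. f = lincomb {..<r} F' a)" for f
  have co: "f = lincomb {..<r} F' (co f)" if "f \<in> E" for f
  proof -
    from that E obtain a where "f = lincomb {..<r} F' a" by blast
    then show ?thesis unfolding co_def by (rule someI[of "\<lambda>a. f = lincomb {..<r} F' a"])
  qed
  have co_eq: "co (lincomb {..<r} F' a) i = a i" if "i < r" for a i
  proof -
    have "lincomb {..<r} F' (co (lincomb {..<r} F' a)) = lincomb {..<r} F' a"
      using co[of "lincomb {..<r} F' a"] E by simp
    from indep_family_coeff_eq[OF ind this] that show ?thesis by simp
  qed
  \<comment> \<open>The coefficient functionals of the eigenbasis, extended by 0 as
    \<open>fun_dual\<close> requires.\<close>
  define \<psi> where "\<psi> i f = (if f \<in> E then co f i else 0)" for i f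
  have \<psi>F: "\<psi> i (F' j) = (if i = j then 1 else 0)" if "i < r" "j < r" for i j
  proof -
    have Fj: "F' j = lincomb {..<r} F' (\<lambda>k. if k = j then 1 else 0)"
      using that by (auto simp: lincomb_def fun_eq_iff if_distrib[where f = "\<lambda>x. x * _"] cong: if_cong)
    have "co (F' j) i = (if i = j then 1 else 0)" by (subst Fj) (rule co_eq[OF that(1)])
    then show ?thesis using frame_elem[OF F', of j] that by (simp add: \<psi>_def)
  qed
  have \<psi>: "\<psi> i \<in> fun_dual E" if i: "i < r" for i
  proof -
    have add: "\<psi> i (f + h) = \<psi> i f + \<psi> i h" if "f \<in> E" "h \<in> E" for f h
    proof -
      have "f + h = lincomb {..<r} F' (\<lambda>i. co f i + co h i)"
      proof
        fix v
        show "(f + h) v = lincomb {..<r} F' (\<lambda>i. co f i + co h i) v"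
          using fun_cong[OF co[OF that(1)], of v] fun_cong[OF co[OF that(2)], of v]
          by (simp add: lincomb_def algebra_simps sum.distrib)
      qed
      then have "f + h \<in> E" "co (f + h) i = co f i + co h i"
        using co_eq[OF i, of "\<lambda>i. co f i + co h i"] E by simp_all
      then show ?thesis using that by (simp add: \<psi>_def)
    qed
    have sc: "\<psi> i (fscale a f) = a * \<psi> i f" if "f \<in> E" for a f
    proof -
      have "fscale a f = lincomb {..<r} F' (\<lambda>i. a * co f i)"
      proof
        fix v
        show "fscale a f v = lincomb {..<r} F' (\<lambda>i. a * co f i) v"
          using fun_cong[OF co[OF that], of v]
          by (simp add: lincomb_def fscale_def sum_distrib_left mult_ac)
      qed
      then have "fscale a f \<in> E" "co (fscale a f) i = a * co f i"
        using co_eq[OF i, of "\<lambda>i. a * co f i"] E by simp_all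
      then show ?thesis using that by (simp add: \<psi>_def)
    qed
    show ?thesis unfolding fun_dual_def using add sc by (simp add: \<psi>_def)
  qed
  have "frame ?J \<psi> {\<phi> \<in> fun_dual E. \<phi> - dual_act x \<phi> = 0}"
    unfolding frame_def
  proof (intro conjI)
    show "finite ?J" by simp
    show "indep_family ?J \<psi>"
      unfolding indep_family_def
    proof (intro allI impI)
      fix a assume a: "lincomb ?J \<psi> a = 0"
      show "\<forall>j\<in>?J. a j = 0"
      proof
        fix j assume j: "j \<in> ?J"
        have "0 = lincomb ?J \<psi> a (F' j)" using a by simp
        also have "\<dots> = (\<Sum>i\<in>?J. if i = j then a i else 0)"
          unfolding lincomb_def using j by (intro sum.cong) (auto simp: \<psi>F)
        finally show "a j = 0" using j by simp
      qed
    qed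
    have dualx: "\<phi> (\<lambda>v. lincomb {..<r} F' a (x v)) = (\<Sum>i<r. a i * c i * \<phi> (F' i))" if "\<phi> \<in> fun_dual E" for \<phi> a
    proof -
      have "(\<lambda>v. lincomb {..<r} F' a (x v)) = lincomb {..<r} F' (\<lambda>i. a i * c i)"
        using fun_cong[OF eig] by (simp add: lincomb_def mult_ac)
      then show ?thesis using linE[OF that] by simp
    qed
    show "{\<phi> \<in> fun_dual E. \<phi> - dual_act x \<phi> = 0} = range (lincomb ?J \<psi>)"
    proof (intro subset_antisym subsetI)
      fix \<phi> assume "\<phi> \<in> {\<phi> \<in> fun_dual E. \<phi> - dual_act x \<phi> = 0}"
      then have \<phi>: "\<phi> \<in> fun_dual E" "\<And>f. \<phi> f = \<phi> (\<lambda>v. f (x v))"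
        by (auto simp: fun_eq_iff act)
      have z: "\<phi> (F' i) = 0" if "i < r" "c i \<noteq> 1" for i
      proof -
        have "\<phi> (\<lambda>v. c i * F' i v) = c i * \<phi> (F' i)"
          using \<phi>(1) frame_elem[OF F', of i] that unfolding fun_dual_def fscale_def by simp
        then have "\<phi> (F' i) = c i * \<phi> (F' i)" using \<phi>(2)[of "F' i"] eig[OF that(1)] by simp
        with that show ?thesis by (metis mult_cancel_right1)
      qed
      have "\<phi> f = lincomb ?J \<psi> (\<lambda>i. \<phi> (F' i)) f" for f
      proof (cases "f \<in> E")
        case True
        have "\<phi> f = (\<Sum>i<r. co f i * \<phi> (F' i))" using linE[OF \<phi>(1), of "co f"] by (simp only: co[OF True, symmetric])
        also have "\<dots> = (\<Sum>i\<in>?J. co f i * \<phi> (F' i))"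
          using z by (intro sum.mono_neutral_right) auto
        finally show ?thesis using True by (simp add: lincomb_def \<psi>_def mult.commute)
      next
        case False
        then show ?thesis using \<phi>(1) by (simp add: lincomb_def \<psi>_def fun_dual_def)
      qed
      then have "\<phi> = lincomb ?J \<psi> (\<lambda>i. \<phi> (F' i))" by (intro ext)
      then show "\<phi> \<in> range (lincomb ?J \<psi>)" by (rule image_eqI[where x = "\<lambda>i. \<phi> (F' i)"]) simp
    next
      fix \<phi> assume "\<phi> \<in> range (lincomb ?J \<psi>)"
      then obtain a where a: "\<phi> = lincomb ?J \<psi> a" by blast
      have "\<phi> \<in> fun_dual E"
        using \<psi> unfolding fun_dual_def a lincomb_def
        by (auto simp: sum.distrib distrib_left sum_distrib_left mult_ac intro!: sum.cong)
      moreover have "\<phi> f = \<phi> (\<lambda>v. f (x v))" for f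
      proof (cases "f \<in> E")
        case True
        have F: "\<phi> (F' i) = c i * \<phi> (F' i)" if "i < r" for i
        proof (cases "c i = 1")
          case False
          have "\<phi> (F' i) = 0" unfolding a lincomb_def
            by (rule sum.neutral) (use False that \<psi>F in auto)
          then show ?thesis by simp
        qed simp
        have "\<phi> f = (\<Sum>i<r. co f i * \<phi> (F' i))" using linE[OF \<open>\<phi> \<in> fun_dual E\<close>, of "co f"] by (simp only: co[OF True, symmetric])
        also have "\<dots> = (\<Sum>i<r. co f i * c i * \<phi> (F' i))"
          using F by (intro sum.cong) (auto simp: mult.assoc)
        also have "\<dots> = \<phi> (\<lambda>v. f (x v))" using dualx[OF \<open>\<phi> \<in> fun_dual E\<close>, of "co f"] by (simp only: co[OF True, symmetric])
        finally show ?thesis .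
      next
        case False
        then have "(\<lambda>v. f (x v)) \<notin> E" using stable by simp
        with False show ?thesis using \<open>\<phi> \<in> fun_dual E\<close> by (simp add: fun_dual_def)
      qed
      ultimately show "\<phi> \<in> {\<phi> \<in> fun_dual E. \<phi> - dual_act x \<phi> = 0}" by (auto simp: fun_eq_iff act)
    qed
  qed
  from frame_dim[OF this] show ?thesis by (simp add: fix_dim_def)
qed

subsection \<open>Transport of polynomial identities\<close>

text \<open>
  A polynomial in \<open>pairing N X\<close> is a polynomial in \<open>N\<close> together with the same polynomial in \<open>X\<close>.
\<close>

definition pairing :: "(nat \<Rightarrow> 'a \<Rightarrow> complex) \<Rightarrow> (nat \<Rightarrow> 'b \<Rightarrow> complex) \<Rightarrow> nat \<Rightarrow> 'a + 'b \<Rightarrow> complex" where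
  "pairing N X i = case_sum (N i) (X i)"

lemma pairing_simps [simp]: "pairing N X i (Inl a) = N i a" "pairing N X i (Inr b) = X i b"
  by (simp_all add: pairing_def)

lemma polyalg_diff: "f \<in> polyalg r F \<Longrightarrow> g \<in> polyalg r F \<Longrightarrow> (\<lambda>v. f v - g v) \<in> polyalg r F"
  using polyalg_add[of f r F "\<lambda>v. - 1 * g v"] polyalg_scale[of g r F "-1"] by simp

text \<open>Independence of \<open>N\<close> makes all coefficients of \<open>f - g\<close>, written
  in the monomials of the pairing, vanish; so the difference is 0 on the right summand as
  well.\<close>

lemma transport_left_right:
  assumes "algind r N" "f \<in> polyalg r (pairing N X)" "g \<in> polyalg r (pairing N X)" "\<And>a. f (Inl a) = g (Inl a)"
  shows "f (Inr b) = g (Inr b)"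
proof -
  obtain A c where A: "finite A" "A \<subseteq> expos r" "(\<lambda>v. f v - g v) = lincomb A (pmono r (pairing N X)) c"
    using polyalg_diff[OF assms(2,3)] by (auto simp: polyalg_explicit)
  have "indep_family A (pmono r N)" using assms(1) A by (simp add: algind_def)
  moreover have "lincomb A (pmono r N) c = 0"
  proof
    fix a
    have "lincomb A (pmono r N) c a = f (Inl a) - g (Inl a)"
      using fun_cong[OF A(3), of "Inl a"] by (simp add: lincomb_def pmono_def)
    then show "lincomb A (pmono r N) c a = 0 a" using assms(4) by simp
  qed
  ultimately have "\<forall>\<alpha>\<in>A. c \<alpha> = 0" by (simp add: indep_family_def)
  then have "f (Inr b) - g (Inr b) = 0" using fun_cong[OF A(3), of "Inr b"] by (simp add: lincomb_def)
  then show ?thesis by simp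
qed

lemma transport_right_left:
  assumes "algind r X" "f \<in> polyalg r (pairing N X)" "g \<in> polyalg r (pairing N X)" "\<And>b. f (Inr b) = g (Inr b)"
  shows "f (Inl a) = g (Inl a)"
proof -
  obtain A c where A: "finite A" "A \<subseteq> expos r" "(\<lambda>v. f v - g v) = lincomb A (pmono r (pairing N X)) c"
    using polyalg_diff[OF assms(2,3)] by (auto simp: polyalg_explicit)
  have "indep_family A (pmono r X)" using assms(1) A by (simp add: algind_def)
  moreover have "lincomb A (pmono r X) c = 0"
  proof
    fix b
    have "lincomb A (pmono r X) c b = f (Inr b) - g (Inr b)"
      using fun_cong[OF A(3), of "Inr b"] by (simp add: lincomb_def pmono_def)
    then show "lincomb A (pmono r X) c b = 0 b" using assms(4) by simp
  qed
  ultimately have "\<forall>\<alpha>\<in>A. c \<alpha> = 0" by (simp add: indep_family_def)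
  then have "f (Inl a) - g (Inl a) = 0" using fun_cong[OF A(3), of "Inl a"] by (simp add: lincomb_def)
  then show ?thesis by simp
qed

text \<open>The outer variable is \<open>t\<close> and the coefficients are polynomials in
  \<open>q\<close>. Over the domain \<open>complex poly\<close> a nonzero polynomial has finitely
  many roots, yet all constants \<open>[:t:]\<close> would be roots of the difference.\<close>

lemma bivariate_poly_eqI:
  fixes p p' :: "complex poly poly"
  assumes "\<And>q t. poly (poly p [:t:]) q = poly (poly p' [:t:]) q"
  shows "p = p'"
proof (rule ccontr)
  assume "p \<noteq> p'"
  then have "finite {x. poly (p - p') x = 0}" by (intro poly_roots_finite) simp
  moreover have "range (\<lambda>t. [:t:]) \<subseteq> {x. poly (p - p') x = 0}"
    using assms by (auto simp: poly_eq_poly_eq_iff[symmetric] fun_eq_iff)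
  moreover have "infinite (range (\<lambda>t :: complex. [:t:]))"
    by (simp add: finite_image_iff inj_on_def infinite_UNIV_char_0)
  ultimately show False using finite_subset by blast
qed

subsection \<open>The quotient by a normal reflection subgroup\<close>

lemma algind_indep:
  assumes "algind r F"
  shows "indep_family {..<r} F"
  unfolding indep_family_def
proof (intro allI impI)
  fix a assume a: "lincomb {..<r} F a = 0"
  let ?u = "\<lambda>i. (\<lambda>_. 0 :: nat)(i := 1)"
  have inj: "inj_on ?u {..<r}"
  proof (rule inj_onI)
    fix i j assume "?u i = ?u j"
    from fun_cong[OF this, of i] show "i = j" by (auto split: if_splits)
  qed
  have ind: "indep_family (?u ` {..<r}) (pmono r F)"
  proof -
    have "?u ` {..<r} \<subseteq> expos r" by (auto simp: expos_def)
    then show ?thesis using assms unfolding algind_def by blast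
  qed
  have "lincomb (?u ` {..<r}) (pmono r F) (\<lambda>\<alpha>. a (inv_into {..<r} ?u \<alpha>)) v = 0" for v
  proof -
    have "lincomb (?u ` {..<r}) (pmono r F) (\<lambda>\<alpha>. a (inv_into {..<r} ?u \<alpha>)) v =
        (\<Sum>i<r. a (inv_into {..<r} ?u (?u i)) * pmono r F (?u i) v)"
      unfolding lincomb_def by (subst sum.reindex[OF inj]) (simp only: comp_def)
    also have "\<dots> = (\<Sum>i<r. a i * F i v)"
      by (rule sum.cong[OF refl]) (simp only: inv_into_f_f[OF inj] pmono_unit lessThan_iff)
    also have "\<dots> = 0" using fun_cong[OF a, of v] by (simp add: lincomb_def)
    finally show ?thesis .
  qed
  then have "lincomb (?u ` {..<r}) (pmono r F) (\<lambda>\<alpha>. a (inv_into {..<r} ?u \<alpha>)) = 0" by auto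
  moreover have "lincomb (?u ` {..<r}) (pmono r F) (\<lambda>\<alpha>. a (inv_into {..<r} ?u \<alpha>)) = 0 \<longrightarrow>
      (\<forall>\<alpha>\<in>?u ` {..<r}. a (inv_into {..<r} ?u \<alpha>) = 0)"
    using ind unfolding indep_family_def by (rule spec)
  ultimately have z: "\<forall>\<alpha>\<in>?u ` {..<r}. a (inv_into {..<r} ?u \<alpha>) = 0" by (rule mp[rotated])
  show "\<forall>j\<in>{..<r}. a j = 0"
  proof
    fix j assume j: "j \<in> {..<r}"
    from bspec[OF z imageI[OF j]] show "a j = 0" by (simp only: inv_into_f_f[OF inj j])
  qed
qed

text \<open>Both sides are continued to \<open>z = 1\<close> factor by factor. A factor on the left
  is the case \<open>d = 1\<close> of \<open>factor_limit\<close>, which leaves \<open>a k i\<close>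
  at eigenvalue 1 and drops all other eigenvalues.\<close>

lemma limit_identity:
  fixes a lam :: "'k \<Rightarrow> nat \<Rightarrow> complex"
  assumes d: "\<And>i. i < r \<Longrightarrow> d i \<ge> 1"
    and id: "\<And>z :: real. 0 < z \<Longrightarrow> z < 1 \<Longrightarrow>
      (\<Sum>k\<in>K. \<Prod>i<r. (1 + (a k i * (1 - of_real z) - 1) * lam k i) / (1 - lam k i * of_real z)) =
      C * (\<Prod>i<r. (1 + (b i * (1 - of_real z) - 1) * c i * of_real z ^ (d i - 1)) / (1 - c i * of_real z ^ d i))"
  shows "(\<Sum>k\<in>K. \<Prod>i<r. if lam k i = 1 then a k i else 1) =
    C * (\<Prod>i<r. if c i = 1 then (b i + of_nat (d i) - 1) / of_nat (d i) else 1)"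
proof -
  let ?l = "\<lambda>z. \<Sum>k\<in>K. \<Prod>i<r. (1 + (a k i * (1 - complex_of_real z) - 1) * lam k i) / (1 - lam k i * of_real z)"
  let ?r = "\<lambda>z. C * (\<Prod>i<r. (1 + (b i * (1 - complex_of_real z) - 1) * c i * of_real z ^ (d i - 1)) / (1 - c i * of_real z ^ d i))"
  have "((\<lambda>z. (1 + (y * (1 - complex_of_real z) - 1) * x) / (1 - x * of_real z)) \<longlongrightarrow> (if x = 1 then y else 1)) (at_left 1)"
    for x y :: complex
    using factor_limit[of 1 y x]
    by (simp only: diff_self_eq_0 power_0 power_one_right mult_1_right of_nat_1 div_by_1
        add_diff_cancel_right' order_refl simp_thms)
  then have l: "(?l \<longlongrightarrow> (\<Sum>k\<in>K. \<Prod>i<r. if lam k i = 1 then a k i else 1)) (at_left 1)"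
    by (intro tendsto_sum tendsto_prod)
  have r: "(?r \<longlongrightarrow> C * (\<Prod>i<r. if c i = 1 then (b i + of_nat (d i) - 1) / of_nat (d i) else 1)) (at_left 1)"
    by (intro tendsto_mult tendsto_prod tendsto_const factor_limit d) simp
  have "\<forall>\<^sub>F z in at_left (1 :: real). ?r z = ?l z"
    using eventually_at_left_real[of 0 1, simplified]
    by (rule eventually_mono) (use id in auto)
  then have "(?l \<longlongrightarrow> C * (\<Prod>i<r. if c i = 1 then (b i + of_nat (d i) - 1) / of_nat (d i) else 1)) (at_left 1)"
    by (rule Lim_transform_eventually[OF r])
  then show ?thesis using l by (intro tendsto_unique[OF trivial_limit_at_left_real])
qed

lemma invariant_iff:
  assumes "\<And>g. g \<in> K \<Longrightarrow> bij g" "\<And>g. g \<in> K \<Longrightarrow> inv_into UNIV g \<in> K"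
  shows "f \<in> invariants K A \<longleftrightarrow> f \<in> A \<and> (\<forall>g\<in>K. \<forall>v. f (g v) = f v)"
proof -
  have "(\<forall>g\<in>K. fun_act g f = f) \<longleftrightarrow> (\<forall>g\<in>K. \<forall>v. f (g v) = f v)"
  proof
    assume l: "\<forall>g\<in>K. fun_act g f = f"
    show "\<forall>g\<in>K. \<forall>v. f (g v) = f v"
    proof (intro ballI allI)
      fix g v assume g: "g \<in> K"
      with l have "fun_act g f (g v) = f (g v)" by simp
      then show "f (g v) = f v" using bij_is_inj[OF assms(1)[OF g]] by (simp add: fun_act_def inv_f_f)
    qed
  next
    assume "\<forall>g\<in>K. \<forall>v. f (g v) = f v"
    then show "\<forall>g\<in>K. fun_act g f = f" using assms(2) by (auto simp: fun_act_def)
  qed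
  then show ?thesis by (simp add: invariants_def)
qed

section \<open>Finite subgroups of the general linear group\<close>

context coordinate_space
begin

lemma X_eqI: "(\<And>i. i < r \<Longrightarrow> X i x = X i y) \<Longrightarrow> x = y"
proof -
  assume "\<And>i. i < r \<Longrightarrow> X i x = X i y"
  then have "\<forall>i<r. X i (x - y) = 0" using X_linear by (simp add: linf_diff)
  with cobasis_X have "x - y = 0" unfolding cobasis_def by blast
  then show ?thesis by simp
qed

lemma dual_basis_X: "dual_basis X e"
  unfolding dual_basis_def by (intro conjI allI impI) (rule X_e, assumption+, rule X_expand)

lemma group_GL: "group (GL scale)"
proof (rule groupI)
  show "\<one>\<^bsub>GL scale\<^esub> \<in> carrier (GL scale)" by (simp add: GL_def linm_iff)
  show "\<exists>y\<in>carrier (GL scale). y \<otimes>\<^bsub>GL scale\<^esub> x = \<one>\<^bsub>GL scale\<^esub>" if "x \<in> carrier (GL scale)" for x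
  proof
    have x: "linm x" "bij x" using that by (auto simp: GL_def)
    have r: "x (inv_into UNIV x v) = v" for v using x(2) by (simp add: bij_is_surj surj_f_inv_f)
    have l: "inv_into UNIV x (x v) = v" for v using x(2) by (simp add: bij_is_inj)
    have "inv_into UNIV x (v + w) = inv_into UNIV x v + inv_into UNIV x w" for v w
      using l[of "inv_into UNIV x v + inv_into UNIV x w"] by (simp add: linm_add[OF x(1)] r)
    moreover have "inv_into UNIV x (scale c v) = scale c (inv_into UNIV x v)" for c v
      using l[of "scale c (inv_into UNIV x v)"] by (simp add: linm_scale[OF x(1)] r)
    ultimately have "linm (inv_into UNIV x)" by (simp add: linm_iff)
    then show "inv_into UNIV x \<in> carrier (GL scale)" using x by (simp add: GL_def bij_imp_bij_inv)
    show "inv_into UNIV x \<otimes>\<^bsub>GL scale\<^esub> x = \<one>\<^bsub>GL scale\<^esub>" by (auto simp: GL_def fun_eq_iff l)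
  qed
qed (auto simp: GL_def linm_iff bij_comp comp_assoc)

lemma subgroup_GL:
  assumes "subgroup H (GL scale)"
  shows "group ((GL scale)\<lparr>carrier := H\<rparr>)"
    and "\<And>g. g \<in> H \<Longrightarrow> linm g" "\<And>g. g \<in> H \<Longrightarrow> bij g"
    and "id \<in> H" "\<And>g h. g \<in> H \<Longrightarrow> h \<in> H \<Longrightarrow> g \<circ> h \<in> H"
    and "\<And>g. g \<in> H \<Longrightarrow> inv_into UNIV g \<in> H"
proof -
  interpret GL: group "GL scale" by (rule group_GL)
  show "group ((GL scale)\<lparr>carrier := H\<rparr>)" using assms group_GL by (rule subgroup.subgroup_is_group)
  show lin: "linm g" and bij: "bij g" if "g \<in> H" for g
    using subgroup.subset[OF assms] that by (auto simp: GL_def)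
  show "id \<in> H" using subgroup.one_closed[OF assms] by (simp add: GL_def)
  show "g \<circ> h \<in> H" if "g \<in> H" "h \<in> H" for g h
    using subgroup.m_closed[OF assms that] by (simp add: GL_def)
  show "inv_into UNIV g \<in> H" if "g \<in> H" for g
  proof -
    let ?y = "inv\<^bsub>GL scale\<^esub> g"
    have "g \<in> carrier (GL scale)" using subgroup.subset[OF assms] that by blast
    then have "?y \<circ> g = id" using GL.l_inv[of g] by (simp add: GL_def)
    then have "?y (g v) = v" for v by (metis comp_apply id_apply)
    then have "?y = inv_into UNIV g" using bij[OF that] by (metis bij_inv_eq_iff ext)
    then show ?thesis using subgroup.m_inv_closed[OF assms that] by simp
  qed
qed

lemma subgroup_GL_power:
  assumes "subgroup H (GL scale)" "finite H" "g \<in> H"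
  shows "g ^^ card H = id"
proof -
  interpret H: group "(GL scale)\<lparr>carrier := H\<rparr>" by (rule subgroup_GL(1)[OF assms(1)])
  have "g [^]\<^bsub>(GL scale)\<lparr>carrier := H\<rparr>\<^esub> n = g ^^ n" for n :: nat
    by (induction n) (simp_all add: funpow_Suc_right GL_def del: funpow.simps(2))
  moreover have "g [^]\<^bsub>(GL scale)\<lparr>carrier := H\<rparr>\<^esub> order ((GL scale)\<lparr>carrier := H\<rparr>) = id"
    using H.pow_order_eq_1[of g] assms(3) by (simp add: GL_def)
  ultimately show ?thesis by (simp add: order_def)
qed

end

section \<open>The groups \<open>G\<close> and \<open>N\<close>, the space \<open>E\<close>, and
  sums over cosets of \<open>N\<close>\<close>

locale normal_pair = coordinate_space scale Basis r X e
  for scale :: "complex \<Rightarrow> 'v::ab_group_add \<Rightarrow> 'v" and Basis r X e +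
  fixes G N :: "('v \<Rightarrow> 'v) set" and Ninv :: "nat \<Rightarrow> 'v \<Rightarrow> complex" and Hpoly :: "nat \<Rightarrow> mpoly"
    and degN dN dH dG :: "nat \<Rightarrow> nat"
  assumes G: "complex_reflection_group scale G"
    and N: "normal_reflection_subgroup scale N G"
    and Ninv: "fundamental_invariants scale N r Ninv degN"
    and E_stable: "\<forall>g\<in>G. \<forall>f\<in>E_dual r Ninv. fun_act g f \<in> E_dual r Ninv"
    and Hpoly: "\<forall>i<r. Hpoly i \<in> mpolys r \<and> mpoly_homogeneous r (Hpoly i) (dH i)"
    and Hinv: "fundamental_invariants scale G r (\<lambda>i. mpoly_subst r (Hpoly i) Ninv) dG"
    and dN: "\<forall>i<r. \<forall>j<r. occurs_in j (Hpoly i) \<longrightarrow> degN j = dN i"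
begin

abbreviation "E \<equiv> E_dual r Ninv"
abbreviation "Z \<equiv> pairing Ninv X"

lemma finG: "finite G" and subG: "subgroup G (GL scale)"
  using G by (auto simp: complex_reflection_group_def)

lemma subN: "subgroup N (GL scale)" and NG: "N \<subseteq> G" and finN: "finite N"
proof -
  have s: "subgroup N ((GL scale)\<lparr>carrier := G\<rparr>)"
    using N by (auto simp: normal_reflection_subgroup_def normal_def)
  then show NG: "N \<subseteq> G" using subgroup.subset by fastforce
  then show "finite N" using finG finite_subset by blast
  show "subgroup N (GL scale)"
    using group.incl_subgroup[OF group_GL subG s] .
qed

lemmas G_facts = subgroup_GL[OF subG]
lemmas N_facts = subgroup_GL[OF subN]

lemma N_algind: "algind r Ninv"
  using Ninv by (auto simp: fundamental_invariants_def intro: alg_independent_imp_algind)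

lemma H_algind: "algind r (\<lambda>i. mpoly_subst r (Hpoly i) Ninv)"
  using Hinv by (auto simp: fundamental_invariants_def intro: alg_independent_imp_algind)

lemma frame_N: "frame {..<r} Ninv E"
  unfolding E_dual_def by (rule frame_span[OF finite_lessThan algind_indep[OF N_algind]])

lemma Ninv_sym: "i < r \<Longrightarrow> Ninv i \<in> S (degN i)"
  and Ninv_inv: "i < r \<Longrightarrow> x \<in> N \<Longrightarrow> Ninv i (x v) = Ninv i v"
  using Ninv invariant_iff[OF N_facts(3,6)] by (auto simp: fundamental_invariants_def)

lemma N_gen: "f \<in> sym_alg scale \<Longrightarrow> (\<And>x v. x \<in> N \<Longrightarrow> f (x v) = f v) \<Longrightarrow> f \<in> polyalg r Ninv"
  using Ninv invariant_iff[OF N_facts(3,6), where A = "sym_alg scale" and f = f]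
  by (simp add: fundamental_invariants_def mpoly_subst_image)

lemma polyalg_N: "f \<in> polyalg r Ninv \<Longrightarrow> f \<in> sym_alg scale"
  using Ninv by (auto simp: fundamental_invariants_def mpoly_subst_image[symmetric] invariants_def)

lemma H_inv: "i < r \<Longrightarrow> g \<in> G \<Longrightarrow> mpoly_subst r (Hpoly i) Ninv (g v) = mpoly_subst r (Hpoly i) Ninv v"
  using Hinv invariant_iff[OF G_facts(3,6)] by (auto simp: fundamental_invariants_def)

lemma H_gen: "f \<in> sym_alg scale \<Longrightarrow> (\<And>g v. g \<in> G \<Longrightarrow> f (g v) = f v) \<Longrightarrow>
    f \<in> polyalg r (\<lambda>i. mpoly_subst r (Hpoly i) Ninv)"
  using Hinv invariant_iff[OF G_facts(3,6), where A = "sym_alg scale" and f = f]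
  by (simp add: fundamental_invariants_def mpoly_subst_image)

lemma E_comp: "g \<in> G \<Longrightarrow> f \<in> E \<Longrightarrow> (\<lambda>v. f (g v)) \<in> E"
proof -
  assume g: "g \<in> G" and f: "f \<in> E"
  have "fun_act (inv_into UNIV g) f \<in> E" using E_stable G_facts(6)[OF g] f by blast
  then show ?thesis using G_facts(3)[OF g] by (simp add: fun_act_def inv_inv_eq)
qed

lemma E_comp_iff: "g \<in> G \<Longrightarrow> f \<in> E \<longleftrightarrow> (\<lambda>v. f (g v)) \<in> E"
proof
  assume g: "g \<in> G" and f: "(\<lambda>v. f (g v)) \<in> E"
  have "(\<lambda>v. f (g (inv_into UNIV g v))) \<in> E" using E_comp[OF G_facts(6)[OF g] f] .
  then show "f \<in> E" using G_facts(3)[OF g] by (simp add: bij_is_surj surj_f_inv_f)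
qed (rule E_comp)

lemma E_inv: "f \<in> E \<Longrightarrow> x \<in> N \<Longrightarrow> f (x v) = f v"
  using frame_N Ninv_inv by (auto simp: frame_def lincomb_def)

text \<open>\<open>g\<close> permutes neither the \<open>N_i\<close> nor their lines, but it
  preserves degrees in \<open>E\<close>; so it has an eigenbasis of homogeneous elements, which
  replaces the \<open>N_i\<close>.\<close>

lemma eigen_data:
  assumes "g \<in> G"
  obtains F' c d' where "frame {..<r} F' E" "\<And>i. i < r \<Longrightarrow> F' i \<in> S (d' i)"
    "\<And>i. i < r \<Longrightarrow> (\<lambda>v. F' i (g v)) = (\<lambda>v. c i * F' i v)" "\<And>i. i < r \<Longrightarrow> c i ^ card G = 1"
proof -
  have "card G > 0" using finG assms card_gt_0_iff by blast
  then show thesis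
  proof (rule eigen_frame[OF _ subgroup_GL_power[OF subG finG assms] frame_N, where P = S and d = degN])
    show "fs.subspace (S j)" for j unfolding sym_comp_def by (rule fs.subspace_span)
    show "(\<lambda>v. f (g v)) \<in> E" if "f \<in> E" for f using E_comp[OF assms that] .
    show "(\<lambda>v. f (g v)) \<in> S j" if "f \<in> S j" for f j using sym_comp_comp[OF that G_facts(2)[OF assms]] .
    show "Ninv i \<in> S (degN i)" if "i < r" for i using Ninv_sym[OF that] .
    fix F' c d' assume "frame {..<r} F' E" "\<And>i. i < r \<Longrightarrow> F' i \<in> S (d' i)"
      "\<And>i. i < r \<Longrightarrow> (\<lambda>v. F' i (g v)) = (\<lambda>v. c i * F' i v)" "\<And>i. i < r \<Longrightarrow> c i ^ card G = 1"
    then show thesis by (rule that)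
  qed
qed

lemma Z_polyalg: "i < r \<Longrightarrow> Z i \<in> polyalg r Z"
  by (rule polyalg_gen)

lemma lincomb_pairing: "lincomb {..<r} Z c (Inl v) = lincomb {..<r} Ninv c v"
    "lincomb {..<r} Z c (Inr w) = lincomb {..<r} X c w"
  by (simp_all add: lincomb_def)

lemma lincomb_Z_polyalg: "lincomb {..<r} Z c \<in> polyalg r Z"
  by (rule polyalg_lincomb) (simp add: polyalg_gen)

text \<open>Each \<open>N_j\<close> is a combination of the \<open>F'\<close>. Transported to the
  coordinates, this relation writes \<open>X j\<close> through the functionals in question, so their
  common zeros have all coordinates 0.\<close>

lemma frame_cobasis:
  assumes F': "frame {..<r} F' E" "\<And>i. i < r \<Longrightarrow> F' i = lincomb {..<r} Ninv (B i)"
  shows "cobasis (\<lambda>i. lincomb {..<r} X (B i))"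
  unfolding cobasis_def
proof (intro conjI allI impI)
  show "linf (lincomb {..<r} X (B i))" for i using X_linear by (intro linf_lincomb) simp
  fix w assume w: "\<forall>i<r. lincomb {..<r} X (B i) w = 0"
  have "X j w = X j 0" if j: "j < r" for j
  proof -
    obtain C where C: "Ninv j = lincomb {..<r} F' C"
      using frame_elem[OF frame_N, of j] F'(1) j by (auto simp: frame_def)
    let ?g = "lincomb {..<r} (\<lambda>i. lincomb {..<r} Z (B i)) C"
    have "?g \<in> polyalg r Z" by (intro polyalg_lincomb lincomb_Z_polyalg)
    moreover have "Z j (Inl v) = ?g (Inl v)" for v
    proof -
      have "Ninv j v = (\<Sum>i<r. C i * F' i v)" using C by (simp add: lincomb_def)
      also have "\<dots> = (\<Sum>i<r. C i * lincomb {..<r} Z (B i) (Inl v))"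
        by (rule sum.cong) (auto simp: F'(2) lincomb_pairing)
      finally show ?thesis by (simp add: lincomb_def)
    qed
    ultimately have "Z j (Inr w) = ?g (Inr w)" by (rule transport_left_right[OF N_algind Z_polyalg[OF j]])
    also have "\<dots> = (\<Sum>i<r. C i * lincomb {..<r} X (B i) w)"
      unfolding lincomb_def[of "{..<r}" "\<lambda>i. lincomb {..<r} Z (B i)"] lincomb_pairing ..
    also have "\<dots> = 0" using w by simp
    finally show ?thesis using linf_zero[OF X_linear[OF j]] by simp
  qed
  then show "w = 0" by (rule X_eqI)
qed

text \<open>A relation among the \<open>F'\<close> is transported to the coordinate side, where the
  \<open>F'\<close> become a basis of functionals.\<close>

lemma frame_algind:
  assumes F': "frame {..<r} F' E"
  shows "algind r F'"
proof -
  obtain m where "\<And>i. i \<in> {..<r} \<Longrightarrow> F' i = lincomb {..<r} Ninv (\<lambda>j. m j i)"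
    using frame_coeffs[OF frame_N, of "{..<r}" F'] frame_elem[OF F'] by metis
  then have m: "\<And>i. i < r \<Longrightarrow> F' i = lincomb {..<r} Ninv (\<lambda>j. m j i)" by simp
  let ?P = "\<lambda>i. lincomb {..<r} Z (\<lambda>j. m j i)"
  let ?Y = "\<lambda>i. lincomb {..<r} X (\<lambda>j. m j i)"
  have Y: "cobasis ?Y" using frame_cobasis[OF F' m] .
  show ?thesis
    unfolding algind_def indep_family_def
  proof (intro allI impI)
    fix A c assume A: "finite A" "A \<subseteq> expos r" "lincomb A (pmono r F') c = 0"
    let ?f = "lincomb A (pmono r ?P) c"
    have f: "?f \<in> polyalg r Z" by (intro polyalg_lincomb polyalg_pmono lincomb_Z_polyalg)
    have l: "?f (Inl v) = (\<lambda>_. 0) (Inl v)" for v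
    proof -
      have "pmono r ?P \<alpha> (Inl v) = pmono r F' \<alpha> v" for \<alpha>
        unfolding pmono_def by (rule prod.cong) (auto simp: m lincomb_pairing)
      then have "?f (Inl v) = lincomb A (pmono r F') c v" by (simp add: lincomb_def[of A])
      then show ?thesis using A(3) by simp
    qed
    have "?f (Inr w) = 0" for w
      using transport_left_right[OF N_algind f polyalg_const[of 0] l] .
    moreover have "?f (Inr w) = lincomb A (pmono r ?Y) c w" for w
    proof -
      have "pmono r ?P \<alpha> (Inr w) = pmono r ?Y \<alpha> w" for \<alpha>
        unfolding pmono_def by (rule prod.cong) (auto simp: lincomb_pairing)
      then show ?thesis by (simp add: lincomb_def[of A])
    qed
    ultimately have "lincomb A (pmono r ?Y) c = 0" by (intro ext) simp
    then show "\<forall>\<alpha>\<in>A. c \<alpha> = 0"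
      using algind_cobasis[OF Y] A by (simp add: algind_def indep_family_def)
  qed
qed

text \<open>Every homogeneous basis of \<open>E\<close> serves as a system of fundamental
  \<open>N\<close>-invariants. This freedom allows a different one for each \<open>g\<close>, chosen
  to diagonalise \<open>g\<close>.\<close>

lemma N_ring:
  assumes F': "frame {..<r} F' E" "\<And>i. i < r \<Longrightarrow> F' i \<in> S (d' i)"
  shows "invariant_ring scale Basis r X e ((GL scale)\<lparr>carrier := N\<rparr>) (\<lambda>x. x) F' d'"
proof (intro invariant_ring.intro invariant_ring_axioms.intro coordinate_space_axioms N_facts(1))
  show "finite (carrier ((GL scale)\<lparr>carrier := N\<rparr>))" using finN by simp
  show "linm x" if "x \<in> carrier ((GL scale)\<lparr>carrier := N\<rparr>)" for x using that N_facts(2) by simp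
  show "(x \<otimes>\<^bsub>(GL scale)\<lparr>carrier := N\<rparr>\<^esub> y) v = x (y v)" for x y v by (simp add: GL_def)
  show "\<one>\<^bsub>(GL scale)\<lparr>carrier := N\<rparr>\<^esub> v = v" for v by (simp add: GL_def)
  show "F' i (x v) = F' i v" if "i < r" "x \<in> carrier ((GL scale)\<lparr>carrier := N\<rparr>)" for i x v
    using that E_inv[OF frame_elem[OF F'(1)]] by simp
  show "algind r F'" by (rule frame_algind[OF F'(1)])
  fix f assume f: "f \<in> sym_alg scale" "\<And>x v. x \<in> carrier ((GL scale)\<lparr>carrier := N\<rparr>) \<Longrightarrow> f (x v) = f v"
  have "Ninv i \<in> polyalg r F'" if "i < r" for i
  proof -
    have "Ninv i \<in> range (lincomb {..<r} F')" using frame_elem[OF frame_N, of i] F'(1) that by (simp add: frame_def)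
    then show ?thesis by (auto intro!: polyalg_lincomb polyalg_gen)
  qed
  then have "polyalg r Ninv \<subseteq> polyalg r F'" by (rule polyalg_subset)
  moreover have "f \<in> polyalg r Ninv" using f by (intro N_gen) auto
  ultimately show "f \<in> polyalg r F'" by blast
qed (use F' in auto)

lemma norm_root:
  fixes c :: complex
  assumes "c ^ card G = 1"
  shows "norm c = 1"
proof -
  have "card G > 0" using finG G_facts(4) card_gt_0_iff by blast
  then show ?thesis using power_eq_imp_eq_norm[of c "card G" 1] assms by simp
qed

lemma root_mult_ne_1:
  fixes c :: complex
  assumes "c ^ card G = 1" "0 < z" "z < 1" "n \<ge> 1"
  shows "c * of_real z ^ n \<noteq> 1"
proof
  assume "c * of_real z ^ n = 1"
  then have "norm (c * of_real z ^ n) = 1" by simp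
  then have "z ^ n = 1" using norm_root[OF assms(1)] assms(2) by (simp add: norm_mult norm_power)
  moreover have "z ^ n < 1" using assms power_Suc_less_one[of z "n - 1"] by simp
  ultimately show False by simp
qed

lemma fix_V:
  assumes "g \<in> G"
  obtains Y c where "cobasis Y" "\<And>i v. i < r \<Longrightarrow> Y i (g v) = c i * Y i v"
    "\<And>i. i < r \<Longrightarrow> c i ^ card G = 1" "fix_dim scale UNIV g = card {i \<in> {..<r}. c i = 1}"
proof -
  have "card G > 0" using finG assms card_gt_0_iff by blast
  then obtain Y c where Y: "cobasis Y" "\<And>i v. i < r \<Longrightarrow> Y i (g v) = c i * Y i v"
    "\<And>i. i < r \<Longrightarrow> c i ^ card G = 1"
    using eigen_cobasis[OF _ subgroup_GL_power[OF subG finG assms] G_facts(2)[OF assms]] by blast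
  from Y fix_dim_eigen[OF Y(1,2)] show thesis by (rule that)
qed

text \<open>The trace identity for \<open>N\<close> with \<open>g\<close> on coefficients and
  \<open>u\<close> times \<open>g\<close> on covectors, where \<open>u = q * (1 - z) - 1\<close>.
  All eigenvalues are roots of unity, so for \<open>0 < z < 1\<close> no denominator vanishes. In
  the limit an element \<open>g x\<close> of the coset contributes \<open>q\<close> for every
  eigenvalue 1 on \<open>V\<close>, and the right side sees only the eigenvalues of \<open>g\<close>
  on \<open>E\<close>.\<close>

lemma N_step:
  fixes q :: complex
  assumes g: "g \<in> G" and F': "frame {..<r} F' E" "\<And>i. i < r \<Longrightarrow> F' i \<in> S (d' i)"
    and eig: "\<And>i. i < r \<Longrightarrow> (\<lambda>v. F' i (g v)) = (\<lambda>v. c i * F' i v)" "\<And>i. i < r \<Longrightarrow> c i ^ card G = 1"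
  shows "(\<Sum>x\<in>N. q ^ fix_dim scale UNIV (g \<circ> x)) =
    of_nat (card N) * (\<Prod>i<r. if c i = 1 then (q + of_nat (d' i) - 1) / of_nat (d' i) else 1)"
proof -
  interpret R: invariant_ring scale Basis r X e "(GL scale)\<lparr>carrier := N\<rparr>" "\<lambda>x. x" F' d'
    by (rule N_ring[OF F'])
  have "\<forall>x\<in>N. \<exists>Y c. cobasis Y \<and> (\<forall>i v. i < r \<longrightarrow> Y i (g (x v)) = c i * Y i v) \<and>
      (\<forall>i<r. c i ^ card G = 1) \<and> fix_dim scale UNIV (g \<circ> x) = card {i \<in> {..<r}. c i = 1}"
  proof
    fix x assume "x \<in> N"
    then have "g \<circ> x \<in> G" using g NG G_facts(5) by blast
    then show "\<exists>Y c. cobasis Y \<and> (\<forall>i v. i < r \<longrightarrow> Y i (g (x v)) = c i * Y i v) \<and>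
      (\<forall>i<r. c i ^ card G = 1) \<and> fix_dim scale UNIV (g \<circ> x) = card {i \<in> {..<r}. c i = 1}"
    proof (rule fix_V)
      fix Y c assume "cobasis Y" "\<And>i v. i < r \<Longrightarrow> Y i ((g \<circ> x) v) = c i * Y i v"
        "\<And>i. i < r \<Longrightarrow> c i ^ card G = 1" "fix_dim scale UNIV (g \<circ> x) = card {i \<in> {..<r}. c i = 1}"
      then show ?thesis by (intro exI[of _ Y] exI[of _ c]) simp
    qed
  qed
  from bchoice[OF this] obtain Y where "\<forall>x\<in>N. \<exists>c. cobasis (Y x) \<and> (\<forall>i v. i < r \<longrightarrow> Y x i (g (x v)) = c i * Y x i v) \<and>
      (\<forall>i<r. c i ^ card G = 1) \<and> fix_dim scale UNIV (g \<circ> x) = card {i \<in> {..<r}. c i = 1}" ..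
  from bchoice[OF this] obtain lam where Y: "\<forall>x\<in>N. cobasis (Y x) \<and> (\<forall>i v. i < r \<longrightarrow> Y x i (g (x v)) = lam x i * Y x i v) \<and>
      (\<forall>i<r. lam x i ^ card G = 1) \<and> fix_dim scale UNIV (g \<circ> x) = card {i \<in> {..<r}. lam x i = 1}" ..
  have "(\<Sum>x\<in>N. q ^ fix_dim scale UNIV (g \<circ> x)) = (\<Sum>x\<in>N. \<Prod>i<r. if lam x i = 1 then q else 1)"
    using Y by (intro sum.cong) (auto simp: prod_if_eq_power)
  also have "\<dots> = of_nat (card N) * (\<Prod>i<r. if c i = 1 then (q + of_nat (d' i) - 1) / of_nat (d' i) else 1)"
  proof (rule limit_identity[where a = "\<lambda>_ _. q" and b = "\<lambda>_. q"])
    show "1 \<le> d' i" if "i < r" for i using R.d_pos[OF that] .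
    fix z :: real assume z: "0 < z" "z < 1"
    define u where "u = q * (1 - of_real z) - 1"
    have lin: "linm g" "linm (\<lambda>v. scale u (g v))"
      using G_facts(2)[OF g] by (auto simp: linm_iff scale_right_distrib mult.commute)
    have "(\<Sum>x\<in>carrier ((GL scale)\<lparr>carrier := N\<rparr>). \<Prod>i<r. (1 + u * lam x i) / (1 - lam x i * of_real z)) =
        of_nat (card (carrier ((GL scale)\<lparr>carrier := N\<rparr>))) *
        (\<Prod>i<r. (1 + u * c i * of_real z ^ (d' i - 1)) / (1 - c i * of_real z ^ d' i))"
    proof (rule R.trace_identity[OF lin, where Y = Y])
      fix k assume k: "k \<in> carrier ((GL scale)\<lparr>carrier := N\<rparr>)"
      then have kN: "k \<in> N" by simp
      show "cobasis (Y k)" using Y kN by blast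
      fix i assume i: "i < r"
      show 1: "Y k i (g (k v)) = lam k i * Y k i v" for v using Y kN i by blast
      have l: "linf (Y k i)" using Y kN i by (auto simp: cobasis_def)
      show "Y k i (scale u (g (k v))) = u * lam k i * Y k i v" for v by (simp add: linf_scale[OF l] 1)
      show "lam k i * of_real z \<noteq> 1" using root_mult_ne_1[of "lam k i" z 1] Y kN i z by simp
    next
      fix i assume i: "i < r"
      show e: "F' i (g v) = c i * F' i v" for v using fun_cong[OF eig(1)[OF i]] .
      show "c i * of_real z ^ d' i \<noteq> 1" using root_mult_ne_1[OF eig(2)[OF i] z R.d_pos[OF i]] .
      fix y w
      have "dird (F' i) (g y) (scale u (g w)) = u * dird (F' i) (g y) (g w)"
        using linf_scale[OF dird_linf[OF F'(2)[OF i]]] .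
      also have "dird (F' i) (g y) (g w) = dird (\<lambda>v. c i * F' i v) y w"
        using dird_comp[OF lin(1), of "F' i" y w] eig(1)[OF i] by simp
      also have "\<dots> = c i * dird (F' i) y w"
        by (rule dird_eqI) (intro DERIV_cmult dird_has_derivative linepoly_sym_comp[OF F'(2)[OF i]])
      finally show "dird (F' i) (g y) (scale u (g w)) = u * c i * dird (F' i) y w" by (simp add: mult.assoc)
    qed
    then show "(\<Sum>x\<in>N. \<Prod>i<r. (1 + (q * (1 - of_real z) - 1) * lam x i) / (1 - lam x i * of_real z)) =
        of_nat (card N) * (\<Prod>i<r. (1 + (q * (1 - of_real z) - 1) * c i * of_real z ^ (d' i - 1)) / (1 - c i * of_real z ^ d' i))"
      by (simp add: u_def)
  qed
  finally show ?thesis .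
qed

end

section \<open>The action of \<open>G\<close> on \<open>E\<close>, modelled on
  \<open>V\<close>\<close>

context normal_pair
begin

definition repmat :: "('v \<Rightarrow> 'v) \<Rightarrow> nat \<Rightarrow> nat \<Rightarrow> complex" where
  "repmat g i = (SOME a. (\<lambda>v. Ninv i (g v)) = lincomb {..<r} Ninv a)"

text \<open>The action of \<open>g\<close> on \<open>E\<close>, transported to \<open>V\<close> by matching \<open>N\<^sub>i\<close> with the coordinate \<open>X\<^sub>i\<close>.\<close>

definition act :: "('v \<Rightarrow> 'v) \<Rightarrow> 'v \<Rightarrow> 'v" where
  "act g v = (\<Sum>i<r. scale (lincomb {..<r} X (repmat g i) v) (e i))"

lemma repmat:
  assumes "g \<in> G" "i < r"
  shows "Ninv i (g v) = lincomb {..<r} Ninv (repmat g i) v"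
proof -
  have "(\<lambda>v. Ninv i (g v)) \<in> E" using E_comp[OF assms(1) frame_elem[OF frame_N]] assms(2) by simp
  then obtain a where "(\<lambda>v. Ninv i (g v)) = lincomb {..<r} Ninv a" using frame_N by (auto simp: frame_def)
  then have "(\<lambda>v. Ninv i (g v)) = lincomb {..<r} Ninv (repmat g i)"
    unfolding repmat_def by (rule someI[of "\<lambda>a. (\<lambda>v. Ninv i (g v)) = lincomb {..<r} Ninv a"])
  then show ?thesis by (rule fun_cong)
qed

lemma X_act: "i < r \<Longrightarrow> X i (act g v) = lincomb {..<r} X (repmat g i) v"
  unfolding act_def
  by (rule dual_basis_combination[OF cobasis_X dual_basis_X, of i "\<lambda>i. lincomb {..<r} X (repmat g i) v"])

lemma linm_act: "linm (act g)"
proof -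
  have l: "linf (lincomb {..<r} X (repmat g i))" for i by (rule linf_lincomb) (simp add: X_linear)
  show ?thesis unfolding linm_iff
  proof (intro conjI allI)
    fix v w
    show "act g (v + w) = act g v + act g w"
      unfolding act_def linf_add[OF l] scale_left_distrib sum.distrib ..
  next
    fix c v
    show "act g (scale c v) = scale c (act g v)"
      unfolding act_def linf_scale[OF l] scale_sum_right by (rule sum.cong) auto
  qed
qed

abbreviation "actZ g \<equiv> map_sum g (act g)"

lemma Z_act: "g \<in> G \<Longrightarrow> i < r \<Longrightarrow> (\<lambda>s. Z i (actZ g s)) = lincomb {..<r} Z (repmat g i)"
proof
  fix s assume "g \<in> G" "i < r"
  then show "Z i (actZ g s) = lincomb {..<r} Z (repmat g i) s"
    by (cases s) (simp_all add: lincomb_pairing repmat X_act)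
qed

lemma polyalg_act:
  assumes "g \<in> G" "f \<in> polyalg r Z"
  shows "(\<lambda>s. f (actZ g s)) \<in> polyalg r Z"
proof -
  obtain A c where f: "f = lincomb A (pmono r Z) c" using assms(2) by (auto simp: polyalg_explicit)
  have eq: "(\<lambda>s. f (actZ g s)) = lincomb A (pmono r (\<lambda>i s. Z i (actZ g s))) c"
    by (simp add: f lincomb_def pmono_def)
  have "(\<lambda>s. Z i (actZ g s)) \<in> polyalg r Z" if "i < r" for i
    unfolding Z_act[OF assms(1) that] by (rule lincomb_Z_polyalg)
  then show ?thesis unfolding eq by (intro polyalg_lincomb polyalg_pmono)
qed

text \<open>On the left summand this is composition of maps; transporting it to the right avoids
  multiplying the matrices \<open>repmat\<close>.\<close>

lemma act_comp:
  assumes "g \<in> G" "h \<in> G"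
  shows "act (g \<circ> h) v = act g (act h v)"
proof (rule X_eqI)
  fix i assume i: "i < r"
  have gh: "g \<circ> h \<in> G" using assms G_facts(5) by blast
  have "Z i (actZ (g \<circ> h) (Inr v)) = Z i (actZ g (actZ h (Inr v)))"
    by (rule transport_left_right[OF N_algind polyalg_act[OF gh Z_polyalg[OF i]]
          polyalg_act[OF assms(2) polyalg_act[OF assms(1) Z_polyalg[OF i]]]]) simp
  then show "X i (act (g \<circ> h) v) = X i (act g (act h v))" by simp
qed

lemma act_id: "act id v = v"
proof (rule X_eqI)
  fix i assume i: "i < r"
  have "Z i (actZ id (Inr v)) = Z i (Inr v)"
    by (rule transport_left_right[OF N_algind polyalg_act[OF G_facts(4) Z_polyalg[OF i]] Z_polyalg[OF i]]) simp
  then show "X i (act id v) = X i v" by simp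
qed

abbreviation "Ht i \<equiv> mpoly_subst r (Hpoly i) X"
abbreviation "HZ i \<equiv> mpoly_subst r (Hpoly i) Z"

lemma HZ_simps: "HZ i (Inl v) = mpoly_subst r (Hpoly i) Ninv v" "HZ i (Inr w) = Ht i w"
  by (simp_all add: mpoly_subst_def)

lemma HZ_polyalg: "HZ i \<in> polyalg r Z"
  by (rule mpoly_subst_mem_polyalg) (rule polyalg_gen)

lemma Ht_sym:
  assumes i: "i < r"
  shows "Ht i \<in> S (dH i)"
proof -
  have "Ht i = lincomb (Poly_Mapping.keys (Hpoly i)) (\<lambda>\<alpha>. pmono r X (Poly_Mapping.lookup \<alpha>)) (Poly_Mapping.lookup (Hpoly i))"
    by (auto simp: lincomb_def mpoly_subst_eq_pmono)
  also have "\<dots> \<in> S (dH i)"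
  proof (rule sym_comp_lincomb)
    fix \<alpha> assume "\<alpha> \<in> Poly_Mapping.keys (Hpoly i)"
    then have "wdeg r (\<lambda>_. 1) (Poly_Mapping.lookup \<alpha>) = dH i"
      using Hpoly i by (simp add: mpoly_homogeneous_def wdeg_def)
    then show "pmono r X (Poly_Mapping.lookup \<alpha>) \<in> S (dH i)"
      using sym_comp_pmono[of r X "\<lambda>_. 1" "Poly_Mapping.lookup \<alpha>"] linf_sym_comp[OF X_linear] by metis
  qed
  finally show ?thesis .
qed

lemma lincomb_HZ:
  "lincomb A (pmono r HZ) c (Inl v) = lincomb A (pmono r (\<lambda>i. mpoly_subst r (Hpoly i) Ninv)) c v"
  "lincomb A (pmono r HZ) c (Inr w) = lincomb A (pmono r Ht) c w"
  by (simp_all add: lincomb_def pmono_def HZ_simps)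

lemma lincomb_HZ_polyalg: "lincomb A (pmono r HZ) c \<in> polyalg r Z"
  by (intro polyalg_lincomb polyalg_pmono HZ_polyalg)

lemma algind_X: "algind r X"
  by (rule algind_cobasis[OF cobasis_X])

text \<open>Every axiom is transported from the known facts about functions on \<open>V\<close>. For
  generation the transport runs both ways: an \<open>act\<close>-invariant is read as a polynomial
  in the \<open>N_i\<close>, becomes \<open>G\<close>-invariant there and hence a polynomial in the
  \<open>H_i\<close>, and that relation is carried back to the coordinates.\<close>

lemma H_ring: "invariant_ring scale Basis r X e ((GL scale)\<lparr>carrier := G\<rparr>) act Ht dH"
proof (intro invariant_ring.intro invariant_ring_axioms.intro coordinate_space_axioms G_facts(1))
  show "finite (carrier ((GL scale)\<lparr>carrier := G\<rparr>))" using finG by simp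
  show "linm (act g)" for g by (rule linm_act)
  show "act (g \<otimes>\<^bsub>(GL scale)\<lparr>carrier := G\<rparr>\<^esub> h) v = act g (act h v)"
    if "g \<in> carrier ((GL scale)\<lparr>carrier := G\<rparr>)" "h \<in> carrier ((GL scale)\<lparr>carrier := G\<rparr>)" for g h v
    using that act_comp[of g h v] by (simp add: GL_def)
  show "act \<one>\<^bsub>(GL scale)\<lparr>carrier := G\<rparr>\<^esub> v = v" for v using act_id by (simp add: GL_def)
  show "Ht i \<in> S (dH i)" if "i < r" for i using Ht_sym[OF that] .
  show "Ht i (act g v) = Ht i v" if "i < r" "g \<in> carrier ((GL scale)\<lparr>carrier := G\<rparr>)" for i g v
  proof -
    have g: "g \<in> G" using that by simp
    have "HZ i (actZ g (Inr v)) = HZ i (Inr v)"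
      by (rule transport_left_right[OF N_algind polyalg_act[OF g HZ_polyalg] HZ_polyalg])
        (simp add: HZ_simps H_inv[OF that(1) g])
    then show ?thesis by (simp add: HZ_simps)
  qed
  show "algind r Ht"
    unfolding algind_def indep_family_def
  proof (intro allI impI)
    fix A c assume A: "finite A" "A \<subseteq> expos r" "lincomb A (pmono r Ht) c = 0"
    have "lincomb A (pmono r HZ) c (Inl v) = (\<lambda>_. 0) (Inl v)" for v
      by (rule transport_right_left[OF algind_X lincomb_HZ_polyalg polyalg_const])
        (simp add: lincomb_HZ A(3))
    then have "lincomb A (pmono r (\<lambda>i. mpoly_subst r (Hpoly i) Ninv)) c = 0"
      by (auto simp: lincomb_HZ)
    then show "\<forall>\<alpha>\<in>A. c \<alpha> = 0" using H_algind A(1,2) by (simp add: algind_def indep_family_def)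
  qed
  fix f assume f: "f \<in> sym_alg scale" "\<And>g v. g \<in> carrier ((GL scale)\<lparr>carrier := G\<rparr>) \<Longrightarrow> f (act g v) = f v"
  obtain B c where B: "finite B" "B \<subseteq> expos r" "f = lincomb B (pmono r X) c"
    using f(1) by (auto simp: sym_alg_eq_polyalg[OF cobasis_X] polyalg_explicit)
  let ?fZ = "lincomb B (pmono r Z) c"
  let ?fN = "lincomb B (pmono r Ninv) c"
  have fZ: "?fZ \<in> polyalg r Z" using B by (auto simp: polyalg_explicit)
  have fZ_simps: "?fZ (Inl v) = ?fN v" "?fZ (Inr v) = f v" for v
    by (simp_all add: B(3) lincomb_def pmono_def)
  have "?fN (g v) = ?fN v" if g: "g \<in> G" for g v
  proof -
    have "?fZ (actZ g (Inl v)) = ?fZ (Inl v)"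
      by (rule transport_right_left[OF algind_X polyalg_act[OF g fZ] fZ])
        (use f(2)[of g] g in \<open>simp add: fZ_simps\<close>)
    then show ?thesis by (simp add: fZ_simps)
  qed
  moreover have "?fN \<in> sym_alg scale" using B by (intro polyalg_N) (auto simp: polyalg_explicit)
  ultimately have "?fN \<in> polyalg r (\<lambda>i. mpoly_subst r (Hpoly i) Ninv)" by (intro H_gen)
  then obtain D a where D: "finite D" "D \<subseteq> expos r"
    "?fN = lincomb D (pmono r (\<lambda>i. mpoly_subst r (Hpoly i) Ninv)) a" by (auto simp: polyalg_explicit)
  have "?fZ (Inr w) = lincomb D (pmono r HZ) a (Inr w)" for w
    by (rule transport_left_right[OF N_algind fZ lincomb_HZ_polyalg]) (simp add: fZ_simps lincomb_HZ D(3))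
  then have "f = lincomb D (pmono r Ht) a" by (intro ext) (simp add: fZ_simps lincomb_HZ)
  then show "f \<in> polyalg r Ht" using D by (auto simp: polyalg_explicit)
qed

text \<open>Doubling the argument separates the degrees, as in \<open>invariant_polynomial\<close>:
  a homogeneous element of \<open>E\<close> involves only those \<open>N_j\<close> that have its
  degree.\<close>

lemma degree_block:
  assumes "f = lincomb {..<r} Ninv a" "f \<in> S n" "j < r" "a j \<noteq> 0"
  shows "degN j = n"
proof -
  have "a j * (2 ^ degN j - 2 ^ n) = 0"
  proof (rule indep_familyD[where J = "{..<r}" and b = Ninv and c = "\<lambda>j. a j * (2 ^ degN j - 2 ^ n)"])
    show "indep_family {..<r} Ninv" by (rule algind_indep[OF N_algind])
    fix v
    have "f (scale 2 v) = 2 ^ n * f v" by (rule sym_comp_homogeneous[OF assms(2)])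
    moreover have "f (scale 2 v) = (\<Sum>j<r. a j * (2 ^ degN j * Ninv j v))"
      unfolding assms(1) lincomb_def
      by (rule sum.cong) (simp_all add: sym_comp_homogeneous[OF Ninv_sym])
    moreover have "2 ^ n * f v = (\<Sum>j<r. 2 ^ n * (a j * Ninv j v))"
      by (simp add: assms(1) lincomb_def sum_distrib_left)
    ultimately show "(\<Sum>j<r. a j * (2 ^ degN j - 2 ^ n) * Ninv j v) = 0"
      by (simp add: algebra_simps sum_subtractf)
  qed (use assms in simp)
  then have "(2 :: complex) ^ degN j = 2 ^ n" using assms(4) by simp
  then have "of_nat (2 ^ degN j) = (of_nat (2 ^ n) :: complex)" by simp
  then have "(2 :: nat) ^ degN j = 2 ^ n" unfolding of_nat_eq_iff .
  then show ?thesis by simp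
qed

text \<open>Coefficients are left alone and covectors are moved by \<open>T\<close>, which
  multiplies each coordinate by a number depending on the degree of its \<open>N_j\<close>.
  Eigenvectors are homogeneous, so they are also eigenvectors of \<open>T\<close>, and the weight
  \<open>y\<close> may be an arbitrary function of the degree. On the right every eigenvalue is 1,
  hence each \<open>i\<close> contributes a limit with \<open>dH i\<close> in the
  denominator.\<close>

lemma H_step:
  fixes y :: "nat \<Rightarrow> complex"
  assumes F': "\<And>g. g \<in> G \<Longrightarrow> frame {..<r} (F' g) E" "\<And>g i. g \<in> G \<Longrightarrow> i < r \<Longrightarrow> F' g i \<in> S (d' g i)"
    and eig: "\<And>g i. g \<in> G \<Longrightarrow> i < r \<Longrightarrow> (\<lambda>v. F' g i (g v)) = (\<lambda>v. c g i * F' g i v)"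
      "\<And>g i. g \<in> G \<Longrightarrow> i < r \<Longrightarrow> c g i ^ card G = 1"
  shows "(\<Sum>g\<in>G. \<Prod>i<r. if c g i = 1 then y (d' g i) else 1) =
    of_nat (card G) * (\<Prod>i<r. (y (dN i) + of_nat (dH i) - 1) / of_nat (dH i))"
proof -
  interpret R: invariant_ring scale Basis r X e "(GL scale)\<lparr>carrier := G\<rparr>" act Ht dH
    by (rule H_ring)
  have "\<forall>g\<in>G. \<exists>m. \<forall>i\<in>{..<r}. F' g i = lincomb {..<r} Ninv (\<lambda>j. m j i)"
  proof
    fix g assume g: "g \<in> G"
    have "\<forall>i\<in>{..<r}. F' g i \<in> E" using frame_elem[OF F'(1)[OF g]] by blast
    from frame_coeffs[OF frame_N this] show "\<exists>m. \<forall>i\<in>{..<r}. F' g i = lincomb {..<r} Ninv (\<lambda>j. m j i)" by metis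
  qed
  from bchoice[OF this] obtain m where m: "\<forall>g\<in>G. \<forall>i\<in>{..<r}. F' g i = lincomb {..<r} Ninv (\<lambda>j. m g j i)" ..
  define YZ where "YZ g i = lincomb {..<r} Z (\<lambda>j. m g j i)" for g i
  define Y where "Y g i = lincomb {..<r} X (\<lambda>j. m g j i)" for g i
  have YZ_polyalg: "YZ g i \<in> polyalg r Z" for g i unfolding YZ_def by (rule lincomb_Z_polyalg)
  have YZ_simps: "YZ g i (Inl v) = F' g i v" "YZ g i (Inr w) = Y g i w" if "g \<in> G" "i < r" for g i v w
    using m that by (simp_all add: YZ_def Y_def lincomb_pairing)
  have Ycob: "cobasis (Y g)" if g: "g \<in> G" for g
    unfolding Y_def[abs_def] by (rule frame_cobasis[OF F'(1)[OF g]]) (use m g in auto)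
  have Yact: "Y g i (act g v) = c g i * Y g i v" if g: "g \<in> G" "i < r" for g i v
  proof -
    have "YZ g i (actZ g (Inr v)) = c g i * YZ g i (Inr v)"
    proof (rule transport_left_right[OF N_algind polyalg_act[OF g(1) YZ_polyalg] polyalg_scale[OF YZ_polyalg]])
      show "YZ g i (actZ g (Inl a)) = c g i * YZ g i (Inl a)" for a
        using fun_cong[OF eig(1)[OF g], of a] by (simp add: YZ_simps[OF g])
    qed
    then show ?thesis by (simp add: YZ_simps[OF g])
  qed
  have "(\<Sum>g\<in>G. \<Prod>i<r. if c g i = 1 then y (d' g i) else 1) =
      of_nat (card G) * (\<Prod>i<r. if (1 :: complex) = 1 then (y (dN i) + of_nat (dH i) - 1) / of_nat (dH i) else 1)"
  proof (rule limit_identity[where a = "\<lambda>g i. y (d' g i)" and b = "\<lambda>i. y (dN i)" and c = "\<lambda>_. 1" and d = dH])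
    show "1 \<le> dH i" if "i < r" for i using R.d_pos[OF that] .
    fix z :: real assume z: "0 < z" "z < 1"
    define u where "u n = y n * (1 - of_real z) - 1" for n
    define T where "T v = (\<Sum>j<r. scale (u (degN j) * X j v) (e j))" for v
    have XT: "X j (T v) = u (degN j) * X j v" if "j < r" for j v
      unfolding T_def
      by (rule dual_basis_combination[OF cobasis_X dual_basis_X that, of "\<lambda>j. u (degN j) * X j v"])
    have linT: "linm T"
      unfolding linm_iff
    proof (intro conjI allI)
      show "T (v + w) = T v + T w" for v w
        by (rule X_eqI) (simp add: XT linf_add[OF X_linear] distrib_left)
      show "T (scale a v) = scale a (T v)" for a v
        by (rule X_eqI) (simp add: XT linf_scale[OF X_linear] mult.left_commute)
    qed
    have YT: "Y g i (T v) = u (d' g i) * Y g i v" if g: "g \<in> G" "i < r" for g i v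
    proof -
      have "Y g i (T v) = (\<Sum>j<r. m g j i * X j (T v))" by (simp add: Y_def lincomb_def)
      also have "\<dots> = (\<Sum>j<r. u (d' g i) * (m g j i * X j v))"
      proof (rule sum.cong)
        fix j assume j: "j \<in> {..<r}"
        have "m g j i = 0 \<or> degN j = d' g i"
          using degree_block[of "F' g i" "\<lambda>j. m g j i" "d' g i" j] m g F'(2)[OF g] j by auto
        then show "m g j i * X j (T v) = u (d' g i) * (m g j i * X j v)"
          using j by (auto simp: XT)
      qed simp
      finally show ?thesis by (simp add: Y_def lincomb_def sum_distrib_left)
    qed
    have "(\<Sum>g\<in>carrier ((GL scale)\<lparr>carrier := G\<rparr>). \<Prod>i<r. (1 + u (d' g i) * c g i) / (1 - c g i * of_real z)) =
        of_nat (card (carrier ((GL scale)\<lparr>carrier := G\<rparr>))) *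
        (\<Prod>i<r. (1 + u (dN i) * of_real z ^ (dH i - 1)) / (1 - 1 * of_real z ^ dH i))"
    proof (rule R.trace_identity[where g = "\<lambda>v. v" and T = T and Y = Y])
      show "linm (\<lambda>v. v)" by (simp add: linm_iff)
      show "linm T" by (rule linT)
      fix g assume "g \<in> carrier ((GL scale)\<lparr>carrier := G\<rparr>)"
      then have g: "g \<in> G" by simp
      show "cobasis (Y g)" by (rule Ycob[OF g])
      fix i assume i: "i < r"
      show "Y g i (act g v) = c g i * Y g i v" for v by (rule Yact[OF g i])
      show "Y g i (T (act g v)) = u (d' g i) * c g i * Y g i v" for v
        by (simp add: YT[OF g i] Yact[OF g i])
      show "c g i * of_real z \<noteq> 1" using root_mult_ne_1[OF eig(2)[OF g i] z, of 1] by simp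
    next
      fix i assume i: "i < r"
      show "Ht i v = 1 * Ht i v" for v by simp
      show "1 * of_real z ^ dH i \<noteq> (1 :: complex)" using root_mult_ne_1[of 1 z "dH i"] z R.d_pos[OF i] by simp
      fix x w
      \<comment> \<open>Only coordinates occurring in \<open>Hpoly i\<close> matter. They all have
        degree \<open>dN i\<close>, so for this function \<open>T\<close> is indistinguishable from
        a scalar.\<close>
      have "Ht i (x + scale t (T w)) = Ht i (x + scale t (scale (u (dN i)) w))" for t
        unfolding mpoly_subst_def
      proof (intro sum.cong arg_cong[of _ _ "\<lambda>z. _ * z"] prod.cong refl)
        fix \<alpha> j assume \<alpha>: "\<alpha> \<in> Poly_Mapping.keys (Hpoly i)" and j: "j \<in> {..<r}"
        show "X j (x + scale t (T w)) ^ Poly_Mapping.lookup \<alpha> j =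
            X j (x + scale t (scale (u (dN i)) w)) ^ Poly_Mapping.lookup \<alpha> j"
        proof (cases "Poly_Mapping.lookup \<alpha> j = 0")
          case False
          then have "occurs_in j (Hpoly i)" using \<alpha> by (auto simp: occurs_in_def in_keys_iff)
          then have "degN j = dN i" using dN i j by simp
          then show ?thesis
            using j by (simp add: linf_add[OF X_linear] linf_scale[OF X_linear] XT mult.assoc)
        qed simp
      qed
      then have "dird (Ht i) x (T w) = dird (Ht i) x (scale (u (dN i)) w)" by (simp add: dird_def)
      then show "dird (Ht i) x (T w) = u (dN i) * dird (Ht i) x w"
        using linf_scale[OF dird_linf[OF Ht_sym[OF i]]] by simp
    qed
    then show "(\<Sum>g\<in>G. \<Prod>i<r. (1 + (y (d' g i) * (1 - of_real z) - 1) * c g i) / (1 - c g i * of_real z)) =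
        of_nat (card G) * (\<Prod>i<r. (1 + (y (dN i) * (1 - of_real z) - 1) * 1 * of_real z ^ (dH i - 1)) / (1 - 1 * of_real z ^ dH i))"
      by (simp add: u_def)
  qed
  then show ?thesis by simp
qed

section \<open>The two-variable sum and its constant\<close>

lemma fix_dim_full:
  assumes g: "g \<in> G"
  shows "fix_dim scale UNIV g \<le> r" "fix_dim scale UNIV g = r \<longleftrightarrow> g = id"
proof -
  obtain Y c where Y: "cobasis Y" "\<And>i v. i < r \<Longrightarrow> Y i (g v) = c i * Y i v"
    and fd: "fix_dim scale UNIV g = card {i \<in> {..<r}. c i = 1}"
    using fix_V[OF g] by metis
  show "fix_dim scale UNIV g \<le> r" unfolding fd using card_mono[of "{..<r}" "{i \<in> {..<r}. c i = 1}"] by auto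
  show "fix_dim scale UNIV g = r \<longleftrightarrow> g = id"
  proof
    assume "fix_dim scale UNIV g = r"
    then have "{i \<in> {..<r}. c i = 1} = {..<r}" unfolding fd by (intro card_subset_eq) auto
    then have c1: "c i = 1" if "i < r" for i using that by blast
    have "g v = v" for v
    proof -
      have "\<forall>i<r. Y i (g v - v) = 0"
        using Y(2) c1 cobasis_linf[OF Y(1)] by (simp add: linf_diff)
      then have "g v - v = 0" using Y(1) unfolding cobasis_def by blast
      then show ?thesis by simp
    qed
    then show "g = id" by auto
  next
    assume "g = id"
    have "fix_dim scale UNIV (\<lambda>v. v) = card {i \<in> {..<r}. (1 :: complex) = 1}"
      by (rule fix_dim_eigen[OF cobasis_X]) simp
    then show "fix_dim scale UNIV g = r" using \<open>g = id\<close> by (simp add: id_def)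
  qed
qed

text \<open>\<open>dN i\<close> is tied to a degree only through variables that occur in
  \<open>Hpoly i\<close>. If it were 0, no variable could occur, and a polynomial homogeneous of
  positive degree \<open>dH i\<close> would have no terms, contradicting independence.\<close>

lemma degrees_pos:
  assumes i: "i < r"
  shows "dH i \<ge> 1" "dN i \<ge> 1"
proof -
  interpret R: invariant_ring scale Basis r X e "(GL scale)\<lparr>carrier := G\<rparr>" act Ht dH
    by (rule H_ring)
  interpret RN: invariant_ring scale Basis r X e "(GL scale)\<lparr>carrier := N\<rparr>" "\<lambda>x. x" Ninv degN
    by (rule N_ring[OF frame_N Ninv_sym])
  show dH: "dH i \<ge> 1" using R.d_pos[OF i] .
  show "dN i \<ge> 1"
  proof (rule ccontr)
    assume dNi: "\<not> dN i \<ge> 1"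
    have no: "\<not> occurs_in j (Hpoly i)" if "j < r" for j
      using dN RN.d_pos[OF that] i that dNi by auto
    have "Poly_Mapping.keys (Hpoly i) = {}"
    proof (rule ccontr)
      assume "Poly_Mapping.keys (Hpoly i) \<noteq> {}"
      then obtain \<alpha> where \<alpha>: "\<alpha> \<in> Poly_Mapping.keys (Hpoly i)" by blast
      then have "Poly_Mapping.lookup \<alpha> j = 0" if "j < r" for j
        using no[OF that] by (auto simp: occurs_in_def in_keys_iff)
      then have "(\<Sum>j<r. Poly_Mapping.lookup \<alpha> j) = 0" by simp
      moreover have "(\<Sum>j<r. Poly_Mapping.lookup \<alpha> j) = dH i"
        using Hpoly i \<alpha> by (simp add: mpoly_homogeneous_def)
      ultimately show False using dH by simp
    qed
    then have Ht0: "Ht i v = 0" for v by (simp add: mpoly_subst_def)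
    have "(if i = i then 1 else 0) = (0 :: complex)"
    proof (rule indep_familyD[OF algind_indep[OF R.F_indep], where c = "\<lambda>j. if j = i then 1 else 0"])
      show "(\<Sum>j<r. (if j = i then 1 else 0) * Ht j v) = 0" for v
        by (rule sum.neutral) (use Ht0 in auto)
    qed (use i in simp)
    then show False by simp
  qed
qed

text \<open>Translation by \<open>N\<close> does not change the fixed dimension on \<open>E\<close>,
  so the power of \<open>t\<close> is constant on a coset while \<open>N_step\<close> evaluates the
  powers of \<open>q\<close> there. The outcome is a product of weights over the eigenvalues 1 on
  \<open>E\<close>, to which \<open>H_step\<close> applies.\<close>

lemma fixed_space_sum_proportional:
  fixes q t :: complex
  shows "(\<Sum>g\<in>G. q ^ fix_dim scale UNIV g * t ^ fix_dim fscale (E_space r Ninv) (dual_act g)) =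
    of_nat (card G) / (\<Prod>i<r. of_nat (dN i) * of_nat (dH i)) *
    (\<Prod>i<r. q * t + of_nat (dN i - 1) * t + of_nat (dN i * (dH i - 1)))"
proof -
  let ?fV = "fix_dim scale UNIV" and ?fE = "\<lambda>g. fix_dim fscale (E_space r Ninv) (dual_act g)"
  have "\<forall>g\<in>G. \<exists>F' c d'. frame {..<r} F' E \<and> (\<forall>i<r. F' i \<in> S (d' i)) \<and>
      (\<forall>i<r. (\<lambda>v. F' i (g v)) = (\<lambda>v. c i * F' i v)) \<and> (\<forall>i<r. c i ^ card G = 1)"
    using eigen_data by metis
  from bchoice[OF this] obtain F' where "\<forall>g\<in>G. \<exists>c d'. frame {..<r} (F' g) E \<and> (\<forall>i<r. F' g i \<in> S (d' i)) \<and>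
      (\<forall>i<r. (\<lambda>v. F' g i (g v)) = (\<lambda>v. c i * F' g i v)) \<and> (\<forall>i<r. c i ^ card G = 1)" ..
  from bchoice[OF this] obtain c where "\<forall>g\<in>G. \<exists>d'. frame {..<r} (F' g) E \<and> (\<forall>i<r. F' g i \<in> S (d' i)) \<and>
      (\<forall>i<r. (\<lambda>v. F' g i (g v)) = (\<lambda>v. c g i * F' g i v)) \<and> (\<forall>i<r. c g i ^ card G = 1)" ..
  from bchoice[OF this] obtain d' where all: "\<forall>g\<in>G. frame {..<r} (F' g) E \<and> (\<forall>i<r. F' g i \<in> S (d' g i)) \<and>
      (\<forall>i<r. (\<lambda>v. F' g i (g v)) = (\<lambda>v. c g i * F' g i v)) \<and> (\<forall>i<r. c g i ^ card G = 1)" ..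
  have F': "\<And>g. g \<in> G \<Longrightarrow> frame {..<r} (F' g) E" "\<And>g i. g \<in> G \<Longrightarrow> i < r \<Longrightarrow> F' g i \<in> S (d' g i)"
    "\<And>g i. g \<in> G \<Longrightarrow> i < r \<Longrightarrow> (\<lambda>v. F' g i (g v)) = (\<lambda>v. c g i * F' g i v)"
    "\<And>g i. g \<in> G \<Longrightarrow> i < r \<Longrightarrow> c g i ^ card G = 1"
    using all by simp_all
  \<comment> \<open>The factor that \<open>N_step\<close> gives for an eigenvalue 1 in degree
    \<open>n\<close>, multiplied by the \<open>t\<close> counting that eigenvalue.\<close>
  define y where "y n = t * (q + of_nat n - 1) / of_nat n" for n
  have H: "(\<Sum>g\<in>G. \<Prod>i<r. if c g i = 1 then y (d' g i) else 1) =
      of_nat (card G) * (\<Prod>i<r. (y (dN i) + of_nat (dH i) - 1) / of_nat (dH i))"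
    by (rule H_step[where F' = F' and c = c and d' = d' and y = y]) (fact F')+
  have fE: "?fE (g \<circ> x) = card {i \<in> {..<r}. c g i = 1}" if g: "g \<in> G" and x: "x \<in> N" for g x
  proof -
    have gx: "g \<circ> x \<in> G" using g x NG G_facts(5) by blast
    have "(\<lambda>v. F' g i ((g \<circ> x) v)) = (\<lambda>v. c g i * F' g i v)" if i: "i < r" for i
    proof
      fix v
      have "F' g i (g (x v)) = c g i * F' g i (x v)" using fun_cong[OF F'(3)[OF g i], of "x v"] .
      then show "F' g i ((g \<circ> x) v) = c g i * F' g i v"
        using E_inv[OF frame_elem[OF F'(1)[OF g]] x, of i v] i by simp
    qed
    then show ?thesis
      unfolding E_space_def using F'(1)[OF g] G_facts(3)[OF gx] E_comp_iff[OF gx]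
      by (intro fix_dim_dual_eigen) auto
  qed
  have translate: "(\<Sum>g\<in>G. f (g \<circ> x)) = (\<Sum>g\<in>G. f g)" if x: "x \<in> N" for x and f :: "('v \<Rightarrow> 'v) \<Rightarrow> complex"
  proof -
    have xG: "x \<in> G" using x NG by blast
    note inv = G_facts(6)[OF xG] and bij = G_facts(3)[OF xG]
    have 1: "x \<circ> inv_into UNIV x = id" "inv_into UNIV x \<circ> x = id"
      using bij by (auto simp: bij_is_surj surj_f_inv_f bij_is_inj)
    show ?thesis
      by (rule sum.reindex_bij_witness[where i = "\<lambda>g. g \<circ> inv_into UNIV x" and j = "\<lambda>g. g \<circ> x"])
        (use 1 inv xG G_facts(5) in \<open>auto simp: comp_assoc\<close>)
  qed
  \<comment> \<open>Summing over \<open>G\<close> and \<open>N\<close> instead of over coset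
    representatives counts every element \<open>card N\<close> times; the factor cancels at the
    end.\<close>
  have "of_nat (card N) * (\<Sum>g\<in>G. q ^ ?fV g * t ^ ?fE g) = (\<Sum>x\<in>N. \<Sum>g\<in>G. q ^ ?fV (g \<circ> x) * t ^ ?fE (g \<circ> x))"
    using translate[of _ "\<lambda>g. q ^ ?fV g * t ^ ?fE g"] by simp
  also have "\<dots> = (\<Sum>g\<in>G. \<Sum>x\<in>N. q ^ ?fV (g \<circ> x) * t ^ ?fE (g \<circ> x))" by (rule sum.swap)
  also have "\<dots> = (\<Sum>g\<in>G. of_nat (card N) * (\<Prod>i<r. if c g i = 1 then y (d' g i) else 1))"
  proof (rule sum.cong)
    fix g assume g: "g \<in> G"
    have "(\<Sum>x\<in>N. q ^ ?fV (g \<circ> x) * t ^ ?fE (g \<circ> x)) =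
        (\<Sum>x\<in>N. q ^ ?fV (g \<circ> x)) * (\<Prod>i<r. if c g i = 1 then t else 1)"
      by (simp add: fE[OF g] prod_if_eq_power sum_distrib_right)
    also have "(\<Sum>x\<in>N. q ^ ?fV (g \<circ> x)) = of_nat (card N) *
        (\<Prod>i<r. if c g i = 1 then (q + of_nat (d' g i) - 1) / of_nat (d' g i) else 1)"
      by (rule N_step[OF g F'(1)[OF g] F'(2)[OF g] F'(3)[OF g] F'(4)[OF g]])
    also have "\<dots> * (\<Prod>i<r. if c g i = 1 then t else 1) =
        of_nat (card N) * (\<Prod>i<r. if c g i = 1 then y (d' g i) else 1)"
      unfolding mult.assoc prod.distrib[symmetric] y_def
      by (intro arg_cong[of _ _ "\<lambda>z. _ * z"] prod.cong) auto
    finally show "(\<Sum>x\<in>N. q ^ ?fV (g \<circ> x) * t ^ ?fE (g \<circ> x)) =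
        of_nat (card N) * (\<Prod>i<r. if c g i = 1 then y (d' g i) else 1)" .
  qed simp
  also have "\<dots> = of_nat (card N) * (of_nat (card G) * (\<Prod>i<r. (y (dN i) + of_nat (dH i) - 1) / of_nat (dH i)))"
    by (simp only: sum_distrib_left[symmetric] H)
  finally have eq: "of_nat (card N) * (\<Sum>g\<in>G. q ^ ?fV g * t ^ ?fE g) =
      of_nat (card N) * (of_nat (card G) * (\<Prod>i<r. (y (dN i) + of_nat (dH i) - 1) / of_nat (dH i)))" .
  have "card N \<noteq> 0" using finN N_facts(4) by auto
  with eq have "(\<Sum>g\<in>G. q ^ ?fV g * t ^ ?fE g) =
      of_nat (card G) * (\<Prod>i<r. (y (dN i) + of_nat (dH i) - 1) / of_nat (dH i))" by simp
  also have "(\<Prod>i<r. (y (dN i) + of_nat (dH i) - 1) / of_nat (dH i)) =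
      (\<Prod>i<r. (q * t + of_nat (dN i - 1) * t + of_nat (dN i * (dH i - 1))) / (of_nat (dN i) * of_nat (dH i)))"
  proof (rule prod.cong)
    fix i assume "i \<in> {..<r}"
    then have "dH i \<ge> 1" "dN i \<ge> 1" using degrees_pos by auto
    then show "(y (dN i) + of_nat (dH i) - 1) / of_nat (dH i) =
        (q * t + of_nat (dN i - 1) * t + of_nat (dN i * (dH i - 1))) / (of_nat (dN i) * of_nat (dH i))"
      by (simp add: y_def of_nat_diff field_simps)
  qed simp
  finally show ?thesis by (simp add: prod_dividef)
qed

text \<open>At \<open>t = 1\<close> the right side is the constant times \<open>r\<close> monic
  linear factors in \<open>q\<close>, so the constant is the coefficient of \<open>q ^ r\<close> on
  the left.\<close>

lemma card_G: "of_nat (card G) / (\<Prod>i<r. of_nat (dN i) * of_nat (dH i)) = (1 :: complex)" (is "?C = 1")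
proof -
  define p1 where "p1 = (\<Sum>g\<in>G. Polynomial.monom (1 :: complex) (fix_dim scale UNIV g))"
  define p2 where "p2 = (\<Prod>i<r. [:of_nat (dN i - 1) + of_nat (dN i * (dH i - 1)), 1 :: complex:])"
  have "poly p1 q = poly (Polynomial.smult ?C p2) q" for q
    using fixed_space_sum_proportional[of q 1]
    by (simp add: p1_def p2_def poly_sum poly_monom poly_prod algebra_simps)
  then have eq: "p1 = Polynomial.smult ?C p2" by (simp add: poly_eq_poly_eq_iff[symmetric] fun_eq_iff)
  have "Polynomial.coeff p1 r = (\<Sum>g\<in>G. if g = id then 1 else 0)"
    unfolding p1_def coeff_sum by (rule sum.cong) (auto simp: fix_dim_full(2))
  also have "\<dots> = 1" using finG G_facts(4) by simp
  finally have 1: "Polynomial.coeff p1 r = 1" .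
  have "degree p2 = r" unfolding p2_def by (subst degree_prod_eq_sum_degree) auto
  moreover have "lead_coeff p2 = 1" unfolding p2_def by (simp add: lead_coeff_prod)
  ultimately have "Polynomial.coeff p2 r = 1" by simp
  with 1 show ?thesis unfolding eq by simp
qed

theorem fixed_space_sum:
  fixes q t :: complex
  shows "(\<Sum>g\<in>G. q ^ fix_dim scale UNIV g * t ^ fix_dim fscale (E_space r Ninv) (dual_act g)) =
    (\<Prod>i<r. q * t + of_nat (dN i - 1) * t + of_nat (dN i * (dH i - 1)))"
  using fixed_space_sum_proportional[of q t] unfolding card_G by simp

end

theorem theorem1p5:
  fixes scale :: "complex \<Rightarrow> 'v::ab_group_add \<Rightarrow> 'v"
    and Basis :: "'v set"
    and r :: nat
    and G N :: "('v \<Rightarrow> 'v) set"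
    and Ninv :: "nat \<Rightarrow> 'v \<Rightarrow> complex"
    and Hpoly :: "nat \<Rightarrow> mpoly"
    and degN dN dH dG eN eG :: "nat \<Rightarrow> nat"
  assumes V: "finite_dimensional_vector_space scale Basis"
    and dim_V: "Vector_Spaces.vector_space.dim scale (UNIV :: 'v set) = r"
    and G: "complex_reflection_group scale G"
    and N: "normal_reflection_subgroup scale N G"
    \<comment> \<open>the fundamental N-invariants, spanning the dual of E\<close>
    and Ninv: "fundamental_invariants scale N r Ninv degN"
    and E_stable: "\<forall>g\<in>G. \<forall>f\<in>E_dual r Ninv. fun_act g f \<in> E_dual r Ninv"
    \<comment> \<open>the fundamental invariants of G/N, as polynomials in the N-invariants\<close>
    and Hpoly: "\<forall>i<r. Hpoly i \<in> mpolys r \<and> mpoly_homogeneous r (Hpoly i) (dH i)"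
    and Hinv: "fundamental_invariants scale G r (\<lambda>i. mpoly_subst r (Hpoly i) Ninv) dG"
    and dN: "\<forall>i<r. \<forall>j<r. occurs_in j (Hpoly i) \<longrightarrow> degN j = dN i"
    \<comment> \<open>the fake degrees and their compatible indexing; all dN i and dH i are positive\<close>
    and eN: "fake_degrees scale N scale (UNIV :: 'v set) (\<lambda>g. g) eN"
    and eG: "fake_degrees scale G fscale (E_space r Ninv) dual_act eG"
    and eN_index: "\<forall>i<r. eN i = dN i - 1"
    and eG_index: "\<forall>i<r. eG i = dN i * (dH i - 1)"
  shows "let q = [:[:0, 1:]:] :: complex poly poly; t = [:0, 1:] in
    (\<Sum>g\<in>G. q ^ fix_dim scale (UNIV :: 'v set) g * t ^ fix_dim fscale (E_space r Ninv) (dual_act g)) =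
    (\<Prod>i<r. q * t + of_nat (eN i) * t + of_nat (eG i))"
proof -
  obtain X e where "coordinate_space scale Basis r X e" using coordinates_exist[OF V dim_V] .
  then interpret normal_pair scale Basis r X e G N Ninv Hpoly degN dN dH dG
    using G N Ninv E_stable Hpoly Hinv dN by (intro normal_pair.intro normal_pair_axioms.intro)
  have const: "poly (poly (of_nat n) [:t:]) q = of_nat n" for n and q t :: complex
    by (induction n) simp_all
  show ?thesis
    unfolding Let_def
  proof (rule bivariate_poly_eqI)
    fix q t :: complex
    have "poly (poly (\<Sum>g\<in>G. [:[:0, 1:]:] ^ fix_dim scale UNIV g * [:0, 1:] ^ fix_dim fscale (E_space r Ninv) (dual_act g)) [:t:]) q =
        (\<Sum>g\<in>G. q ^ fix_dim scale UNIV g * t ^ fix_dim fscale (E_space r Ninv) (dual_act g))"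
      by (simp add: poly_sum poly_power)
    also have "\<dots> = (\<Prod>i<r. q * t + of_nat (dN i - 1) * t + of_nat (dN i * (dH i - 1)))"
      by (rule fixed_space_sum)
    \<comment> \<open>The compatible indexing turns \<open>dN i - 1\<close> and
      \<open>dN i * (dH i - 1)\<close> into the fake degrees.\<close>
    also have "\<dots> = (\<Prod>i<r. poly (poly ([:[:0, 1:]:] * [:0, 1:] + of_nat (eN i) * [:0, 1:] + of_nat (eG i)) [:t:]) q)"
      using eN_index eG_index by (intro prod.cong) (simp_all add: const algebra_simps)
    finally show "poly (poly (\<Sum>g\<in>G. [:[:0, 1:]:] ^ fix_dim scale UNIV g * [:0, 1:] ^ fix_dim fscale (E_space r Ninv) (dual_act g)) [:t:]) q =
        poly (poly (\<Prod>i<r. [:[:0, 1:]:] * [:0, 1:] + of_nat (eN i) * [:0, 1:] + of_nat (eG i)) [:t:]) q"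
      by (simp only: poly_prod)
  qed
qed

end
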